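(* Let $S$ be any infinite set of positive even integers, and let $\Lambda$ be a positive-definite even unimodular lattice. Then $\Lambda$ is generated (as an abelian group) by elements with norm in $S$.
   Context: An even unimodular lattice is a free $\mathbb{Z}$-module $\Lambda$ of finite rank with a symmetric bilinear form $\Lambda\times\Lambda\to\mathbb{Z}$, $(x,y)\mapsto x\cdot y$, of determinant $\pm1$ such that $x\cdot x$ is even for all $x\in\Lambda$. The norm of $x\in\Lambda$ is $x\cdot x$. *)

theory Defs
  imports
    "Jordan_Normal_Form.Determinant"
    "HOL-Computational_Algebra.Group_Closure"
begin

(* The lattice is the subset L of an ambient abelian group. The parameter scale is the action of
   the integers on that group; by the module axioms it can only be repeated addition. *)

locale int_module = Modules.module scale
  for scale :: "int \<Rightarrow> 'a::ab_group_add \<Rightarrow> 'a"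
begin

definition is_basis :: "'a set \<Rightarrow> 'a list \<Rightarrow> bool" where
  "is_basis L bs \<longleftrightarrow> distinct bs \<and> independent (set bs) \<and> span (set bs) = L"

end

definition gram_mat :: "('a \<Rightarrow> 'a \<Rightarrow> int) \<Rightarrow> 'a list \<Rightarrow> int mat" where
  "gram_mat form bs = mat (length bs) (length bs) (\<lambda>(i, j). form (bs ! i) (bs ! j))"

(* The determinant of the form does not depend on the basis: a change of basis multiplies it by
   the square of a unit of the integers. So it is enough to name one basis. *)

locale even_unimodular_lattice = int_module scale
  for scale :: "int \<Rightarrow> 'a::ab_group_add \<Rightarrow> 'a" +
  fixes L :: "'a set"
    and form :: "'a \<Rightarrow> 'a \<Rightarrow> int"
  assumes form_sym: "x \<in> L \<Longrightarrow> y \<in> L \<Longrightarrow> form x y = form y x"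
    and form_add_left:
      "x \<in> L \<Longrightarrow> y \<in> L \<Longrightarrow> z \<in> L \<Longrightarrow> form (x + y) z = form x z + form y z"
    and form_scale_left:
      "x \<in> L \<Longrightarrow> y \<in> L \<Longrightarrow> form (scale k x) y = k * form x y"
    and free_unimodular:
      "\<exists>bs. is_basis L bs \<and> det (gram_mat form bs) \<in> {1, -1}"
    and form_even: "x \<in> L \<Longrightarrow> even (form x x)"

locale pos_def_even_unimodular_lattice = even_unimodular_lattice +
  assumes form_pos: "x \<in> L \<Longrightarrow> x \<noteq> 0 \<Longrightarrow> form x x > 0"

end

theory Submission
  imports Defs "HOL-Probability.Probability" "HOL-Complex_Analysis.Complex_Analysis"
    "HOL-Analysis.Kronecker_Approximation_Theorem"
begin

text \<open>Suppose the vectors with norm in \<open>S\<close> generate a proper subgroup \<open>G\<close> of \<open>\<Lambda>\<close>. A proper subgroup of a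
free abelian group of finite rank is annihilated modulo \<open>1\<close> by a rational functional that is not
integral on the whole group (\<open>proper_subgroup_functional\<close>). As \<open>\<Lambda>\<close> is unimodular, this functional is
\<open>x \<mapsto> w \<cdot> x\<close> for a rational vector \<open>w\<close> outside \<open>\<Lambda>\<close>. Write \<open>e(z) = exp (2 \<pi> i z)\<close> and compare
the two theta series
\<open>\<theta>\<^sub>0 (\<tau>) = \<Sum> e (\<tau> (x \<cdot> x) / 2)\<close> and \<open>\<theta>\<^sub>w (\<tau>) = \<Sum> e (w \<cdot> x) e (\<tau> (x \<cdot> x) / 2)\<close>. Whenever \<open>2 k\<close> lies in \<open>S\<close>, all
vectors of norm \<open>2 k\<close> have integral product with \<open>w\<close>, and the \<open>k\<close>-th coefficient of
\<open>F = \<theta>\<^sub>0 - \<theta>\<^sub>w\<close> vanishes. The circle method shows that this is impossible for large \<open>k\<close>.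

Poisson summation (\<open>poisson_lattice\<close>) gives the transformation of theta series with characteristics
under \<open>\<tau> \<mapsto> -1 / \<tau>\<close>. Together with \<open>\<tau> \<mapsto> \<tau> + 1\<close> it forces \<open>8\<close> to divide the rank (\<open>dim_dvd_8\<close>), so the weight
\<open>s\<close>, half the rank, is a positive multiple of \<open>4\<close>, and the theta series are permuted by the modular group
without any multiplier (\<open>theta_modular\<close>). At the cusp \<open>-d / c\<close> one finds
\<open>F (\<tau>) \<approx> \<kappa> (c \<tau> + d)\<^sup>-\<^sup>s\<close>, where \<open>\<kappa>\<close> has modulus at most \<open>2\<close>, and \<open>\<kappa> = 1\<close> for \<open>c = 1\<close>: the transform of
\<open>\<theta>\<^sub>0\<close> has constant term \<open>1\<close>, while that of \<open>\<theta>\<^sub>w\<close> is a sum over a translate of \<open>\<Lambda>\<close> by \<open>c w\<close>, which has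
no constant term unless \<open>c w\<close> lies in \<open>\<Lambda>\<close> (\<open>theta_diff_cusp\<close>).

Integrate \<open>F\<close> against \<open>e (- k \<tau>)\<close> along a segment of length \<open>1\<close> at height \<open>y = (s - 1) / (2 \<pi> k)\<close>. The cusp \<open>0\<close> contributes
\<open>(2 \<pi>)\<^sup>s k\<^sup>s\<^sup>-\<^sup>1 / (s - 1)!\<close> up to lower order; this is read off from the function \<open>(2 \<pi>)\<^sup>s / (1 - e (\<tau>))\<^sup>s\<close>, which has the
same pole and explicit binomial coefficients. The cusps with denominator \<open>c \<ge> 2\<close> contribute in absolute value at most
a constant times \<open>\<Sum> c\<^sup>1\<^sup>-\<^sup>s \<le> 2\<^sup>2\<^sup>-\<^sup>s\<close>, which is strictly smaller (\<open>fact_exp_bound\<close>), and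
everything else is of lower order in \<open>k\<close> (\<open>all_large_norms_avoid_kernel\<close>). Thus every large even number is the
norm of a vector outside \<open>G\<close>, which contradicts that \<open>S\<close> is infinite.\<close>

section \<open>Uniqueness of Fourier coefficients\<close>

definition e2pi :: "complex \<Rightarrow> complex" where
  "e2pi z = exp (2 * of_real pi * \<i> * z)"

lemma e2pi_0 [simp]: "e2pi 0 = 1"
  by (simp add: e2pi_def)

lemma e2pi_add: "e2pi (x + y) = e2pi x * e2pi y"
  by (simp add: e2pi_def exp_add distrib_left)

lemma e2pi_int [simp]: "e2pi (of_int k) = 1"
  using exp_integer_2pi[of "of_int k"] by (simp add: e2pi_def algebra_simps)

lemma e2pi_Ints: "x \<in> \<int> \<Longrightarrow> e2pi (of_real x) = 1"
  by (metis Ints_cases e2pi_int of_real_of_int_eq)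

lemma e2pi_eq_1_iff: "e2pi (of_real x) = 1 \<longleftrightarrow> x \<in> \<int>"
proof -
  have "e2pi (of_real x) = 1 \<longleftrightarrow> (\<exists>k::int. x = of_int k)"
    by (auto simp: e2pi_def exp_eq_1)
  thus ?thesis by (auto elim: Ints_cases)
qed

lemma norm_e2pi: "norm (e2pi z) = exp (- 2 * pi * Im z)"
  by (simp add: e2pi_def)

lemma norm_e2pi_real [simp]: "norm (e2pi (of_real x)) = 1"
  by (simp add: norm_e2pi)

lemma cnj_e2pi [simp]: "cnj (e2pi z) = e2pi (- cnj z)"
  by (simp add: e2pi_def exp_cnj)

lemma continuous_on_e2pi [continuous_intros]:
  "continuous_on A f \<Longrightarrow> continuous_on A (\<lambda>x. e2pi (f x))"
  unfolding e2pi_def by (intro continuous_intros)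

text \<open>Trigonometric polynomials, in the form that an induction over real polynomials in the real and
imaginary part of \<open>e2pi u\<close> produces.\<close>

inductive trig :: "(real \<Rightarrow> complex) \<Rightarrow> bool" where
  monom: "trig (\<lambda>u. c * e2pi (of_real (of_int k * u)))"
| add: "trig p \<Longrightarrow> trig q \<Longrightarrow> trig (\<lambda>u. p u + q u)"

lemma trig_const: "trig (\<lambda>u. c)"
  using trig.monom[of c 0] by simp

lemma trig_mult:
  assumes "trig p" "trig q" shows "trig (\<lambda>u. p u * q u)"
  using assms(1)
proof induction
  case (monom c k)
  show ?case using assms(2)
  proof induction
    case (monom c' k')
    have "(\<lambda>u. c * e2pi (of_real (of_int k * u)) * (c' * e2pi (of_real (of_int k' * u)))) =
      (\<lambda>u. (c * c') * e2pi (of_real (of_int (k + k') * u)))"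
      by (simp add: fun_eq_iff e2pi_add ring_distribs)
    then show ?case using trig.monom by metis
  next
    case (add p q)
    then show ?case by (simp add: distrib_left trig.add)
  qed
next
  case (add p1 p2)
  then show ?case by (simp add: distrib_right trig.add)
qed

lemma trig_real_polynomial:
  assumes "real_polynomial_function (p :: complex \<Rightarrow> real)"
  shows "trig (\<lambda>u. of_real (p (e2pi (of_real u))))"
  using assms
proof induction
  case (linear f)
  interpret bounded_linear f by fact
  have f: "f z = Re z * f 1 + Im z * f \<i>" for z
  proof -
    have "z = Re z *\<^sub>R 1 + Im z *\<^sub>R \<i>"
      by (simp add: complex_eq_iff)
    hence "f z = f (Re z *\<^sub>R 1 + Im z *\<^sub>R \<i>)" by (rule arg_cong)
    thus ?thesis by (simp only: add scaleR) simp
  qed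
  have "of_real (f (e2pi (of_real u))) =
    ((of_real (f 1) - \<i> * of_real (f \<i>)) / 2) * e2pi (of_real (of_int 1 * u)) +
    ((of_real (f 1) + \<i> * of_real (f \<i>)) / 2) * e2pi (of_real (of_int (-1) * u))" for u
  proof -
    have e: "e2pi (of_real (of_int (-1) * u)) = cnj (e2pi (of_real u))"
      by simp
    obtain a b where ab: "e2pi (of_real u) = Complex a b" by (cases "e2pi (of_real u)")
    have 1: "of_int 1 * u = u" by simp
    show ?thesis
      unfolding f[of "e2pi (of_real u)"] 1 e ab by (simp add: complex_eq_iff f[of "Complex a b"] field_simps)
  qed
  then show ?case
    using trig.add[OF trig.monom[of "(of_real (f 1) - \<i> * of_real (f \<i>)) / 2" 1]
       trig.monom[of "(of_real (f 1) + \<i> * of_real (f \<i>)) / 2" "-1"]] by (simp only:)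
next
  case (const c)
  then show ?case by (simp add: trig_const)
next
  case (add f g)
  then show ?case by (simp add: trig.add)
next
  case (mult f g)
  then show ?case by (simp add: trig_mult)
qed

lemma trig_polynomial:
  assumes "polynomial_function (p :: complex \<Rightarrow> complex)"
  shows "trig (\<lambda>u. p (e2pi (of_real u)))"
proof -
  have "real_polynomial_function (\<lambda>z. Re (p z))" "real_polynomial_function (\<lambda>z. Im (p z))"
    using assms bounded_linear_Re bounded_linear_Im
    unfolding polynomial_function_def o_def by blast+
  hence "trig (\<lambda>u. of_real (Re (p (e2pi (of_real u)))))" "trig (\<lambda>u. of_real (Im (p (e2pi (of_real u)))))"
    using trig_real_polynomial by force+
  from trig.add[OF this(1) trig_mult[OF trig_const[of \<i>] this(2)]]
  show ?thesis by (simp flip: complex_eq)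
qed

lemma trig_continuous: "trig p \<Longrightarrow> continuous_on A p"
  by (induction rule: trig.induct) (auto intro!: continuous_intros)

lemma periodic_int:
  assumes "\<And>u. D (u + 1) = D (u::real)"
  shows "D (u + of_int k) = D u"
proof -
  have n: "D (u + of_nat n) = D u" for n u
  proof (induction n)
    case (Suc n)
    have "D (u + of_nat (Suc n)) = D ((u + of_nat n) + 1)" by (simp add: add_ac)
    thus ?case using Suc by (simp only: assms)
  qed simp
  show ?thesis
  proof (cases "k \<ge> 0")
    case True
    then show ?thesis using n[of u "nat k"] by simp
  next
    case False
    then show ?thesis using n[of "u + of_int k" "nat (-k)"] by simp
  qed
qed

text \<open>A continuous periodic function descends to a continuous function on the unit circle, where by
Stone--Weierstrass it is a uniform limit of trigonometric polynomials. It is orthogonal to these, hence to itself.\<close>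

lemma fourier_unique:
  fixes D :: "real \<Rightarrow> complex"
  assumes cont: "continuous_on UNIV D" and per: "\<And>u. D (u + 1) = D u"
    and zero: "\<And>k::int. integral {0..1} (\<lambda>u. D u * e2pi (of_real (- of_int k * u))) = 0"
  shows "D u = 0"
proof -
  have contA: "continuous_on A D" for A using cont continuous_on_subset by blast
  have perint: "D u = D v" if "e2pi (of_real u) = e2pi (of_real v)" for u v
  proof -
    have "e2pi (of_real (u - v)) * e2pi (of_real v) = e2pi (of_real v)"
      using that by (simp flip: e2pi_add)
    moreover have "e2pi (of_real v) \<noteq> 0" by (simp add: e2pi_def)
    ultimately have "e2pi (of_real (u - v)) = 1" by simp
    then obtain k :: int where "u - v = of_int k"
      unfolding e2pi_eq_1_iff by (auto elim: Ints_cases)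
    hence "u = v + of_int k" by simp
    thus ?thesis using periodic_int[of D, OF per] by auto
  qed
  (* The function on the circle; the branch cut of Arg does no harm by periodicity. *)
  define D' where "D' z = D (Arg z / (2 * pi))" for z
  have eArg: "e2pi (of_real (Arg z / (2 * pi))) = z" if "norm z = 1" for z
    proof -
    have "z \<noteq> 0" using that by auto
    from Arg_eq[OF this] that show ?thesis by (simp add: e2pi_def mult_ac)
  qed
  have D': "D' (e2pi (of_real u)) = D u" for u
    unfolding D'_def by (intro perint eArg norm_e2pi_real)
  have contD': "continuous_on (sphere 0 1) D'"
    unfolding continuous_on_eq_continuous_within
  proof
    fix z0 :: complex assume "z0 \<in> sphere 0 1"
    hence z0: "norm z0 = 1" "z0 \<noteq> 0" by auto
    define u0 where "u0 = Arg z0 / (2 * pi)"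
    (* Rotating by z0 moves the branch cut away from the point under consideration. *)
    have eq: "D' z = D (Arg (z / z0) / (2 * pi) + u0)" if "z \<in> sphere 0 1" for z
    proof -
      have nz: "norm z = 1" using that by auto
      have "e2pi (of_real (Arg (z / z0) / (2 * pi) + u0)) = z"
        unfolding of_real_add e2pi_add u0_def using nz z0
        by (subst (1 2) eArg) (auto simp: norm_divide)
      thus ?thesis unfolding D'_def by (intro perint) (simp only: eArg nz)
    qed
    have "isCont (\<lambda>z. D (Arg (z / z0) / (2 * pi) + u0)) z0"
    proof -
      have "isCont (\<lambda>z. z / z0) z0" using z0 by (intro continuous_intros) auto
      moreover have "isCont Arg (z0 / z0)" using z0 by (intro continuous_at_Arg) auto
      ultimately have "isCont (\<lambda>z. Arg (z / z0)) z0"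
        by (rule isCont_o2)
      hence 1: "isCont (\<lambda>z. Arg (z / z0) / (2 * pi) + u0) z0"
        by (intro continuous_intros) auto
      have "isCont D x" for x using cont by (simp add: continuous_on_eq_continuous_at)
      from isCont_o2[OF 1 this] show ?thesis .
    qed
    hence "continuous (at z0 within sphere 0 1) (\<lambda>z. D (Arg (z / z0) / (2 * pi) + u0))"
      by (rule continuous_at_imp_continuous_at_within)
    thus "continuous (at z0 within sphere 0 1) D'"
      using continuous_transform_within[where f = "\<lambda>z. D (Arg (z / z0) / (2 * pi) + u0)" and g = D' and \<delta> = 1
          and x = z0 and s = "sphere 0 1"] \<open>z0 \<in> sphere 0 1\<close> eq by simp
  qed
  have ort: "integral {0..1} (\<lambda>u. D u * cnj (p u)) = 0" if "trig p" for p
    using that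
  proof induction
    case (monom c k)
    have "integral {0..1} (\<lambda>u. D u * cnj (c * e2pi (of_real (of_int k * u)))) =
       integral {0..1} (\<lambda>u. cnj c * (D u * e2pi (of_real (- of_int k * u))))"
      by (rule integral_cong) (simp add: mult_ac)
    also have "\<dots> = cnj c * 0"
      using zero[of k] by (subst integral_mult_right) simp
    finally show ?case by simp
  next
    case (add p q)
    have "(\<lambda>u. D u * cnj (p u)) integrable_on {0..1}" "(\<lambda>u. D u * cnj (q u)) integrable_on {0..1}"
      by (intro integrable_continuous_real continuous_intros contA add.hyps[THEN trig_continuous])+
    from integral_add[OF this] show ?case using add.IH by (simp add: distrib_left)
  qed
  obtain M where M: "\<And>u. u \<in> {0..1} \<Longrightarrow> norm (D u) \<le> M"
    using compact_imp_bounded[OF compact_continuous_image[OF contA compact_Icc[of 0 1]]]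
    unfolding bounded_iff by blast
  have M0: "M \<ge> 0" using order_trans[OF norm_ge_zero M[of 0]] by simp
  have int2: "integral {0..1} (\<lambda>u. D u * cnj (D u)) = 0"
  proof (rule ccontr)
    assume "\<not> ?thesis"
    define I where "I = norm (integral {0..1} (\<lambda>u. D u * cnj (D u)))"
    have I: "I > 0" using \<open>\<not> _\<close> by (simp add: I_def)
    define \<epsilon> where "\<epsilon> = I / (2 * (M + 1))"
    have \<epsilon>: "\<epsilon> > 0" using I M0 by (simp add: \<epsilon>_def)
    obtain p where p: "polynomial_function p" "\<And>z. z \<in> sphere 0 1 \<Longrightarrow> norm (D' z - p z) < \<epsilon>"
      using Stone_Weierstrass_polynomial_function[OF compact_sphere contD' \<epsilon>] by blast
    define q where "q u = p (e2pi (of_real u))" for u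
    have q: "trig q" unfolding q_def by (rule trig_polynomial) fact
    have close: "norm (D u - q u) \<le> \<epsilon>" for u
      using p(2)[of "e2pi (of_real u)"] D'[of u] by (simp add: q_def)
    have "integral {0..1} (\<lambda>u. D u * cnj (D u)) =
        integral {0..1} (\<lambda>u. D u * cnj (D u - q u) + D u * cnj (q u))"
      by (simp add: algebra_simps)
    also have "\<dots> = integral {0..1} (\<lambda>u. D u * cnj (D u - q u)) + integral {0..1} (\<lambda>u. D u * cnj (q u))"
      by (intro integral_add integrable_continuous_real continuous_intros contA trig_continuous[OF q])
    finally have "I = norm (integral {0..1} (\<lambda>u. D u * cnj (D u - q u)))"
      by (simp add: I_def ort[OF q])
    also have "\<dots> \<le> M * \<epsilon> * (1 - 0)"
    proof (rule integral_bound)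
      show "continuous_on {0..1} (\<lambda>u. D u * cnj (D u - q u))"
        by (intro continuous_intros contA trig_continuous[OF q])
      fix t :: real assume "t \<in> {0..1}"
      thus "norm (D t * cnj (D t - q t)) \<le> M * \<epsilon>"
        unfolding norm_mult complex_mod_cnj using M[of t] close[of t] M0 by (intro mult_mono) auto
    qed auto
    also have "\<dots> < I"
    proof -
      have "M * \<epsilon> = (M / (M + 1)) * (I / 2)" using M0 by (simp add: \<epsilon>_def field_simps)
      also have "\<dots> \<le> 1 * (I / 2)" using M0 I by (intro mult_right_mono) auto
      finally show ?thesis using I by simp
    qed
    finally show False by simp
  qed
  have "integral {0..1} (\<lambda>u. (norm (D u))^2) = 0"
  proof -
    have cont2: "continuous_on {0..1} (\<lambda>u. (norm (D u))^2)" by (intro continuous_intros contA)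
    have eq: "D u * cnj (D u) = of_real ((norm (D u))^2)" for u by (rule complex_norm_square[symmetric])
    have "((\<lambda>u. complex_of_real ((norm (D u))^2)) has_integral
            of_real (integral {0..1} (\<lambda>u. (norm (D u))^2))) {0..1}"
      by (intro has_integral_of_real integrable_integral integrable_continuous_real cont2)
    from integral_unique[OF this] int2 show ?thesis by (simp only: eq of_real_eq_0_iff)
  qed
  hence D0: "D u = 0" if "u \<in> {0..1}" for u
    using integral_eq_0_iff[of 0 1 "\<lambda>u. (norm (D u))^2"] that
      continuous_on_power[OF continuous_on_norm[OF contA], of "{0..1}" 2] by auto
  have "D u = D (frac u)" using periodic_int[of D "frac u" "\<lfloor>u\<rfloor>", OF per] by (simp add: frac_def)
  also have "\<dots> = 0" using frac_ge_0[of u] frac_lt_1[of u] by (intro D0) auto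
  finally show ?thesis .
qed

section \<open>Gaussian series\<close>

lemma summable_gauss0:
  assumes "c > (0::real)"
  shows "(\<lambda>m::int. exp (- c * (of_int m)^2)) summable_on UNIV"
proof -
  have geo: "(\<lambda>n::nat. exp (- c) ^ n) summable_on UNIV"
    using assms by (intro norm_summable_imp_summable_on) (auto simp: norm_power intro!: summable_geometric)
  have nat: "(\<lambda>n::nat. exp (- c * (of_nat n)^2)) summable_on UNIV"
  proof (rule summable_on_comparison_test[OF geo])
    fix n :: nat
    have "real n \<le> (real n)^2" by (cases "n = 0") (auto simp: power2_eq_square)
    hence "- c * (real n)^2 \<le> real n * (- c)" using assms by simp
    thus "exp (- c * (of_nat n)^2) \<le> exp (- c) ^ n" by (simp flip: exp_of_nat_mult)
  qed auto
  have 1: "(\<lambda>m::int. exp (- c * (of_int m)^2)) summable_on {0..}"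
  proof -
    have "bij_betw int UNIV {0..}" by (rule bij_betwI[of _ _ _ nat]) auto
    from summable_on_reindex_bij_betw[OF this, of "\<lambda>m. exp (- c * (of_int m)^2)"] nat
    show ?thesis by simp
  qed
  have 2: "(\<lambda>m::int. exp (- c * (of_int m)^2)) summable_on {..0}"
  proof -
    have "bij_betw uminus {0..} {..0::int}" by (rule bij_betwI[of _ _ _ uminus]) auto
    from summable_on_reindex_bij_betw[OF this, of "\<lambda>m. exp (- c * (of_int m)^2)"] 1
    show ?thesis by simp
  qed
  have "{0..} \<union> {..(0::int)} = UNIV" by (auto simp: not_le)
  with summable_on_union[OF 1 2] show ?thesis by (simp only:)
qed

lemma shift_square_ge: "(m + t)^2 \<ge> m^2 / 2 - (t::real)^2"
proof -
  have "2 * (m + t)^2 - (m^2 - 2 * t^2) = (m + 2 * t)^2" by (simp add: power2_eq_square algebra_simps)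
  with zero_le_power2[of "m + 2 * t"] show ?thesis by linarith
qed

text \<open>The point of the bound is uniformity: for \<open>t\<close> in a bounded set the right-hand side is a fixed summable
Gaussian, which makes shifted Gaussian series converge uniformly.\<close>

lemma exp_shift_bound:
  assumes "c \<ge> (0::real)"
  shows "exp (- c * (m + t)^2) \<le> exp (c * t^2) * exp (- (c / 2) * m^2)"
proof -
  have "- c * (m + t)^2 \<le> - c * (m^2 / 2 - t^2)"
    using mult_left_mono[OF shift_square_ge[of m t] assms] by simp
  thus ?thesis by (simp add: algebra_simps flip: exp_add)
qed

lemma summable_gauss:
  assumes "c > (0::real)"
  shows "(\<lambda>m::int. exp (- c * (of_int m + t)^2)) summable_on UNIV"
  by (rule summable_on_comparison_test[OF summable_on_cmult_right[OF summable_gauss0[of "c/2"], of "exp (c * t^2)"]])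
     (use assms exp_shift_bound in auto)

lemma summable_on_norm_comparison:
  fixes g :: "'a \<Rightarrow> 'b::banach"
  assumes "f summable_on A" "\<And>x. x \<in> A \<Longrightarrow> norm (g x) \<le> f x"
  shows "g summable_on A"
  using assms abs_summable_summable summable_on_comparison_test[OF assms(1), of "\<lambda>x. norm (g x)"] by auto

text \<open>On a disc inside the right half-plane the real part is bounded below by some \<open>d > 0\<close>, so the series is
dominated by the summable series at \<open>d\<close>.\<close>

lemma holomorphic_gauss_series:
  fixes N :: "'i \<Rightarrow> real" and c :: "'i \<Rightarrow> complex"
  assumes N: "\<And>i. i \<in> I \<Longrightarrow> N i \<ge> 0" and c: "\<And>i. i \<in> I \<Longrightarrow> norm (c i) \<le> 1"
    and sum: "\<And>r. r > 0 \<Longrightarrow> (\<lambda>i. exp (- r * N i)) summable_on I"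
  shows "(\<lambda>Y. \<Sum>\<^sub>\<infinity>i\<in>I. c i * exp (- Y * of_real (N i))) holomorphic_on {Y. Re Y > 0}"
proof -
  have "\<exists>d>0. (\<lambda>Y. \<Sum>\<^sub>\<infinity>i\<in>I. c i * exp (- Y * of_real (N i))) holomorphic_on ball Y0 d"
    if "Re Y0 > 0" for Y0
  proof -
    define d where "d = Re Y0 / 2"
    have d: "d > 0" using that by (simp add: d_def)
    have Re: "Re Y \<ge> d" if "Y \<in> cball Y0 d" for Y
    proof -
      have "\<bar>Re (Y0 - Y)\<bar> \<le> d" using that abs_Re_le_cmod[of "Y0 - Y"] by (simp add: dist_norm)
      hence "Re Y0 - Re Y \<le> d" by simp
      thus ?thesis by (simp add: d_def)
    qed
    have ul: "uniform_limit (cball Y0 d) (\<lambda>X Y. \<Sum>i\<in>X. c i * exp (- Y * of_real (N i)))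
      (\<lambda>Y. \<Sum>\<^sub>\<infinity>i\<in>I. c i * exp (- Y * of_real (N i))) (finite_subsets_at_top I)"
    proof (rule Weierstrass_m_test_general[OF _ sum[OF d]])
      fix i Y assume i: "i \<in> I" "Y \<in> cball Y0 d"
      have "norm (c i * exp (- Y * of_real (N i))) \<le> 1 * exp (- Re Y * N i)"
        unfolding norm_mult using c[OF i(1)] by (intro mult_mono) auto
      also have "\<dots> \<le> exp (- d * N i)"
        using mult_right_mono[OF Re[OF i(2)] N[OF i(1)]] by simp
      finally show "norm (c i * exp (- Y * of_real (N i))) \<le> exp (- d * N i)" .
    qed
    have "(\<lambda>Y. \<Sum>\<^sub>\<infinity>i\<in>I. c i * exp (- Y * of_real (N i))) holomorphic_on ball Y0 d"
      by (rule holomorphic_uniform_limit[OF _ ul])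
         (auto intro!: always_eventually continuous_intros holomorphic_intros)
    thus ?thesis using d by blast
  qed
  note loc = this
  show ?thesis
    unfolding holomorphic_on_def
  proof
    fix Y0 assume "Y0 \<in> {Y. Re Y > 0}"
    then obtain d where d: "d > 0" "(\<lambda>Y. \<Sum>\<^sub>\<infinity>i\<in>I. c i * exp (- Y * of_real (N i))) holomorphic_on ball Y0 d"
      using loc by blast
    show "(\<lambda>Y. \<Sum>\<^sub>\<infinity>i\<in>I. c i * exp (- Y * of_real (N i))) field_differentiable at Y0 within {Y. Re Y > 0}"
      by (rule field_differentiable_at_within, rule holomorphic_on_imp_differentiable_at[OF d(2) open_ball])
         (use d in simp)
  qed
qed

text \<open>Up to scaling this is the characteristic function of the standard normal distribution.\<close>

lemma integral_e2pi_gauss: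
  fixes Y \<beta> :: real
  assumes Y: "Y > 0"
  defines "G \<equiv> (\<lambda>x. of_real (exp (- pi * Y * x^2)) * e2pi (of_real (\<beta> * x)))"
  shows "integrable lborel G" and "integral\<^sup>L lborel G = of_real (exp (- pi * \<beta>^2 / Y) / sqrt Y)"
proof -
  define \<sigma> where "\<sigma> = sqrt (2 * pi * Y)"
  have \<sigma>: "\<sigma> > 0" using Y by (simp add: \<sigma>_def)
  have \<sigma>2: "\<sigma>^2 = 2 * pi * Y" using Y by (simp add: \<sigma>_def)
  define t where "t = 2 * pi * \<beta> / \<sigma>"
  have scaled: "std_normal_density (0 + \<sigma> * x) * 1 = exp (- pi * Y * x^2) / sqrt (2 * pi)" for x
    unfolding std_normal_density_def by (simp add: power_mult_distrib \<sigma>2 field_simps)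
  have int1: "integrable lborel (\<lambda>x. std_normal_density x *\<^sub>R iexp (t * x))"
  proof -
    have "integrable lborel (\<lambda>x. norm (std_normal_density x *\<^sub>R iexp (t * x)))"
      using integrable_normal_density[of 1 0] by (simp add: normal_density_nonneg)
    thus ?thesis by (subst (asm) integrable_norm_iff) auto
  qed
  have eq: "std_normal_density (0 + \<sigma> * x) *\<^sub>R iexp (t * (0 + \<sigma> * x)) = G x / of_real (sqrt (2 * pi))" for x
  proof -
    have "iexp (t * (0 + \<sigma> * x)) = e2pi (of_real (\<beta> * x))"
      using \<sigma> by (simp add: e2pi_def t_def field_simps)
    thus ?thesis using scaled[of x] by (simp add: G_def scaleR_conv_of_real)
  qed
  have "integrable lborel (\<lambda>x. std_normal_density (0 + \<sigma> * x) *\<^sub>R iexp (t * (0 + \<sigma> * x)))"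
    using lborel_integrable_real_affine[OF int1, of \<sigma> 0] \<sigma> by simp
  hence "integrable lborel (\<lambda>x. G x / of_real (sqrt (2 * pi)))" by (simp only: eq)
  hence "integrable lborel (\<lambda>x. G x / of_real (sqrt (2 * pi)) * of_real (sqrt (2 * pi)))"
    by (rule integrable_mult_left)
  thus "integrable lborel G" by simp
  have "of_real (exp (- (t^2) / 2)) = char std_normal_distribution t"
    by (simp add: char_std_normal_distribution)
  also have "\<dots> = integral\<^sup>L lborel (\<lambda>x. std_normal_density x *\<^sub>R iexp (t * x))"
    unfolding char_def by (subst integral_density) (auto simp: normal_density_nonneg)
  also have "\<dots> = \<bar>\<sigma>\<bar> *\<^sub>R integral\<^sup>L lborel (\<lambda>x. std_normal_density (0 + \<sigma> * x) *\<^sub>R iexp (t * (0 + \<sigma> * x)))"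
    using \<sigma> by (intro lborel_integral_real_affine) auto
  also have "\<dots> = \<sigma> *\<^sub>R (integral\<^sup>L lborel G / of_real (sqrt (2 * pi)))"
    unfolding eq using \<sigma> by simp
  finally have "integral\<^sup>L lborel G = of_real (sqrt (2 * pi) * exp (- (t^2) / 2) / \<sigma>)"
    using \<sigma> by (simp add: scaleR_conv_of_real field_simps)
  also have "sqrt (2 * pi) / \<sigma> = 1 / sqrt Y" using Y by (simp add: \<sigma>_def real_sqrt_mult)
  hence "(sqrt (2 * pi) / \<sigma>) * exp (- (t^2) / 2) = (1 / sqrt Y) * exp (- (t^2) / 2)" by (rule arg_cong)
  hence "sqrt (2 * pi) * exp (- (t^2) / 2) / \<sigma> = exp (- (t^2) / 2) / sqrt Y"
    by (simp add: field_simps)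
  also have "- (t^2) / 2 = - pi * \<beta>^2 / Y"
    unfolding t_def power_divide \<sigma>2 power_mult_distrib using Y by (simp add: field_simps power2_eq_square)
  finally show "integral\<^sup>L lborel G = of_real (exp (- pi * \<beta>^2 / Y) / sqrt Y)" .
qed

section \<open>Integrating series over a period\<close>

lemma integral_infsum:
  fixes f :: "'i \<Rightarrow> real \<Rightarrow> complex"
  assumes M: "\<And>i u. i \<in> I \<Longrightarrow> u \<in> {a..b} \<Longrightarrow> norm (f i u) \<le> M i" "M summable_on I"
    and cont: "\<And>i. i \<in> I \<Longrightarrow> continuous_on {a..b} (f i)"
  shows "((\<lambda>i. integral {a..b} (f i)) has_sum integral {a..b} (\<lambda>u. \<Sum>\<^sub>\<infinity>i\<in>I. f i u)) I"
    and "continuous_on {a..b} (\<lambda>u. \<Sum>\<^sub>\<infinity>i\<in>I. f i u)"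
proof -
  define f' where "f' i = (if i \<in> I then f i else (\<lambda>_. 0))" for i
  have cont': "continuous_on {a..b} (\<lambda>u. \<Sum>i\<in>X. f' i u)" for X
    by (intro continuous_on_sum) (auto simp: f'_def cont)
  have eq: "(\<Sum>\<^sub>\<infinity>i\<in>I. f' i u) = (\<Sum>\<^sub>\<infinity>i\<in>I. f i u)" for u
    by (rule infsum_cong) (simp add: f'_def)
  have ul: "uniform_limit {a..b} (\<lambda>X u. \<Sum>i\<in>X. f' i u) (\<lambda>u. \<Sum>\<^sub>\<infinity>i\<in>I. f' i u) (finite_subsets_at_top I)"
    by (rule Weierstrass_m_test_general[OF _ M(2)]) (simp add: f'_def M(1))
  show "continuous_on {a..b} (\<lambda>u. \<Sum>\<^sub>\<infinity>i\<in>I. f i u)"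
    using uniform_limit_theorem[OF always_eventually[OF allI[OF cont']] ul] by (simp add: eq)
  obtain A J where AJ: "\<And>X. ((\<lambda>u. \<Sum>i\<in>X. f' i u) has_integral A X) {a..b}"
    "((\<lambda>u. \<Sum>\<^sub>\<infinity>i\<in>I. f' i u) has_integral J) {a..b}" "(A \<longlongrightarrow> J) (finite_subsets_at_top I)"
    by (rule uniform_limit_integral[OF ul cont']) auto
  have J: "J = integral {a..b} (\<lambda>u. \<Sum>\<^sub>\<infinity>i\<in>I. f i u)" using integral_unique[OF AJ(2)] by (simp add: eq)
  have A: "A X = (\<Sum>i\<in>X. integral {a..b} (f i))" if "finite X" "X \<subseteq> I" for X
  proof -
    have "A X = integral {a..b} (\<lambda>u. \<Sum>i\<in>X. f' i u)" by (rule integral_unique[symmetric, OF AJ(1)])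
    also have "\<dots> = (\<Sum>i\<in>X. integral {a..b} (f' i))"
      using that by (intro integral_sum integrable_continuous_real) (auto simp: f'_def cont)
    also have "\<dots> = (\<Sum>i\<in>X. integral {a..b} (f i))"
      using that by (intro sum.cong) (auto simp: f'_def)
    finally show ?thesis .
  qed
  show "((\<lambda>i. integral {a..b} (f i)) has_sum integral {a..b} (\<lambda>u. \<Sum>\<^sub>\<infinity>i\<in>I. f i u)) I"
    unfolding has_sum_def J[symmetric] using AJ(3)
    by (rule Lim_transform_eventually) (auto intro!: eventually_finite_subsets_at_top_weakI simp: A)
qed

lemma integral_e2pi_period:
  "integral {a..a+1} (\<lambda>u. e2pi (of_real (of_int n * u))) = (if n = 0 then 1 else 0)"
proof (cases "n = 0")
  case False
  define c where "c = 2 * of_real pi * \<i> * of_int n"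
  have c: "c \<noteq> 0" using False by (simp add: c_def)
  have "((\<lambda>u. e2pi (of_real (of_int n * u))) has_integral
     (e2pi (of_real (of_int n * (a + 1))) / c - e2pi (of_real (of_int n * a)) / c)) {a..a+1}"
  proof (rule fundamental_theorem_of_calculus)
    fix x assume "x \<in> {a..a+1}"
    show "((\<lambda>u. e2pi (of_real (of_int n * u)) / c) has_vector_derivative e2pi (of_real (of_int n * x))) (at x within {a..a+1})"
      unfolding e2pi_def of_real_mult of_real_of_int_eq
      by (rule has_vector_derivative_real_field)
         (rule derivative_eq_intros refl | use c in \<open>simp add: c_def\<close>)+
  qed auto
  moreover have "e2pi (of_real (of_int n * (a + 1))) = e2pi (of_real (of_int n * a))"
    by (simp add: distrib_left e2pi_add)
  ultimately show ?thesis using False by (simp add: integral_unique)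
qed simp

text \<open>The translates of the unit interval by integers tile the line.\<close>

lemma integral_unfold:
  fixes G :: "real \<Rightarrow> complex"
  assumes cont: "continuous_on UNIV G" and int: "integrable lborel G"
    and M: "\<And>m u. u \<in> {0..1} \<Longrightarrow> norm (G (of_int m + u)) \<le> M m" "M summable_on (UNIV :: int set)"
  shows "integral {0..1} (\<lambda>u. \<Sum>\<^sub>\<infinity>m::int. G (of_int m + u)) = integral\<^sup>L lborel G"
proof -
  define J where "J = integral {0..1} (\<lambda>u. \<Sum>\<^sub>\<infinity>m::int. G (of_int m + u))"
  have contG: "continuous_on A G" for A using cont continuous_on_subset by blast
  have J: "((\<lambda>m::int. integral {0..1} (\<lambda>u. G (of_int m + u))) has_sum J) UNIV"
    unfolding J_def by (rule integral_infsum(1)[OF M(1) M(2)])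
      (auto intro!: continuous_on_compose2[OF cont] continuous_intros)
  define X where "X N = {- int N..<int N}" for N
  have "filterlim X (finite_subsets_at_top UNIV) sequentially"
    unfolding filterlim_finite_subsets_at_top
  proof (intro allI impI)
    fix Y :: "int set" assume Y: "finite Y \<and> Y \<subseteq> UNIV"
    define B where "B = Max (abs ` Y)"
    have B: "\<bar>y\<bar> \<le> B" if "y \<in> Y" for y
      unfolding B_def using Y that by (intro Max_ge) auto
    show "\<forall>\<^sub>F N in sequentially. finite (X N) \<and> Y \<subseteq> X N \<and> X N \<subseteq> UNIV"
      unfolding eventually_sequentially
    proof (intro exI allI impI)
      fix N assume "nat (B + 1) \<le> N"
      thus "finite (X N) \<and> Y \<subseteq> X N \<and> X N \<subseteq> UNIV" using B by (force simp: X_def abs_le_iff)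
    qed
  qed
  hence 1: "(\<lambda>N. \<Sum>m\<in>X N. integral {0..1} (\<lambda>u. G (of_int m + u))) \<longlonglongrightarrow> J"
    using J unfolding has_sum_def by (rule filterlim_compose[rotated])
  have shift: "integral {0..1} (\<lambda>u. G (of_int m + u)) = integral {of_int m..of_int m + 1} G" for m :: int
    using integral_shift[of 0 "of_int m" 1 G] contG by (simp add: o_def add.commute)
  have S: "(\<Sum>m\<in>X N. integral {0..1} (\<lambda>u. G (of_int m + u))) = integral {- of_nat N..of_nat N} G" for N
  proof (induction N)
    case (Suc N)
    have X: "X (Suc N) = insert (- int N - 1) (insert (int N) (X N))" by (auto simp: X_def)
    have ig: "G integrable_on {a..b}" for a b by (rule integrable_continuous_real) (rule contG)
    have "(\<Sum>m\<in>X (Suc N). integral {0..1} (\<lambda>u. G (of_int m + u))) =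
       integral {0..1} (\<lambda>u. G (of_int (- int N - 1) + u)) + (integral {0..1} (\<lambda>u. G (of_int (int N) + u))
       + integral {- of_nat N..of_nat N} G)"
      unfolding X Suc[symmetric] by (subst sum.insert, simp add: X_def, simp add: X_def)+ simp
    also have "\<dots> = (integral {- of_nat (Suc N)..- of_nat N} G + integral {- of_nat N..of_nat N} G)
       + integral {of_nat N..of_nat (Suc N)} G"
    proof -
      have e: "real_of_int (- int N - 1) = - of_nat (Suc N)" "- of_nat (Suc N) + 1 = - real N"
        "real_of_int (int N) = of_nat N" "of_nat N + 1 = real (Suc N)" by auto
      show ?thesis unfolding shift unfolding e by (simp only: add_ac)
    qed
    also have "\<dots> = integral {- of_nat (Suc N)..of_nat N} G + integral {of_nat N..of_nat (Suc N)} G"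
      by (subst Henstock_Kurzweil_Integration.integral_combine) (auto intro!: ig)
    also have "\<dots> = integral {- of_nat (Suc N)..of_nat (Suc N)} G"
      by (subst Henstock_Kurzweil_Integration.integral_combine) (auto intro!: ig)
    finally show ?case .
  qed (simp add: X_def)
  have L: "integral {- of_nat N..of_nat N} G = (LINT x|lborel. indicator {- real N..real N} x *\<^sub>R G x)" for N
    using set_borel_integral_eq_integral(2)[of "{- real N..real N}" G]
      borel_integrable_compact[OF _ contG, of "{- real N..real N}"]
    by (simp add: set_lebesgue_integral_def set_integrable_def)
  have 2: "(\<lambda>N. LINT x|lborel. indicator {- real N..real N} x *\<^sub>R G x) \<longlonglongrightarrow> integral\<^sup>L lborel G"
  proof (rule integral_dominated_convergence[where w = "\<lambda>x. norm (G x)"])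
    show "AE x in lborel. (\<lambda>N. indicator {- real N..real N} x *\<^sub>R G x) \<longlonglongrightarrow> G x"
    proof (rule AE_I2)
      fix x :: real
      obtain N0 where N0: "real N0 \<ge> \<bar>x\<bar>" using real_arch_simple by blast
      have "\<forall>\<^sub>F N in sequentially. indicator {- real N..real N} x *\<^sub>R G x = G x"
        using eventually_ge_at_top[of N0]
      proof eventually_elim
        case (elim N)
        hence "x \<in> {- real N..real N}" using N0 by auto
        thus ?case by simp
      qed
      thus "(\<lambda>N. indicator {- real N..real N} x *\<^sub>R G x) \<longlonglongrightarrow> G x" by (rule tendsto_eventually)
    qed
  next
    fix N
    show "AE x in lborel. norm (indicator {- real N..real N} x *\<^sub>R G x) \<le> norm (G x)"
      by (rule AE_I2) (auto simp: indicator_def)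
  qed (use int in auto)
  show ?thesis using LIMSEQ_unique[OF 1] 2 unfolding S L J_def by blast
qed

section \<open>The one-dimensional theta inversion\<close>

text \<open>Both sides, multiplied by \<open>e2pi (b * a)\<close>, are continuous periodic functions of \<open>a\<close>. The Fourier coefficients of the left-hand
one are Gaussian integrals over the whole line by unfolding, and those of the right-hand one can be read off.\<close>

lemma poisson_real:
  fixes Y a b :: real
  assumes Y: "Y > 0"
  shows "(\<Sum>\<^sub>\<infinity>m::int. of_real (exp (- pi * Y * (of_int m + a)^2)) * e2pi (of_real (b * of_int m))) =
    of_real (1 / sqrt Y) * (\<Sum>\<^sub>\<infinity>k::int. of_real (exp (- pi / Y * (of_int k - b)^2)) * e2pi (of_real ((of_int k - b) * a)))"
proof -
  define G where "G \<beta> x = of_real (exp (- pi * Y * x^2)) * e2pi (of_real (\<beta> * x))" for \<beta> x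
  define h where "h u = (\<Sum>\<^sub>\<infinity>m::int. G b (of_int m + u))" for u
  define c where "c k = complex_of_real (exp (- pi / Y * (of_int k - b)^2) / sqrt Y)" for k :: int
  define g where "g u = (\<Sum>\<^sub>\<infinity>k::int. c k * e2pi (of_real (of_int k * u)))" for u
  have normG: "norm (G \<beta> x) = exp (- (pi * Y) * x^2)" for \<beta> x
    unfolding G_def norm_mult norm_of_real norm_e2pi_real by simp
  have sumG: "(\<lambda>m::int. G \<beta> (of_int m + u)) summable_on UNIV" for \<beta> u
    by (rule summable_on_norm_comparison[OF summable_gauss[of "pi * Y" u]]) (use Y normG in auto)
  have contG: "continuous_on A (G \<beta>)" for A \<beta> unfolding G_def by (intro continuous_intros)
  have sumc: "(\<lambda>k. norm (c k)) summable_on UNIV"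
  proof -
    have "(\<lambda>m::int. exp (- (pi / Y) * (of_int m + (- b))^2) * (1 / sqrt Y)) summable_on UNIV"
      by (intro summable_on_cmult_left summable_gauss) (use Y in auto)
    moreover have "norm (c k) = exp (- (pi / Y) * (of_int k + (- b))^2) * (1 / sqrt Y)" for k
      unfolding c_def norm_of_real using Y by simp
    ultimately show ?thesis by simp
  qed
  have intG: "integrable lborel (G \<beta>)" "integral\<^sup>L lborel (G \<beta>) = of_real (exp (- pi * \<beta>^2 / Y) / sqrt Y)" for \<beta>
  proof -
    have "G \<beta> = (\<lambda>x. of_real (exp (- pi * Y * x^2)) * e2pi (of_real (\<beta> * x)))" by (simp add: G_def fun_eq_iff)
    with integral_e2pi_gauss[OF Y, of \<beta>]
    show "integrable lborel (G \<beta>)" "integral\<^sup>L lborel (G \<beta>) = of_real (exp (- pi * \<beta>^2 / Y) / sqrt Y)"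
      by (simp_all only:)
  qed
  define M where "M R m = exp (pi * Y * R^2) * exp (- (pi * Y / 2) * (of_int m)^2)" for R :: real and m :: int
  have sumM: "M R summable_on UNIV" for R
    unfolding M_def using Y by (intro summable_on_cmult_right summable_gauss0) auto
  have M: "norm (G \<beta> (of_int m + u)) \<le> M R m" if "\<bar>u\<bar> \<le> R" for m :: int and u \<beta> R
  proof -
    have "norm (G \<beta> (of_int m + u)) \<le> exp ((pi * Y) * u^2) * exp (- (pi * Y / 2) * (of_int m)^2)"
      unfolding normG using exp_shift_bound[of "pi * Y" "of_int m" u] Y by simp
    also have "\<dots> \<le> M R m"
    proof -
      have "u^2 \<le> R^2" using that power_mono[OF that, of 2] by simp
      thus ?thesis unfolding M_def using Y by (intro mult_right_mono) auto
    qed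
    finally show ?thesis .
  qed
  have cont_h: "continuous_on UNIV h"
  proof -
    have "continuous_on {-R..R} h" for R
      unfolding h_def
      by (rule integral_infsum(2)[OF _ sumM[of R]])
         (auto intro!: M continuous_on_compose2[OF contG] continuous_intros)
    note c = this
    have *: "continuous_on {-R<..<R} h" for R by (rule continuous_on_subset[OF c[of R]]) auto
    have "isCont h x" for x
    proof -
      have "x \<in> {-(\<bar>x\<bar> + 1)<..<\<bar>x\<bar> + 1}" by auto
      with *[of "\<bar>x\<bar> + 1"] show ?thesis by (simp only: continuous_on_eq_continuous_at open_greaterThanLessThan)
    qed
    thus ?thesis by (simp add: continuous_on_eq_continuous_at)
  qed
  have cont_g: "continuous_on UNIV g"
  proof -
    have "continuous_on {-R..R} g" for R
      unfolding g_def
      by (rule integral_infsum(2)[OF _ sumc]) (auto simp: norm_mult intro!: continuous_intros simp del: of_real_mult)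
    note c = this
    have *: "continuous_on {-R<..<R} g" for R by (rule continuous_on_subset[OF c[of R]]) auto
    have "isCont g x" for x
    proof -
      have "x \<in> {-(\<bar>x\<bar> + 1)<..<\<bar>x\<bar> + 1}" by auto
      with *[of "\<bar>x\<bar> + 1"] show ?thesis by (simp only: continuous_on_eq_continuous_at open_greaterThanLessThan)
    qed
    thus ?thesis by (simp add: continuous_on_eq_continuous_at)
  qed
  have per_h: "h (u + 1) = h u" for u
  proof -
    have "h (u + 1) = (\<Sum>\<^sub>\<infinity>m::int. G b (of_int (m + 1) + u))"
      by (simp add: h_def add_ac)
    also have "\<dots> = h u"
      unfolding h_def by (rule infsum_reindex_bij_betw[where g = "\<lambda>m. m + 1"])
         (rule bij_betwI[of _ _ _ "\<lambda>m. m - 1"]; simp)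
    finally show ?thesis .
  qed
  have per_g: "g (u + 1) = g u" for u
    unfolding g_def by (simp add: distrib_left e2pi_add)
  have coeff_h: "integral {0..1} (\<lambda>u. h u * e2pi (of_real (- of_int k * u))) = c k" for k
  proof -
    have eq: "h u * e2pi (of_real (- of_int k * u)) = (\<Sum>\<^sub>\<infinity>m::int. G (b - of_int k) (of_int m + u))" for u
    proof -
      have "h u * e2pi (of_real (- of_int k * u)) = (\<Sum>\<^sub>\<infinity>m::int. G b (of_int m + u) * e2pi (of_real (- of_int k * u)))"
        unfolding h_def by (rule infsum_cmult_left'[symmetric])
      also have "\<dots> = (\<Sum>\<^sub>\<infinity>m::int. G (b - of_int k) (of_int m + u))"
      proof (rule infsum_cong)
        fix m :: int
        have "of_real ((b - of_int k) * (of_int m + u)) =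
          of_real (b * (of_int m + u)) + of_real (- of_int k * u) + (of_int (- k * m) :: complex)"
          by (simp add: algebra_simps)
        thus "G b (of_int m + u) * e2pi (of_real (- of_int k * u)) = G (b - of_int k) (of_int m + u)"
          unfolding G_def by (simp only: e2pi_add e2pi_int mult.assoc mult_1_right)
      qed
      finally show ?thesis .
    qed
    have "integral {0..1} (\<lambda>u. h u * e2pi (of_real (- of_int k * u))) = integral\<^sup>L lborel (G (b - of_int k))"
      unfolding eq
      by (rule integral_unfold[OF contG intG(1) _ sumM[of 1]]) (rule M, simp)
    also have "\<dots> = c k"
      unfolding intG(2) c_def by (simp add: power2_commute[of b])
    finally show ?thesis .
  qed
  have coeff_g: "integral {0..1} (\<lambda>u. g u * e2pi (of_real (- of_int k * u))) = c k" for k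
  proof -
    define f where "f j u = c j * e2pi (of_real (of_int (j - k) * u))" for j and u :: real
    have eq: "g u * e2pi (of_real (- of_int k * u)) = (\<Sum>\<^sub>\<infinity>j. f j u)" for u
      unfolding g_def f_def infsum_cmult_left'[symmetric]
      by (rule infsum_cong) (simp add: algebra_simps flip: e2pi_add)
    have "((\<lambda>j. integral {0..1} (f j)) has_sum integral {0..1} (\<lambda>u. \<Sum>\<^sub>\<infinity>j. f j u)) UNIV"
      by (rule integral_infsum(1)[OF _ sumc])
         (auto simp: f_def norm_mult simp del: of_real_mult of_int_diff intro!: continuous_intros)
    moreover have "integral {0..1} (f j) = (if j = k then c k else 0)" for j
      using integral_e2pi_period[of 0 "j - k"] unfolding f_def by (subst integral_mult_right) auto
    ultimately have "((\<lambda>j. if j = k then c k else 0) has_sum integral {0..1} (\<lambda>u. \<Sum>\<^sub>\<infinity>j. f j u)) UNIV"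
      by simp
    moreover have "((\<lambda>j. if j = k then c k else 0) has_sum c k) UNIV"
      using has_sum_finite_neutralI[of "{k}" UNIV "\<lambda>j. if j = k then c k else 0"] by simp
    ultimately show ?thesis unfolding eq using has_sum_unique by blast
  qed
  have "h u - g u = 0" for u
  proof (rule fourier_unique[of "\<lambda>u. h u - g u"])
    show "integral {0..1} (\<lambda>u. (h u - g u) * e2pi (of_real (- of_int k * u))) = 0" for k
    proof -
      have i: "(\<lambda>u. h u * e2pi (of_real (- of_int k * u))) integrable_on {0..1}"
        "(\<lambda>u. g u * e2pi (of_real (- of_int k * u))) integrable_on {0..1}"
        by (intro integrable_continuous_real continuous_intros continuous_on_subset[OF cont_h]
          continuous_on_subset[OF cont_g] subset_UNIV)+
      show ?thesis
        unfolding left_diff_distrib using integral_diff[OF i] coeff_h coeff_g by simp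
    qed
  qed (simp_all add: per_h per_g continuous_on_diff cont_h cont_g)
  hence hg: "h a = g a" by simp
  have "(\<Sum>\<^sub>\<infinity>m::int. of_real (exp (- pi * Y * (of_int m + a)^2)) * e2pi (of_real (b * of_int m))) =
     h a * e2pi (of_real (- b * a))"
    unfolding h_def infsum_cmult_left'[symmetric]
  proof (rule infsum_cong)
    fix m :: int
    have "of_real (b * of_int m) = of_real (b * (of_int m + a)) + (of_real (- b * a) :: complex)"
      by (simp add: algebra_simps)
    thus "of_real (exp (- pi * Y * (of_int m + a)^2)) * e2pi (of_real (b * of_int m)) =
      G b (of_int m + a) * e2pi (of_real (- b * a))"
      unfolding G_def by (simp only: e2pi_add mult.assoc)
  qed
  also have "\<dots> = (\<Sum>\<^sub>\<infinity>k::int. of_real (1 / sqrt Y) * (of_real (exp (- pi / Y * (of_int k - b)^2)) * e2pi (of_real ((of_int k - b) * a))))"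
    unfolding hg g_def infsum_cmult_left'[symmetric]
  proof (rule infsum_cong)
    fix k :: int
    have "of_real ((of_int k - b) * a) = of_real (of_int k * a) + (of_real (- b * a) :: complex)"
      by (simp add: algebra_simps)
    hence e: "e2pi (of_real ((of_int k - b) * a)) = e2pi (of_real (of_int k * a)) * e2pi (of_real (- b * a))"
      by (simp only: e2pi_add)
    show "c k * e2pi (of_real (of_int k * a)) * e2pi (of_real (- b * a)) =
       of_real (1 / sqrt Y) * (of_real (exp (- pi / Y * (of_int k - b)^2)) * e2pi (of_real ((of_int k - b) * a)))"
      unfolding e c_def by simp
  qed
  finally show ?thesis unfolding infsum_cmult_right' .
qed

text \<open>Both sides are holomorphic in \<open>Y\<close> on the right half-plane and agree on the positive real axis.\<close>

lemma poisson_complex: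
  fixes Y :: complex and a b :: real
  assumes Y: "Re Y > 0"
  shows "(\<Sum>\<^sub>\<infinity>m::int. e2pi (of_real (b * of_int m)) * exp (- Y * of_real (pi * (of_int m + a)^2))) =
    (\<Sum>\<^sub>\<infinity>k::int. e2pi (of_real ((of_int k - b) * a)) * exp (- (1 / Y) * of_real (pi * (of_int k - b)^2))) / csqrt Y"
proof -
  define L where "L Y = (\<Sum>\<^sub>\<infinity>m::int. e2pi (of_real (b * of_int m)) * exp (- Y * of_real (pi * (of_int m + a)^2)))" for Y
  define R where "R Y = (\<Sum>\<^sub>\<infinity>k::int. e2pi (of_real ((of_int k - b) * a)) * exp (- Y * of_real (pi * (of_int k - b)^2)))" for Y
  have sum: "(\<lambda>m::int. exp (- r * (pi * (of_int m + t)^2))) summable_on UNIV" if "r > 0" for r t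
    using summable_gauss[of "r * pi" t] that by (simp add: mult_ac)
  have hL: "L holomorphic_on {Y. Re Y > 0}"
    unfolding L_def by (rule holomorphic_gauss_series[OF _ _ sum]) (simp_all del: of_real_mult)
  have hR0: "R holomorphic_on {Y. Re Y > 0}"
    unfolding R_def by (rule holomorphic_gauss_series[OF _ _ sum[where t = "- b", unfolded add_uminus_conv_diff]])
      (simp_all del: of_real_mult)
  have nn: "Y \<notin> \<real>\<^sub>\<le>\<^sub>0 \<and> Y \<noteq> 0" if "Re Y > 0" for Y
    using that by (auto simp: complex_nonpos_Reals_iff)
  have Reinv: "Re (1 / Y) > 0" if "Re Y > 0" for Y
    using that by (simp add: Re_divide zero_less_divide_iff add_pos_nonneg)
  have hR: "(\<lambda>Y. R (1 / Y) / csqrt Y) holomorphic_on {Y. Re Y > 0}"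
  proof (rule holomorphic_on_divide)
    show "csqrt holomorphic_on {Y. Re Y > 0}" by (rule holomorphic_on_subset[OF holomorphic_on_csqrt]) (use nn in auto)
    have "(\<lambda>Y. 1 / Y) holomorphic_on {Y. Re Y > 0}" using nn by (auto intro!: holomorphic_intros)
    from holomorphic_on_compose_gen[OF this hR0] Reinv
    show "(\<lambda>Y. R (1 / Y)) holomorphic_on {Y. Re Y > 0}" by (simp add: o_def image_subset_iff)
  qed (use nn in auto)
  have "(\<lambda>Y. L Y - R (1 / Y) / csqrt Y) Y = 0"
  proof (rule analytic_continuation[where f = "\<lambda>Y. L Y - R (1 / Y) / csqrt Y" and S = "{Y. Re Y > 0}" and U = "of_real ` {0<..}" and \<xi> = 1])
    show "(\<lambda>Y. L Y - R (1 / Y) / csqrt Y) holomorphic_on {Y. Re Y > 0}"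
      by (intro holomorphic_on_diff hL hR)
    show "connected {Y. 0 < Re Y}" by (intro convex_connected convex_halfspace_Re_gt)
    show "(1::complex) islimpt complex_of_real ` {0<..}"
      unfolding islimpt_approachable
    proof (intro allI impI)
      fix e :: real assume e: "e > 0"
      have "dist (complex_of_real (1 + e / 2)) 1 = e / 2"
      proof -
        have "complex_of_real (1 + e / 2) - 1 = of_real (e / 2)" by simp
        thus ?thesis unfolding dist_norm using e by (simp only: norm_of_real)
      qed
      moreover have "complex_of_real (1 + e / 2) \<noteq> 1" using e by (simp add: complex_eq_iff)
      moreover have "complex_of_real (1 + e / 2) \<in> complex_of_real ` {0<..}" using e by (intro imageI) simp
      moreover have "e / 2 < e" using e by simp
      ultimately show "\<exists>x'\<in>complex_of_real ` {0<..}. x' \<noteq> 1 \<and> dist x' 1 < e"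
        by (metis (no_types, lifting))
    qed
    fix z :: complex assume "z \<in> of_real ` {0<..}"
    then obtain y where y: "z = of_real y" "y > 0" by auto
    have "L z = (\<Sum>\<^sub>\<infinity>m::int. of_real (exp (- pi * y * (of_int m + a)^2)) * e2pi (of_real (b * of_int m)))"
      unfolding L_def y(1) by (rule infsum_cong) (simp add: mult_ac flip: exp_of_real)
    also have "\<dots> = of_real (1 / sqrt y) * (\<Sum>\<^sub>\<infinity>k::int. of_real (exp (- pi / y * (of_int k - b)^2)) * e2pi (of_real ((of_int k - b) * a)))"
      by (rule poisson_real) fact
    also have "(\<Sum>\<^sub>\<infinity>k::int. of_real (exp (- pi / y * (of_int k - b)^2)) * e2pi (of_real ((of_int k - b) * a))) = R (1 / z)"
      unfolding R_def y(1) by (rule infsum_cong) (simp add: mult_ac flip: exp_of_real)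
    finally show "L z - R (1 / z) / csqrt z = 0"
      using y by (simp add: csqrt_of_real')
  qed (use Y in \<open>auto simp: open_halfspace_Re_gt\<close>)
  thus ?thesis by (simp add: L_def R_def)
qed

section \<open>Quadratic forms and lattice points\<close>

text \<open>The integral vectors of length \<open>n\<close> as real functions; coordinates beyond \<open>n\<close> are \<open>0\<close>, so that the
rank can vary within an induction.\<close>

definition Zn :: "nat \<Rightarrow> (nat \<Rightarrow> real) set" where
  "Zn n = {x. (\<forall>i<n. x i \<in> \<int>) \<and> (\<forall>i\<ge>n. x i = 0)}"

definition qf :: "nat \<Rightarrow> (nat \<Rightarrow> nat \<Rightarrow> real) \<Rightarrow> (nat \<Rightarrow> real) \<Rightarrow> real" where
  "qf n A x = (\<Sum>i<n. \<Sum>j<n. A i j * x i * x j)"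

definition ip :: "nat \<Rightarrow> (nat \<Rightarrow> real) \<Rightarrow> (nat \<Rightarrow> real) \<Rightarrow> real" where
  "ip n b x = (\<Sum>i<n. b i * x i)"

text \<open>Positive definiteness in the quantitative form that yields convergence of all Gaussian series.\<close>

definition coercive :: "nat \<Rightarrow> ((nat \<Rightarrow> real) \<Rightarrow> real) \<Rightarrow> bool" where
  "coercive n q \<longleftrightarrow> (\<exists>\<epsilon>>0. \<forall>x. q x \<ge> \<epsilon> * (\<Sum>i<n. (x i)^2))"

lemma Zn_0: "Zn 0 = {\<lambda>_. 0}"
  by (auto simp: Zn_def fun_eq_iff)

lemma bij_Zn_Suc: "bij_betw (\<lambda>(x, m). x(n := of_int m)) (Zn n \<times> (UNIV :: int set)) (Zn (Suc n))"
proof (rule bij_betwI[where g = "\<lambda>y. (y(n := 0), \<lfloor>y n\<rfloor>)"])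
  show "(\<lambda>(x, m). x(n := of_int m)) \<in> Zn n \<times> (UNIV :: int set) \<rightarrow> Zn (Suc n)"
    by (auto simp: Zn_def less_Suc_eq)
  show "(\<lambda>y. (y(n := 0), \<lfloor>y n\<rfloor>)) \<in> Zn (Suc n) \<rightarrow> Zn n \<times> UNIV"
    by (auto simp: Zn_def less_Suc_eq)
  show "(\<lambda>y. (y(n := 0), \<lfloor>y n\<rfloor>)) ((\<lambda>(x, m). x(n := real_of_int m)) z) = z" if "z \<in> Zn n \<times> UNIV" for z
    using that by (auto simp: Zn_def fun_eq_iff split: prod.splits)
  show "(\<lambda>(x, m). x(n := real_of_int m)) ((\<lambda>y. (y(n := 0), \<lfloor>y n\<rfloor>)) y) = y" if "y \<in> Zn (Suc n)" for y
    using that by (auto simp: Zn_def fun_eq_iff elim: Ints_cases)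
qed

lemma summable_product:
  fixes f :: "'a \<Rightarrow> real" and g :: "'b \<Rightarrow> real"
  assumes "f summable_on A" "g summable_on B" "\<And>x. x \<in> A \<Longrightarrow> f x \<ge> 0" "\<And>y. y \<in> B \<Longrightarrow> g y \<ge> 0"
  shows "(\<lambda>(x, y). f x * g y) summable_on A \<times> B"
proof (rule summable_on_SigmaI)
  show "((\<lambda>y. case (x, y) of (x, y) \<Rightarrow> f x * g y) has_sum f x * infsum g B) B" if "x \<in> A" for x
    using has_sum_cmult_right[OF has_sum_infsum[OF assms(2)]] by simp
  show "(\<lambda>x. f x * infsum g B) summable_on A" by (rule summable_on_cmult_left) fact
qed (use assms in auto)

lemma infsum_Zn_Suc:
  fixes f :: "(nat \<Rightarrow> real) \<Rightarrow> complex"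
  assumes "f summable_on Zn (Suc n)"
  shows "infsum f (Zn (Suc n)) = (\<Sum>\<^sub>\<infinity>x\<in>Zn n. \<Sum>\<^sub>\<infinity>m::int. f (x(n := of_int m)))"
proof -
  have s: "(\<lambda>(x, m). f (x(n := real_of_int m))) summable_on Zn n \<times> UNIV"
    using assms summable_on_reindex_bij_betw[OF bij_Zn_Suc[of n], of f] by (simp add: case_prod_unfold)
  have "infsum f (Zn (Suc n)) = infsum (\<lambda>(x, m). f (x(n := real_of_int m))) (Zn n \<times> UNIV)"
    using infsum_reindex_bij_betw[OF bij_Zn_Suc[of n], of f] by (simp add: case_prod_unfold)
  also have "\<dots> = (\<Sum>\<^sub>\<infinity>x\<in>Zn n. \<Sum>\<^sub>\<infinity>m::int. f (x(n := of_int m)))"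
    by (rule infsum_Sigma'_banach[symmetric]) (rule s)
  finally show ?thesis .
qed

lemma summable_Zn_square:
  assumes "c > 0"
  shows "(\<lambda>x. exp (- c * (\<Sum>i<n. (x i + t i)^2))) summable_on Zn n"
proof (induction n)
  case (Suc n)
  have "(\<lambda>(x, m). exp (- c * (\<Sum>i<n. (x i + t i)^2)) * exp (- c * (of_int m + t n)^2)) summable_on Zn n \<times> (UNIV :: int set)"
    by (rule summable_product[OF Suc summable_gauss[OF assms]]) auto
  also have "?this \<longleftrightarrow> (\<lambda>z. exp (- c * (\<Sum>i<Suc n. ((case z of (x, m) \<Rightarrow> x(n := real_of_int m)) i + t i)^2))) summable_on Zn n \<times> UNIV"
    by (intro summable_on_cong) (auto simp: distrib_left simp flip: exp_add)
  also have "\<dots> \<longleftrightarrow> (\<lambda>x. exp (- c * (\<Sum>i<Suc n. (x i + t i)^2))) summable_on Zn (Suc n)"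
    by (rule summable_on_reindex_bij_betw[OF bij_Zn_Suc])
  finally show ?case .
qed (simp add: Zn_0)

lemma summable_coercive:
  assumes "coercive n q" "c > 0"
  shows "(\<lambda>x. exp (- c * q (\<lambda>i. x i + t i))) summable_on Zn n"
proof -
  obtain \<epsilon> where \<epsilon>: "\<epsilon> > 0" "\<And>x. q x \<ge> \<epsilon> * (\<Sum>i<n. (x i)^2)"
    using assms(1) by (auto simp: coercive_def)
  show ?thesis
  proof (rule summable_on_comparison_test)
    show "(\<lambda>x. exp (- (c * \<epsilon>) * (\<Sum>i<n. (x i + t i)^2))) summable_on Zn n"
      using \<epsilon> assms by (intro summable_Zn_square) auto
    fix x :: "nat \<Rightarrow> real"
    show "exp (- c * q (\<lambda>i. x i + t i)) \<le> exp (- (c * \<epsilon>) * (\<Sum>i<n. (x i + t i)^2))"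
      using mult_left_mono[OF \<epsilon>(2)[of "\<lambda>i. x i + t i"], of c] assms(2) by (simp add: mult.assoc)
  qed auto
qed

lemma coercive_nonneg: "coercive n q \<Longrightarrow> q x \<ge> 0"
  unfolding coercive_def by (meson order_trans mult_nonneg_nonneg sum_nonneg zero_le_power2 less_imp_le)

text \<open>Completing the square in the last variable; the remaining form is the Schur complement.\<close>

lemma qf_complete_square:
  fixes A :: "nat \<Rightarrow> nat \<Rightarrow> real"
  assumes sym: "\<And>i. i < n \<Longrightarrow> A i n = A n i" and nz: "A n n \<noteq> 0"
  shows "qf (Suc n) A x = A n n * (x n + ip n (\<lambda>j. A n j / A n n) x)^2 +
     qf n (\<lambda>i j. A i j - A n i * A n j / A n n) x"
proof -
  define L where "L = (\<Sum>j<n. A n j * x j)"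
  have "ip n (\<lambda>j. A n j / A n n) x = L / A n n"
    by (simp add: ip_def L_def sum_divide_distrib)
  moreover have "qf n (\<lambda>i j. A i j - A n i * A n j / A n n) x = qf n A x - L^2 / A n n"
  proof -
    have "L^2 / A n n = (\<Sum>i<n. \<Sum>j<n. A n i * A n j / A n n * x i * x j)"
      unfolding L_def power2_eq_square sum_product sum_divide_distrib by (simp add: mult_ac)
    thus ?thesis by (simp add: qf_def left_diff_distrib sum_subtractf)
  qed
  moreover have "qf (Suc n) A x = qf n A x + 2 * x n * L + A n n * (x n)^2"
  proof -
    have "(\<Sum>i<n. A i n * x i * x n) = x n * L"
      unfolding L_def sum_distrib_left by (rule sum.cong) (auto simp: sym)
    moreover have "(\<Sum>j<n. A n j * x n * x j) = x n * L"
      unfolding L_def sum_distrib_left by (rule sum.cong) auto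
    ultimately show ?thesis by (simp add: qf_def sum.distrib power2_eq_square)
  qed
  ultimately show ?thesis using nz by (simp add: power2_eq_square distrib_left distrib_right add_divide_distrib)
qed

text \<open>By Cauchy--Schwarz the shift \<open>ip n \<mu> x\<close> is controlled by the first \<open>n\<close> coordinates, so a small multiple of the new square
can be traded for the square of the last coordinate alone.\<close>

lemma coercive_Suc:
  assumes q': "coercive n q'" and \<alpha>: "\<alpha> > 0"
  shows "coercive (Suc n) (\<lambda>x. \<alpha> * (x n + ip n \<mu> x)^2 + q' x)"
proof -
  obtain \<epsilon> where \<epsilon>: "\<epsilon> > 0" "\<And>x. q' x \<ge> \<epsilon> * (\<Sum>i<n. (x i)^2)"
    using q' by (auto simp: coercive_def)
  define D where "D = (\<Sum>i<n. (\<mu> i)^2) + 1"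
  have D: "D > 0" unfolding D_def by (intro add_nonneg_pos sum_nonneg) auto
  define \<delta> where "\<delta> = min \<alpha> (\<epsilon> / (2 * D))"
  have \<delta>: "\<delta> > 0" "\<delta> \<le> \<alpha>" "\<delta> * D \<le> \<epsilon> / 2"
  proof -
    show "\<delta> > 0" "\<delta> \<le> \<alpha>" using \<alpha> \<epsilon> D by (auto simp: \<delta>_def)
    have "\<delta> * D \<le> \<epsilon> / (2 * D) * D" using D by (intro mult_right_mono) (auto simp: \<delta>_def)
    thus "\<delta> * D \<le> \<epsilon> / 2" using D by simp
  qed
  show ?thesis unfolding coercive_def
  proof (intro exI[of _ "min (\<delta> / 2) (\<epsilon> / 2)"] conjI allI)
    fix x :: "nat \<Rightarrow> real"
    define S where "S = (\<Sum>i<n. (x i)^2)"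
    define P where "P = ip n \<mu> x"
    have S: "S \<ge> 0" by (simp add: S_def sum_nonneg)
    have "P^2 \<le> (\<Sum>i<n. (\<mu> i)^2) * S"
      unfolding P_def ip_def S_def by (rule Cauchy_Schwarz_ineq_sum)
    also have "\<dots> \<le> D * S" using S by (intro mult_right_mono) (auto simp: D_def)
    finally have P: "P^2 \<le> D * S" .
    have "min (\<delta> / 2) (\<epsilon> / 2) * (\<Sum>i<Suc n. (x i)^2) = min (\<delta> / 2) (\<epsilon> / 2) * S + min (\<delta> / 2) (\<epsilon> / 2) * (x n)^2"
      by (simp add: S_def distrib_left)
    also have "\<dots> \<le> (\<epsilon> / 2) * S + \<delta> / 2 * (x n)^2"
      by (intro add_mono mult_right_mono) (auto simp: S)
    also have "\<dots> = \<delta> * ((x n)^2 / 2) - \<epsilon> / 2 * S + \<epsilon> * S" by (simp add: algebra_simps)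
    also have "\<dots> \<le> \<delta> * ((x n)^2 / 2) - \<delta> * D * S + \<epsilon> * S"
      using mult_right_mono[OF \<delta>(3) S] by (simp add: mult_ac)
    also have "\<dots> = \<delta> * ((x n)^2 / 2 - D * S) + \<epsilon> * S" by (simp add: algebra_simps)
    also have "\<dots> \<le> \<delta> * (x n + P)^2 + q' x"
    proof (intro add_mono mult_left_mono)
      show "(x n)^2 / 2 - D * S \<le> (x n + P)^2" using shift_square_ge[of "x n" P] P by linarith
      show "\<epsilon> * S \<le> q' x" using \<epsilon>(2)[of x] by (simp add: S_def)
    qed (use \<delta> in auto)
    also have "\<dots> \<le> \<alpha> * (x n + P)^2 + q' x"
      using \<delta> by (intro add_mono mult_right_mono) auto
    finally show "min (\<delta> / 2) (\<epsilon> / 2) * (\<Sum>i<Suc n. (x i)^2) \<le> \<alpha> * (x n + ip n \<mu> x)^2 + q' x"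
      unfolding P_def .
  qed (use \<delta> \<epsilon> in auto)
qed

text \<open>This is the shape that the dual form takes when one variable is added: the new dual variable enters all others by a
shear.\<close>

lemma coercive_dual_Suc:
  assumes q': "coercive n q'" and \<alpha>: "\<alpha> > 0"
  shows "coercive (Suc n) (\<lambda>k. \<alpha> * (k n)^2 + q' (\<lambda>j. k j - k n * \<mu> j))"
proof -
  obtain \<epsilon> where \<epsilon>: "\<epsilon> > 0" "\<And>x. q' x \<ge> \<epsilon> * (\<Sum>i<n. (x i)^2)"
    using q' by (auto simp: coercive_def)
  define D where "D = (\<Sum>i<n. (\<mu> i)^2) + 1"
  have D: "D > 0" unfolding D_def by (intro add_nonneg_pos sum_nonneg) auto
  define \<delta> where "\<delta> = min \<epsilon> (\<alpha> / (2 * D))"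
  have \<delta>: "\<delta> > 0" "\<delta> \<le> \<epsilon>" "\<delta> * D \<le> \<alpha> / 2"
  proof -
    show "\<delta> > 0" "\<delta> \<le> \<epsilon>" using \<alpha> \<epsilon> D by (auto simp: \<delta>_def)
    have "\<delta> * D \<le> \<alpha> / (2 * D) * D" using D by (intro mult_right_mono) (auto simp: \<delta>_def)
    thus "\<delta> * D \<le> \<alpha> / 2" using D by simp
  qed
  show ?thesis unfolding coercive_def
  proof (intro exI[of _ "min (\<delta> / 2) (\<alpha> / 2)"] conjI allI)
    fix k :: "nat \<Rightarrow> real"
    define S where "S = (\<Sum>i<n. (k i)^2)"
    define S' where "S' = (\<Sum>i<n. (k i - k n * \<mu> i)^2)"
    have S: "S \<ge> 0" by (simp add: S_def sum_nonneg)
    have S': "S' \<ge> 0" by (simp add: S'_def sum_nonneg)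
    have "S / 2 - D * (k n)^2 \<le> (\<Sum>i<n. (k i)^2 / 2 - (k n)^2 * (\<mu> i)^2)"
    proof -
      have "(\<Sum>i<n. (k i)^2 / 2 - (k n)^2 * (\<mu> i)^2) = S / 2 - (k n)^2 * (\<Sum>i<n. (\<mu> i)^2)"
        by (simp add: S_def sum_subtractf sum_divide_distrib sum_distrib_left)
      thus ?thesis by (simp add: D_def algebra_simps)
    qed
    also have "\<dots> \<le> S'"
      unfolding S'_def
    proof (rule sum_mono)
      fix i show "(k i)^2 / 2 - (k n)^2 * (\<mu> i)^2 \<le> (k i - k n * \<mu> i)^2"
        using shift_square_ge[of "k i" "- (k n * \<mu> i)"] by (simp add: power_mult_distrib)
    qed
    finally have SS: "S / 2 - D * (k n)^2 \<le> S'" .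
    have "min (\<delta> / 2) (\<alpha> / 2) * (\<Sum>i<Suc n. (k i)^2) = min (\<delta> / 2) (\<alpha> / 2) * S + min (\<delta> / 2) (\<alpha> / 2) * (k n)^2"
      by (simp add: S_def distrib_left)
    also have "\<dots> \<le> (\<delta> / 2) * S + \<alpha> / 2 * (k n)^2"
      by (intro add_mono mult_right_mono) (auto simp: S)
    also have "\<dots> = \<alpha> * (k n)^2 + \<delta> * (S / 2) - \<alpha> / 2 * (k n)^2" by (simp add: algebra_simps)
    also have "\<dots> \<le> \<alpha> * (k n)^2 + \<delta> * (S / 2) - \<delta> * D * (k n)^2"
      using mult_right_mono[OF \<delta>(3), of "(k n)^2"] by (simp add: mult_ac)
    also have "\<dots> = \<alpha> * (k n)^2 + \<delta> * (S / 2 - D * (k n)^2)" by (simp add: algebra_simps)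
    also have "\<dots> \<le> \<alpha> * (k n)^2 + \<delta> * S'"
      using SS \<delta> by (intro add_left_mono mult_left_mono) auto
    also have "\<dots> \<le> \<alpha> * (k n)^2 + \<epsilon> * S'" using S' \<delta> by (intro add_left_mono mult_right_mono) auto
    also have "\<dots> \<le> \<alpha> * (k n)^2 + q' (\<lambda>j. k j - k n * \<mu> j)"
      using \<epsilon>(2)[of "\<lambda>j. k j - k n * \<mu> j"] by (simp add: S'_def)
    finally show "min (\<delta> / 2) (\<alpha> / 2) * (\<Sum>i<Suc n. (k i)^2) \<le> \<alpha> * (k n)^2 + q' (\<lambda>j. k j - k n * \<mu> j)" .
  qed (use \<delta> \<alpha> in auto)
qed

section \<open>Poisson summation for a positive definite form\<close>

lemma Re_inverse_pos: "Re Y > 0 \<Longrightarrow> Re (1 / Y) > 0"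
  by (simp add: Re_divide zero_less_divide_iff add_pos_nonneg)

lemma norm_exp_of_real: "norm (exp (- Y * of_real r)) = exp (- Re Y * r)"
  by simp

lemma ip_Suc_upd: "ip (Suc n) b (x(n := m)) = ip n b x + b n * m"
  by (simp add: ip_def)

lemma ip_cong: "(\<And>i. i < n \<Longrightarrow> b i = b' i) \<Longrightarrow> (\<And>i. i < n \<Longrightarrow> x i = x' i) \<Longrightarrow> ip n b x = ip n b' x'"
  by (simp add: ip_def)

lemma qf_cong: "(\<And>i. i < n \<Longrightarrow> x i = x' i) \<Longrightarrow> qf n A x = qf n A x'"
  by (simp add: qf_def)

text \<open>\<open>Q'\<close> is the dual form, that is the form of the inverse matrix; it is characterised by its values on the image of \<open>A\<close>, and
\<open>C\<close> is the inverse covolume. Neither has to be computed: for a unimodular lattice the dual form is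
the form itself in other coordinates, and \<open>C = 1\<close> follows by evaluating the formula at a fixed point.\<close>

definition poisson_dual ::
    "nat \<Rightarrow> (nat \<Rightarrow> nat \<Rightarrow> real) \<Rightarrow> real \<Rightarrow> ((nat \<Rightarrow> real) \<Rightarrow> real) \<Rightarrow> bool" where
  "poisson_dual n A C Q' \<longleftrightarrow> coercive n Q' \<and>
    (\<forall>x z. (\<forall>i<n. x i = z i) \<longrightarrow> Q' x = Q' z) \<and>
    (\<forall>x. Q' (\<lambda>i. \<Sum>j<n. A i j * x j) = qf n A x) \<and>
    (\<forall>Y a b. Re Y > 0 \<longrightarrow>
      (\<Sum>\<^sub>\<infinity>x\<in>Zn n. e2pi (of_real (ip n b x)) * exp (- Y * of_real (pi * qf n A (\<lambda>i. x i + a i)))) =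
      of_real C / csqrt Y ^ n *
       (\<Sum>\<^sub>\<infinity>k\<in>Zn n. e2pi (of_real (ip n (\<lambda>i. k i - b i) a)) * exp (- (1 / Y) * of_real (pi * Q' (\<lambda>i. k i - b i)))))"

lemma poisson_dualD:
  assumes "poisson_dual n A C Q'"
  shows "coercive n Q'" and "(\<And>i. i < n \<Longrightarrow> x i = z i) \<Longrightarrow> Q' x = Q' z"
    and "Q' (\<lambda>i. \<Sum>j<n. A i j * x j) = qf n A x"
    and "Re Y > 0 \<Longrightarrow>
      (\<Sum>\<^sub>\<infinity>x\<in>Zn n. e2pi (of_real (ip n b x)) * exp (- Y * of_real (pi * qf n A (\<lambda>i. x i + a i)))) =
      of_real C / csqrt Y ^ n *
       (\<Sum>\<^sub>\<infinity>k\<in>Zn n. e2pi (of_real (ip n (\<lambda>i. k i - b i) a)) * exp (- (1 / Y) * of_real (pi * Q' (\<lambda>i. k i - b i))))"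
  using assms unfolding poisson_dual_def by (elim conjE, simp)+

text \<open>Induction on the number of variables. After completing the square, the last variable occurs in a single square, and the
one-dimensional formula applies to it; its dual variable then only changes the character in the other variables, so the
induction hypothesis for the Schur complement applies. Positive definiteness is only required at rational vectors, since
this is what an integral form provides and it is inherited by the Schur complement.\<close>

theorem poisson_lattice:
  fixes A :: "nat \<Rightarrow> nat \<Rightarrow> real"
  assumes "\<And>i j. i < n \<Longrightarrow> j < n \<Longrightarrow> A i j = A j i" "\<And>i j. i < n \<Longrightarrow> j < n \<Longrightarrow> A i j \<in> \<rat>"
    and "\<And>x. (\<And>i. i < n \<Longrightarrow> x i \<in> \<rat>) \<Longrightarrow> (\<exists>i<n. x i \<noteq> 0) \<Longrightarrow> qf n A x > 0"
  shows "coercive n (qf n A) \<and> (\<exists>C>0. \<exists>Q'. poisson_dual n A C Q')"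
  using assms
proof (induction n arbitrary: A)
  case 0
  show ?case
  proof (intro conjI exI[of _ 1] exI[of _ "\<lambda>_. 0"])
    show "coercive 0 (qf 0 A)" by (auto simp: coercive_def qf_def intro!: exI[of _ 1])
    have "coercive 0 (\<lambda>_. 0)" by (auto simp: coercive_def intro!: exI[of _ 1])
    thus "poisson_dual 0 A 1 (\<lambda>_. 0)" unfolding poisson_dual_def by (simp add: Zn_0 ip_def qf_def)
  qed simp
next
  case (Suc n)
  define \<alpha> where "\<alpha> = A n n"
  define \<mu> where "\<mu> j = A n j / A n n" for j
  define A' where "A' i j = A i j - A n i * A n j / A n n" for i j
  have qf_unit: "qf (Suc n) A (\<lambda>i. if i = n then 1 else 0) = \<alpha>"
  proof -
    have "(\<Sum>i<n. \<Sum>j<Suc n. A i j * (if i = n then 1 else 0) * (if j = n then 1 else 0)) = (0::real)"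
      by (intro sum.neutral ballI) auto
    moreover have "(\<Sum>j<n. A n j * (if n = n then 1 else 0) * (if j = n then 1 else 0)) = (0::real)"
      by (intro sum.neutral ballI) auto
    ultimately show ?thesis unfolding qf_def sum.lessThan_Suc[of _ n] by (simp add: \<alpha>_def)
  qed
  have \<alpha>: "\<alpha> > 0"
    unfolding qf_unit[symmetric] by (rule Suc.prems(3)) auto
  have rat: "\<mu> j \<in> \<rat>" if "j < n" for j using Suc.prems(2)[of n] that by (auto simp: \<mu>_def)
  have square: "qf (Suc n) A x = \<alpha> * (x n + ip n \<mu> x)^2 + qf n A' x" for x
    unfolding \<alpha>_def \<mu>_def[abs_def] A'_def[abs_def]
    by (rule qf_complete_square) (use Suc.prems(1) \<alpha> in \<open>auto simp: \<alpha>_def\<close>)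
  have pd': "qf n A' x > 0" if x: "\<And>i. i < n \<Longrightarrow> x i \<in> \<rat>" and nz: "\<exists>i<n. x i \<noteq> 0" for x
  proof -
    define z where "z = x(n := - ip n \<mu> x)"
    have "ip n \<mu> x \<in> \<rat>" unfolding ip_def by (intro Rats_sum Rats_mult rat x) auto
    hence "z i \<in> \<rat>" if "i < Suc n" for i using x that by (auto simp: z_def less_Suc_eq)
    moreover obtain i where i: "i < n" "x i \<noteq> 0" using nz by blast
    hence "\<exists>i<Suc n. z i \<noteq> 0" by (intro exI[of _ i]) (auto simp: z_def)
    ultimately have "qf (Suc n) A z > 0" by (rule Suc.prems(3))
    moreover have "ip n \<mu> z = ip n \<mu> x" "qf n A' z = qf n A' x"
      by (auto intro!: ip_cong qf_cong simp: z_def)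
    ultimately show ?thesis unfolding square by (simp add: z_def)
  qed
  have sym': "A' i j = A' j i" if "i < n" "j < n" for i j
    using Suc.prems(1)[of i j] that by (simp add: A'_def)
  have rat': "A' i j \<in> \<rat>" if "i < n" "j < n" for i j
    unfolding A'_def using that by (intro Rats_diff Rats_divide Rats_mult Suc.prems(2)) auto
  from Suc.IH[OF sym' rat' pd']
  obtain C' Q' where co': "coercive n (qf n A')" and C': "C' > 0" and PD: "poisson_dual n A' C' Q'" by blast
  note coQ' = poisson_dualD(1)[OF PD] and cong' = poisson_dualD(2)[OF PD]
    and dual' = poisson_dualD(3)[OF PD] and IH = poisson_dualD(4)[OF PD]
  define Q where "Q k = (1 / \<alpha>) * (k n)^2 + Q' (\<lambda>j. k j - k n * \<mu> j)" for k
  have co: "coercive (Suc n) (qf (Suc n) A)"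
    using coercive_Suc[OF co' \<alpha>, of \<mu>] square by (simp add: coercive_def)
  have coQ: "coercive (Suc n) Q"
    unfolding Q_def[abs_def] by (rule coercive_dual_Suc[OF coQ']) (use \<alpha> in simp)
  have cong: "Q x = Q z" if "\<forall>i<Suc n. x i = z i" for x z
    using that cong'[of "\<lambda>j. x j - x n * \<mu> j" "\<lambda>j. z j - z n * \<mu> j"] by (simp add: Q_def)
  have dual: "Q (\<lambda>i. \<Sum>j<Suc n. A i j * x j) = qf (Suc n) A x" for x
  proof -
    define k where "k i = (\<Sum>j<Suc n. A i j * x j)" for i
    have kn: "k n = \<alpha> * (x n + ip n \<mu> x)"
      using \<alpha> by (simp add: k_def ip_def \<mu>_def \<alpha>_def distrib_left sum_distrib_left)
    have kj: "k j - k n * \<mu> j = (\<Sum>l<n. A' j l * x l)" if "j < n" for j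
    proof -
      have "k n * \<mu> j = A n j * x n + (\<Sum>l<n. A n j * A n l / A n n * x l)"
        using \<alpha> unfolding kn by (simp add: \<mu>_def \<alpha>_def ip_def distrib_left distrib_right sum_distrib_left sum_distrib_right sum_divide_distrib mult_ac)
      moreover have "k j = (\<Sum>l<n. A j l * x l) + A n j * x n"
        using Suc.prems(1)[of j n] that by (simp add: k_def)
      ultimately show ?thesis by (simp add: A'_def left_diff_distrib sum_subtractf)
    qed
    have "Q k = (1 / \<alpha>) * (\<alpha> * (x n + ip n \<mu> x))^2 + Q' (\<lambda>j. k j - k n * \<mu> j)"
      unfolding Q_def kn ..
    also have "Q' (\<lambda>j. k j - k n * \<mu> j) = qf n A' x"
      unfolding dual'[symmetric] by (rule cong') (rule kj)
    also have "(1 / \<alpha>) * (\<alpha> * (x n + ip n \<mu> x))^2 = \<alpha> * (x n + ip n \<mu> x)^2"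
      using \<alpha> by (simp add: power2_eq_square)
    finally show ?thesis unfolding square k_def .
  qed
  define C where "C = C' / sqrt \<alpha>"
  have C: "C > 0" using C' \<alpha> by (simp add: C_def)
  have formula: "(\<Sum>\<^sub>\<infinity>x\<in>Zn (Suc n). e2pi (of_real (ip (Suc n) b x)) * exp (- Y * of_real (pi * qf (Suc n) A (\<lambda>i. x i + a i)))) =
      of_real C / csqrt Y ^ Suc n *
       (\<Sum>\<^sub>\<infinity>k\<in>Zn (Suc n). e2pi (of_real (ip (Suc n) (\<lambda>i. k i - b i) a)) * exp (- (1 / Y) * of_real (pi * Q (\<lambda>i. k i - b i))))"
    if Y: "Re Y > 0" for Y a b
  proof -
    have ReY: "Re (1 / Y) > 0"
      by (rule Re_inverse_pos) fact
    have Y\<alpha>: "Re (Y * of_real \<alpha>) > 0" "Re (1 / (Y * of_real \<alpha>)) > 0"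
    proof -
      show "Re (Y * of_real \<alpha>) > 0" using Y \<alpha> by simp
      thus "Re (1 / (Y * of_real \<alpha>)) > 0" by (rule Re_inverse_pos)
    qed
    have csq: "csqrt (Y * of_real \<alpha>) = csqrt Y * of_real (sqrt \<alpha>)"
    proof -
      have "csqrt (of_real \<alpha> * Y) = csqrt (of_real \<alpha>) * csqrt Y"
        using \<alpha> Arg_le_pi[of Y] mpi_less_Arg[of Y] by (intro csqrt_mult) (auto simp: Arg_of_real)
      thus ?thesis using \<alpha> by (simp add: mult.commute csqrt_of_real')
    qed
    define t where "t x = a n + ip n \<mu> (\<lambda>i. x i + a i)" for x
    define f1 where "f1 x = e2pi (of_real (ip n b x)) * exp (- Y * of_real (pi * qf n A' (\<lambda>i. x i + a i)))" for x
    define h where "h l = exp (- (1 / (Y * of_real \<alpha>)) * of_real (pi * (of_int l - b n)^2))" for l :: int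
    define F where "F x = e2pi (of_real (ip (Suc n) b x)) * exp (- Y * of_real (pi * qf (Suc n) A (\<lambda>i. x i + a i)))" for x
    define H where "H k = e2pi (of_real (ip (Suc n) (\<lambda>i. k i - b i) a)) * exp (- (1 / Y) * of_real (pi * Q (\<lambda>i. k i - b i)))" for k
    have sumF: "F summable_on Zn (Suc n)"
    proof (rule summable_on_norm_comparison[OF summable_coercive[OF co, of "Re Y * pi" a]])
      show "norm (F x) \<le> exp (- (Re Y * pi) * qf (Suc n) A (\<lambda>i. x i + a i))" for x
        unfolding F_def norm_mult norm_exp_of_real by (simp add: mult_ac)
    qed (use Y in auto)
    have sumH: "H summable_on Zn (Suc n)"
    proof (rule summable_on_norm_comparison[OF summable_coercive[OF coQ, of "Re (1/Y) * pi" "\<lambda>i. - b i"]])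
      show "norm (H x) \<le> exp (- (Re (1/Y) * pi) * Q (\<lambda>i. x i + - b i))" for x
        unfolding H_def norm_mult norm_exp_of_real by (simp add: mult_ac)
    qed (use ReY in auto)
    have sumf1: "(\<lambda>x. norm (f1 x)) summable_on Zn n"
    proof -
      have "norm (f1 x) = exp (- (Re Y * pi) * qf n A' (\<lambda>i. x i + a i))" for x
        unfolding f1_def norm_mult norm_exp_of_real by (simp add: mult_ac)
      thus ?thesis using summable_coercive[OF co', of "Re Y * pi" a] Y by simp
    qed
    have sumh: "(\<lambda>l. norm (h l)) summable_on UNIV"
    proof -
      have "norm (h l) = exp (- (Re (1 / (Y * of_real \<alpha>)) * pi) * (of_int l + - b n)^2)" for l
        unfolding h_def norm_exp_of_real by (simp add: mult_ac)
      thus ?thesis using summable_gauss[of "Re (1 / (Y * of_real \<alpha>)) * pi" "- b n"] Y\<alpha>(2) by (simp only:) simp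
    qed
    have "infsum F (Zn (Suc n)) = (\<Sum>\<^sub>\<infinity>x\<in>Zn n. \<Sum>\<^sub>\<infinity>m::int. F (x(n := of_int m)))"
      by (rule infsum_Zn_Suc[OF sumF])
    also have "\<dots> = (\<Sum>\<^sub>\<infinity>x\<in>Zn n. \<Sum>\<^sub>\<infinity>l::int. f1 x * e2pi (of_real ((of_int l - b n) * t x)) * h l / csqrt (Y * of_real \<alpha>))"
    proof (rule infsum_cong)
      fix x :: "nat \<Rightarrow> real"
      have "F (x(n := of_int m)) = f1 x * (e2pi (of_real (b n * of_int m)) * exp (- (Y * of_real \<alpha>) * of_real (pi * (of_int m + t x)^2)))" for m :: int
      proof -
        have "qf (Suc n) A (\<lambda>i. (x(n := of_int m)) i + a i) = \<alpha> * (of_int m + t x)^2 + qf n A' (\<lambda>i. x i + a i)"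
        proof -
          have "ip n \<mu> (\<lambda>i. (x(n := of_int m)) i + a i) = ip n \<mu> (\<lambda>i. x i + a i)"
            "qf n A' (\<lambda>i. (x(n := of_int m)) i + a i) = qf n A' (\<lambda>i. x i + a i)"
            by (auto intro!: ip_cong qf_cong)
          thus ?thesis unfolding square t_def by (simp add: add_ac)
        qed
        thus ?thesis
          unfolding F_def f1_def ip_Suc_upd
          by (simp add: e2pi_add exp_add[symmetric] algebra_simps)
      qed
      hence "(\<Sum>\<^sub>\<infinity>m::int. F (x(n := of_int m))) = f1 x * (\<Sum>\<^sub>\<infinity>m::int. (e2pi (of_real (b n * of_int m)) * exp (- (Y * of_real \<alpha>) * of_real (pi * (of_int m + t x)^2))))"
        by (simp only: infsum_cmult_right')
      also have "\<dots> = f1 x * ((\<Sum>\<^sub>\<infinity>l::int. e2pi (of_real ((of_int l - b n) * t x)) * h l) / csqrt (Y * of_real \<alpha>))"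
        unfolding poisson_complex[OF Y\<alpha>(1)] h_def ..
      also have "\<dots> = (\<Sum>\<^sub>\<infinity>l::int. f1 x * e2pi (of_real ((of_int l - b n) * t x)) * h l / csqrt (Y * of_real \<alpha>))"
        unfolding divide_inverse by (simp only: infsum_cmult_right'[symmetric] infsum_cmult_left'[symmetric] mult.assoc)
      finally show "(\<Sum>\<^sub>\<infinity>m::int. F (x(n := of_int m))) = (\<Sum>\<^sub>\<infinity>l::int. f1 x * e2pi (of_real ((of_int l - b n) * t x)) * h l / csqrt (Y * of_real \<alpha>))" .
    qed
    also have "\<dots> = (\<Sum>\<^sub>\<infinity>l::int. \<Sum>\<^sub>\<infinity>x\<in>Zn n. f1 x * e2pi (of_real ((of_int l - b n) * t x)) * h l / csqrt (Y * of_real \<alpha>))"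
    proof (rule infsum_swap_banach)
      have "(\<lambda>(x, l). norm (f1 x) * (norm (h l) / norm (csqrt (Y * of_real \<alpha>)))) summable_on Zn n \<times> UNIV"
        unfolding divide_inverse by (intro summable_product sumf1 summable_on_cmult_left sumh) auto
      thus "(\<lambda>(x, l). f1 x * e2pi (of_real ((of_int l - b n) * t x)) * h l / csqrt (Y * of_real \<alpha>)) summable_on Zn n \<times> UNIV"
        by (rule summable_on_norm_comparison) (auto simp: norm_mult norm_divide simp del: of_real_mult of_real_diff)
    qed
    also have "\<dots> = (\<Sum>\<^sub>\<infinity>l::int. of_real C / csqrt Y ^ Suc n * (\<Sum>\<^sub>\<infinity>k\<in>Zn n. H (k(n := of_int l))))"
    proof (rule infsum_cong)
      fix l :: int
      define \<kappa> where "\<kappa> = of_int l - b n"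
      have 1: "f1 x * e2pi (of_real (\<kappa> * t x)) * h l / csqrt (Y * of_real \<alpha>) =
         (e2pi (of_real (\<kappa> * (a n + ip n \<mu> a))) * h l / csqrt (Y * of_real \<alpha>)) *
         (e2pi (of_real (ip n (\<lambda>i. b i + \<kappa> * \<mu> i) x)) * exp (- Y * of_real (pi * qf n A' (\<lambda>i. x i + a i))))" for x
      proof -
        have "ip n b x + \<kappa> * t x = \<kappa> * (a n + ip n \<mu> a) + ip n (\<lambda>i. b i + \<kappa> * \<mu> i) x"
          by (simp add: t_def ip_def algebra_simps sum.distrib sum_distrib_left)
        hence "e2pi (of_real (ip n b x)) * e2pi (of_real (\<kappa> * t x)) =
          e2pi (of_real (\<kappa> * (a n + ip n \<mu> a))) * e2pi (of_real (ip n (\<lambda>i. b i + \<kappa> * \<mu> i) x))"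
          by (simp only: e2pi_add[symmetric] of_real_add[symmetric])
        thus ?thesis unfolding f1_def by (simp add: divide_simps)
      qed
      have "(\<Sum>\<^sub>\<infinity>x\<in>Zn n. f1 x * e2pi (of_real (\<kappa> * t x)) * h l / csqrt (Y * of_real \<alpha>)) =
         (e2pi (of_real (\<kappa> * (a n + ip n \<mu> a))) * h l / csqrt (Y * of_real \<alpha>)) *
          (of_real C' / csqrt Y ^ n *
          (\<Sum>\<^sub>\<infinity>k\<in>Zn n. e2pi (of_real (ip n (\<lambda>i. k i - (b i + \<kappa> * \<mu> i)) a)) * exp (- (1 / Y) * of_real (pi * Q' (\<lambda>i. k i - (b i + \<kappa> * \<mu> i))))))"
        unfolding 1 infsum_cmult_right' IH[OF Y] ..
      also have "\<dots> = of_real C / csqrt Y ^ Suc n * (\<Sum>\<^sub>\<infinity>k\<in>Zn n. (e2pi (of_real (\<kappa> * (a n + ip n \<mu> a))) * h l) *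
            (e2pi (of_real (ip n (\<lambda>i. k i - (b i + \<kappa> * \<mu> i)) a)) * exp (- (1 / Y) * of_real (pi * Q' (\<lambda>i. k i - (b i + \<kappa> * \<mu> i))))))"
        unfolding infsum_cmult_right' csq C_def by (simp add: field_simps)
      also have "(\<Sum>\<^sub>\<infinity>k\<in>Zn n. (e2pi (of_real (\<kappa> * (a n + ip n \<mu> a))) * h l) *
            (e2pi (of_real (ip n (\<lambda>i. k i - (b i + \<kappa> * \<mu> i)) a)) * exp (- (1 / Y) * of_real (pi * Q' (\<lambda>i. k i - (b i + \<kappa> * \<mu> i)))))) =
           (\<Sum>\<^sub>\<infinity>k\<in>Zn n. H (k(n := of_int l)))"
      proof (rule infsum_cong)
        fix k :: "nat \<Rightarrow> real"
        define k' where "k' = k(n := of_int l)"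
        have e1: "\<kappa> * (a n + ip n \<mu> a) + ip n (\<lambda>i. k i - (b i + \<kappa> * \<mu> i)) a = ip (Suc n) (\<lambda>i. k' i - b i) a"
          by (simp add: k'_def ip_def \<kappa>_def algebra_simps sum.distrib sum_distrib_left sum_subtractf)
        have e2: "Q (\<lambda>i. k' i - b i) = \<kappa>^2 / \<alpha> + Q' (\<lambda>i. k i - (b i + \<kappa> * \<mu> i))"
        proof -
          have "Q' (\<lambda>j. k' j - b j - (k' n - b n) * \<mu> j) = Q' (\<lambda>i. k i - (b i + \<kappa> * \<mu> i))"
            by (rule cong') (simp add: k'_def \<kappa>_def)
          thus ?thesis by (simp add: Q_def k'_def \<kappa>_def)
        qed
        have e3: "h l * exp (- (1 / Y) * of_real (pi * Q' (\<lambda>i. k i - (b i + \<kappa> * \<mu> i)))) = exp (- (1 / Y) * of_real (pi * Q (\<lambda>i. k' i - b i)))"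
          unfolding h_def e2 \<kappa>_def[symmetric] exp_add[symmetric] using \<alpha>
          by (intro arg_cong[of _ _ exp]) (simp add: distrib_left distrib_right mult_ac)
        show "e2pi (of_real (\<kappa> * (a n + ip n \<mu> a))) * h l *
            (e2pi (of_real (ip n (\<lambda>i. k i - (b i + \<kappa> * \<mu> i)) a)) * exp (- (1 / Y) * of_real (pi * Q' (\<lambda>i. k i - (b i + \<kappa> * \<mu> i))))) = H (k(n := of_int l))"
          unfolding H_def k'_def[symmetric] e1[symmetric] e3[symmetric] of_real_add e2pi_add by (simp only: mult_ac)
      qed
      finally show "(\<Sum>\<^sub>\<infinity>x\<in>Zn n. f1 x * e2pi (of_real ((of_int l - b n) * t x)) * h l / csqrt (Y * of_real \<alpha>)) =
         of_real C / csqrt Y ^ Suc n * (\<Sum>\<^sub>\<infinity>k\<in>Zn n. H (k(n := of_int l)))"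
        unfolding \<kappa>_def .
    qed
    also have "\<dots> = of_real C / csqrt Y ^ Suc n * (\<Sum>\<^sub>\<infinity>l::int. \<Sum>\<^sub>\<infinity>k\<in>Zn n. H (k(n := of_int l)))"
      by (rule infsum_cmult_right')
    also have "(\<Sum>\<^sub>\<infinity>l::int. \<Sum>\<^sub>\<infinity>k\<in>Zn n. H (k(n := of_int l))) = (\<Sum>\<^sub>\<infinity>k\<in>Zn n. \<Sum>\<^sub>\<infinity>l::int. H (k(n := of_int l)))"
    proof (rule infsum_swap_banach[symmetric])
      show "(\<lambda>(k, l). H (k(n := real_of_int l))) summable_on Zn n \<times> UNIV"
        using sumH summable_on_reindex_bij_betw[OF bij_Zn_Suc[of n], of H] by (simp add: case_prod_unfold)
    qed
    also have "\<dots> = infsum H (Zn (Suc n))" by (rule infsum_Zn_Suc[OF sumH, symmetric])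
    finally show ?thesis unfolding F_def[abs_def] H_def[abs_def] .
  qed
  have "poisson_dual (Suc n) A C Q"
    unfolding poisson_dual_def
  proof (intro conjI coQ)
    show "\<forall>x z. (\<forall>i<Suc n. x i = z i) \<longrightarrow> Q x = Q z" using cong by blast
  qed (intro allI impI dual formula; assumption)+
  with co C show ?case by blast
qed

section \<open>Theta functions with characteristics\<close>

lemma common_denominator:
  assumes "\<And>i. i < (n::nat) \<Longrightarrow> x i \<in> (\<rat> :: real set)"
  shows "\<exists>D::nat. D > 0 \<and> (\<forall>i<n. real D * x i \<in> \<int>)"
  using assms
proof (induction n)
  case (Suc n)
  then obtain D where D: "D > 0" "\<forall>i<n. real D * x i \<in> \<int>" by auto
  obtain p q :: int where pq: "q > 0" "x n = of_int p / of_int q"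
    using Suc.prems[of n] by (auto elim!: Rats_cases')
  have "real (D * nat q) * x i \<in> \<int>" if "i < Suc n" for i
  proof (cases "i = n")
    case True
    have "real (D * nat q) * x i = of_int (int D * p)" using pq True by simp
    thus ?thesis by (simp only: Ints_of_int)
  next
    case False
    hence "real D * x i \<in> \<int>" using that D by auto
    hence "of_int q * (real D * x i) \<in> \<int>" by (rule Ints_mult[OF Ints_of_int])
    moreover have "real (D * nat q) * x i = of_int q * (real D * x i)" using pq by simp
    ultimately show ?thesis by (simp only:)
  qed
  thus ?case using D pq by (intro exI[of _ "D * nat q"]) auto
qed (auto intro: exI[of _ 1])

definition bf :: "nat \<Rightarrow> (nat \<Rightarrow> nat \<Rightarrow> real) \<Rightarrow> (nat \<Rightarrow> real) \<Rightarrow> (nat \<Rightarrow> real) \<Rightarrow> real" where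
  "bf n A x y = (\<Sum>i<n. \<Sum>j<n. A i j * x i * y j)"

text \<open>The Gram matrix of a positive definite even unimodular lattice of positive rank. The condition \<open>dual\<close> says that every
integral functional is the product with a lattice vector.\<close>

locale even_unimodular_gram =
  fixes n :: nat and A :: "nat \<Rightarrow> nat \<Rightarrow> real"
  assumes n_pos: "n > 0"
    and sym: "i < n \<Longrightarrow> j < n \<Longrightarrow> A i j = A j i"
    and int: "i < n \<Longrightarrow> j < n \<Longrightarrow> A i j \<in> \<int>"
    and even: "x \<in> Zn n \<Longrightarrow> qf n A x / 2 \<in> \<int>"
    and pos: "x \<in> Zn n \<Longrightarrow> x \<noteq> (\<lambda>_. 0) \<Longrightarrow> qf n A x > 0"
    and dual: "k \<in> Zn n \<Longrightarrow> \<exists>x\<in>Zn n. \<forall>i<n. k i = (\<Sum>j<n. A i j * x j)"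
begin

abbreviation "q \<equiv> qf n A"
abbreviation "B \<equiv> bf n A"

lemma B_sym: "B x y = B y x"
proof -
  have "B x y = (\<Sum>j<n. \<Sum>i<n. A i j * x i * y j)" unfolding bf_def by (rule sum.swap)
  also have "\<dots> = B y x" unfolding bf_def by (intro sum.cong refl) (simp add: sym mult_ac)
  finally show ?thesis .
qed

lemma q_add: "q (\<lambda>i. x i + c * y i) = q x + 2 * c * B x y + c^2 * q y"
proof -
  have "q (\<lambda>i. x i + c * y i) = (\<Sum>i<n. \<Sum>j<n. A i j * x i * x j + c * (A i j * x i * y j) + c * (A i j * y i * x j) + c^2 * (A i j * y i * y j))"
    unfolding qf_def by (intro sum.cong refl) (simp add: power2_eq_square algebra_simps)
  also have "\<dots> = q x + c * B x y + c * B y x + c^2 * q y"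
    by (simp only: sum.distrib sum_distrib_left[symmetric] qf_def bf_def)
  finally show ?thesis using B_sym[of x y] by simp
qed

lemma q_scale: "q (\<lambda>i. c * x i) = c^2 * q x"
  by (simp add: qf_def sum_distrib_left power2_eq_square mult_ac)

lemma B_add_left: "B (\<lambda>i. x i + c * y i) u = B x u + c * B y u"
proof -
  have "B (\<lambda>i. x i + c * y i) u = (\<Sum>i<n. \<Sum>j<n. A i j * x i * u j + c * (A i j * y i * u j))"
    unfolding bf_def by (intro sum.cong refl) (simp add: algebra_simps)
  thus ?thesis by (simp only: sum.distrib sum_distrib_left[symmetric] bf_def)
qed

lemma B_scale_right: "B x (\<lambda>i. c * y i) = c * B x y"
  by (simp add: bf_def sum_distrib_left mult_ac)

lemma B_self: "B x x = q x"
  by (simp add: bf_def qf_def)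

lemma q_Zn_ge_1:
  assumes "x \<in> Zn n" "x \<noteq> (\<lambda>_. 0)" shows "q x \<ge> 1"
proof -
  obtain k where k: "q x / 2 = of_int k" using even[OF assms(1)] by (elim Ints_cases)
  have "of_int k > (0::real)" using pos[OF assms] k by simp
  hence "k \<ge> 1" by simp
  hence "of_int k \<ge> (1::real)" by simp
  thus ?thesis using k by simp
qed

lemma pos_rat:
  assumes "\<And>i. i < n \<Longrightarrow> x i \<in> \<rat>" "\<exists>i<n. x i \<noteq> 0"
  shows "q x > 0"
proof -
  obtain D where D: "D > 0" "\<forall>i<n. real D * x i \<in> \<int>"
    using common_denominator[of n x] assms(1) by blast
  define z where "z i = (if i < n then real D * x i else 0)" for i
  have z: "z \<in> Zn n" using D by (auto simp: Zn_def z_def)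
  obtain i where "i < n" "x i \<noteq> 0" using assms(2) by blast
  hence "z i \<noteq> 0" using D by (simp add: z_def)
  hence "q z > 0" using z by (intro pos) auto
  moreover have "q z = q (\<lambda>i. real D * x i)" by (rule qf_cong) (simp add: z_def)
  ultimately show ?thesis using D by (simp add: q_scale zero_less_mult_iff)
qed

lemma coercive_q: "coercive n q"
  and ex_poisson: "\<exists>C>0. \<exists>Q'. poisson_dual n A C Q'"
proof -
  have "\<And>i j. i < n \<Longrightarrow> j < n \<Longrightarrow> A i j \<in> \<rat>" using int Ints_subset_Rats by blast
  from poisson_lattice[OF sym this pos_rat]
  show "coercive n q" "\<exists>C>0. \<exists>Q'. poisson_dual n A C Q'" by blast+
qed

lemma q_nonneg: "q x \<ge> 0"
  by (rule coercive_nonneg[OF coercive_q])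

definition dualmap :: "(nat \<Rightarrow> real) \<Rightarrow> nat \<Rightarrow> real" where
  "dualmap x i = (if i < n then \<Sum>j<n. A i j * x j else 0)"

lemma ip_dualmap: "ip n (dualmap x) y = B x y"
proof -
  have "ip n (dualmap x) y = (\<Sum>i<n. \<Sum>j<n. A i j * x j * y i)"
    unfolding ip_def dualmap_def by (intro sum.cong refl) (simp add: sum_distrib_right)
  also have "\<dots> = B y x" unfolding bf_def by (simp add: mult_ac)
  finally show ?thesis by (simp add: B_sym)
qed

lemma bij_dualmap: "bij_betw dualmap (Zn n) (Zn n)"
proof (rule bij_betw_imageI)
  show "inj_on dualmap (Zn n)"
  proof (rule inj_onI)
    fix x y assume xy: "x \<in> Zn n" "y \<in> Zn n" "dualmap x = dualmap y"
    define z where "z i = x i - y i" for i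
    have z: "z \<in> Zn n" using xy by (auto simp: Zn_def z_def)
    have "dualmap z i = dualmap x i - dualmap y i" for i
      by (simp add: dualmap_def z_def right_diff_distrib sum_subtractf)
    hence "dualmap z = (\<lambda>_. 0)" using xy(3) by (simp add: fun_eq_iff)
    hence "q z = 0" using ip_dualmap[of z z] by (simp add: bf_def qf_def ip_def)
    hence "z = (\<lambda>_. 0)" using pos[OF z] by force
    thus "x = y" by (simp add: z_def fun_eq_iff)
  qed
  show "dualmap ` Zn n = Zn n"
  proof (intro equalityI subsetI)
    fix k assume "k \<in> dualmap ` Zn n"
    thus "k \<in> Zn n"
      by (auto simp: Zn_def dualmap_def intro!: Ints_sum Ints_mult int)
  next
    fix k assume k: "k \<in> Zn n"
    then obtain x where x: "x \<in> Zn n" "\<forall>i<n. k i = (\<Sum>j<n. A i j * x j)" using dual by blast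
    hence "k = dualmap x" using k by (auto simp: fun_eq_iff dualmap_def Zn_def)
    thus "k \<in> dualmap ` Zn n" using x by blast
  qed
qed

text \<open>The theta series with characteristic \<open>(a w, b w)\<close>. The constant phase is half the product of the two characteristics; with this
choice translation and inversion act on the pair \<open>(a, b)\<close> without any further factor.\<close>

definition theta :: "(nat \<Rightarrow> real) \<Rightarrow> int \<Rightarrow> int \<Rightarrow> complex \<Rightarrow> complex" where
  "theta w a b \<tau> = (\<Sum>\<^sub>\<infinity>x\<in>Zn n. e2pi (\<tau> * of_real (q (\<lambda>i. x i + of_int a * w i) / 2) +
      of_real (of_int b * B w x + of_int (a * b) * q w / 2)))"

lemma e2pi_exp: "e2pi (\<tau> * of_real (r / 2)) = exp (- (- \<i> * \<tau>) * of_real (pi * r))"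
  by (simp add: e2pi_def mult_ac)

lemma theta_summable:
  assumes "Im \<tau> > 0"
  shows "(\<lambda>x. norm (e2pi (\<tau> * of_real (q (\<lambda>i. x i + of_int a * w i) / 2) +
      of_real (of_int b * B w x + of_int (a * b) * q w / 2)))) summable_on Zn n"
proof -
  have "norm (e2pi (\<tau> * of_real (q (\<lambda>i. x i + of_int a * w i) / 2) +
      of_real (of_int b * B w x + of_int (a * b) * q w / 2))) = exp (- (Im \<tau> * pi) * q (\<lambda>i. x i + of_int a * w i))" for x
    unfolding norm_e2pi by (simp add: mult_ac)
  thus ?thesis using summable_coercive[OF coercive_q, of "Im \<tau> * pi" "\<lambda>i. of_int a * w i"] assms by simp
qed

text \<open>Evenness of the lattice enters here: \<open>e2pi (k * q x / 2) = 1\<close>.\<close>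

lemma theta_translate: "theta w a b (\<tau> + of_int k) = theta w a (b + k * a) \<tau>"
  unfolding theta_def
proof (rule infsum_cong)
  fix x assume x: "x \<in> Zn n"
  obtain m where m: "q x / 2 = of_int m" using even[OF x] by (elim Ints_cases)
  define X where "X = q (\<lambda>i. x i + of_int a * w i) / 2"
  have "q x = 2 * of_int m" using m by simp
  hence X: "X = of_int m + of_int a * B w x + of_int a^2 * q w / 2"
    unfolding X_def q_add using B_sym[of x w] by (simp add: add_divide_distrib)
  have "of_int k * X + (of_int b * B w x + of_int (a * b) * q w / 2) =
     (of_int (b + k * a) * B w x + of_int (a * (b + k * a)) * q w / 2) + of_int (k * m)"
    unfolding X by (simp add: power2_eq_square distrib_left distrib_right add_divide_distrib mult_ac)
  hence "of_real (of_int k * X + (of_int b * B w x + of_int (a * b) * q w / 2)) =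
     complex_of_real (of_int (b + k * a) * B w x + of_int (a * (b + k * a)) * q w / 2 + of_int (k * m))"
    by (rule arg_cong)
  hence "(\<tau> + of_int k) * of_real X + of_real (of_int b * B w x + of_int (a * b) * q w / 2) =
     (\<tau> * of_real X + of_real (of_int (b + k * a) * B w x + of_int (a * (b + k * a)) * q w / 2)) + of_int (k * m)"
    unfolding of_real_add of_real_mult of_real_of_int_eq by (simp only: distrib_right add.assoc)
  thus "e2pi ((\<tau> + of_int k) * of_real (q (\<lambda>i. x i + of_int a * w i) / 2) + of_real (of_int b * B w x + of_int (a * b) * q w / 2)) =
     e2pi (\<tau> * of_real (q (\<lambda>i. x i + of_int a * w i) / 2) + of_real (of_int (b + k * a) * B w x + of_int (a * (b + k * a)) * q w / 2))"
    unfolding X_def[symmetric] by (simp only: e2pi_add[of _ "of_int _"] e2pi_int mult_1_right)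
qed

lemma bij_neg_Zn: "bij_betw (\<lambda>x i. - x i) (Zn n) (Zn n)"
  by (rule bij_betwI[where g = "\<lambda>x i. - x i"]) (auto simp: Zn_def)

lemma theta_neg: "theta w (- a) (- b) \<tau> = theta w a b \<tau>"
proof -
  have "theta w (- a) (- b) \<tau> = (\<Sum>\<^sub>\<infinity>x\<in>Zn n. e2pi (\<tau> * of_real (q (\<lambda>i. - x i + of_int (- a) * w i) / 2) +
      of_real (of_int (- b) * B w (\<lambda>i. - x i) + of_int (- a * - b) * q w / 2)))"
    unfolding theta_def by (rule infsum_reindex_bij_betw[OF bij_neg_Zn, symmetric])
  also have "\<dots> = theta w a b \<tau>"
  proof -
    have "q (\<lambda>i. - x i + of_int (- a) * w i) = q (\<lambda>i. x i + of_int a * w i)" for x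
      using q_scale[of "-1" "\<lambda>i. x i + of_int a * w i"] by simp
    moreover have "B w (\<lambda>i. - x i) = - B w x" for x by (simp add: bf_def sum_negf)
    ultimately show ?thesis unfolding theta_def by simp
  qed
  finally show ?thesis .
qed

text \<open>Poisson summation with \<open>Y = \<i> / \<tau>\<close>. The sum over the dual lattice is moved back to the lattice by
\<open>dualmap\<close>, which is a bijection because the lattice is unimodular.\<close>

lemma theta_inversion_up_to_constant:
  assumes "poisson_dual n A C Q'" and \<tau>: "Im \<tau> > 0"
  shows "theta w a b (- 1 / \<tau>) = of_real C / csqrt (\<i> / \<tau>) ^ n * theta w (- b) a \<tau>"
proof -
  define Y where "Y = \<i> / \<tau>"
  have \<tau>0: "\<tau> \<noteq> 0" using \<tau> by auto
  have Y: "Re Y > 0"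
  proof -
    have "Im \<tau> / ((Re \<tau>)\<^sup>2 + (Im \<tau>)\<^sup>2) > 0" using \<tau> by (intro divide_pos_pos add_nonneg_pos) auto
    thus ?thesis by (simp add: Y_def Re_divide)
  qed
  have Y1: "- (- \<i> * (- 1 / \<tau>)) = - Y" "- (1 / Y) = - (- \<i> * \<tau>)"
    using \<tau>0 by (simp_all add: Y_def field_simps)
  let ?ph = "e2pi (of_real (of_int (a * b) * q w / 2))"
  have "theta w a b (- 1 / \<tau>) = (\<Sum>\<^sub>\<infinity>x\<in>Zn n. e2pi (of_real (ip n (dualmap (\<lambda>i. of_int b * w i)) x)) *
       exp (- Y * of_real (pi * q (\<lambda>i. x i + of_int a * w i)))) * ?ph"
    unfolding theta_def infsum_cmult_left'[symmetric]
  proof (rule infsum_cong)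
    fix x
    have "ip n (dualmap (\<lambda>i. of_int b * w i)) x = of_int b * B w x"
      unfolding ip_dualmap by (simp add: bf_def sum_distrib_left mult_ac)
    thus "e2pi (- 1 / \<tau> * of_real (q (\<lambda>i. x i + of_int a * w i) / 2) + of_real (of_int b * B w x + of_int (a * b) * q w / 2)) =
       e2pi (of_real (ip n (dualmap (\<lambda>i. of_int b * w i)) x)) * exp (- Y * of_real (pi * q (\<lambda>i. x i + of_int a * w i))) * ?ph"
      unfolding of_real_add e2pi_add e2pi_exp Y1 by (simp only: mult_ac)
  qed
  also have "(\<Sum>\<^sub>\<infinity>x\<in>Zn n. e2pi (of_real (ip n (dualmap (\<lambda>i. of_int b * w i)) x)) * exp (- Y * of_real (pi * q (\<lambda>i. x i + of_int a * w i)))) =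
     of_real C / csqrt Y ^ n * (\<Sum>\<^sub>\<infinity>k\<in>Zn n. e2pi (of_real (ip n (\<lambda>i. k i - dualmap (\<lambda>i. of_int b * w i) i) (\<lambda>i. of_int a * w i))) *
         exp (- (1 / Y) * of_real (pi * Q' (\<lambda>i. k i - dualmap (\<lambda>i. of_int b * w i) i))))"
    by (rule poisson_dualD(4)[OF assms(1) Y])
  also have "(\<Sum>\<^sub>\<infinity>k\<in>Zn n. e2pi (of_real (ip n (\<lambda>i. k i - dualmap (\<lambda>i. of_int b * w i) i) (\<lambda>i. of_int a * w i))) *
         exp (- (1 / Y) * of_real (pi * Q' (\<lambda>i. k i - dualmap (\<lambda>i. of_int b * w i) i)))) =
      (\<Sum>\<^sub>\<infinity>z\<in>Zn n. e2pi (of_real (ip n (\<lambda>i. dualmap z i - dualmap (\<lambda>i. of_int b * w i) i) (\<lambda>i. of_int a * w i))) *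
         exp (- (1 / Y) * of_real (pi * Q' (\<lambda>i. dualmap z i - dualmap (\<lambda>i. of_int b * w i) i))))"
    by (rule infsum_reindex_bij_betw[OF bij_dualmap, symmetric])
  also have "of_real C / csqrt Y ^ n * (\<Sum>\<^sub>\<infinity>z\<in>Zn n. e2pi (of_real (ip n (\<lambda>i. dualmap z i - dualmap (\<lambda>i. of_int b * w i) i) (\<lambda>i. of_int a * w i))) *
         exp (- (1 / Y) * of_real (pi * Q' (\<lambda>i. dualmap z i - dualmap (\<lambda>i. of_int b * w i) i)))) * ?ph =
      of_real C / csqrt Y ^ n * ((\<Sum>\<^sub>\<infinity>z\<in>Zn n. e2pi (of_real (ip n (\<lambda>i. dualmap z i - dualmap (\<lambda>i. of_int b * w i) i) (\<lambda>i. of_int a * w i))) *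
         exp (- (1 / Y) * of_real (pi * Q' (\<lambda>i. dualmap z i - dualmap (\<lambda>i. of_int b * w i) i)))) * ?ph)"
    by (rule mult.assoc)
  also have "(\<Sum>\<^sub>\<infinity>z\<in>Zn n. e2pi (of_real (ip n (\<lambda>i. dualmap z i - dualmap (\<lambda>i. of_int b * w i) i) (\<lambda>i. of_int a * w i))) *
         exp (- (1 / Y) * of_real (pi * Q' (\<lambda>i. dualmap z i - dualmap (\<lambda>i. of_int b * w i) i)))) * ?ph = theta w (- b) a \<tau>"
    unfolding theta_def infsum_cmult_left'[symmetric]
  proof (rule infsum_cong)
    fix z
    define z' where "z' i = z i + of_int (- b) * w i" for i
    have d: "dualmap z i - dualmap (\<lambda>i. of_int b * w i) i = dualmap z' i" for i
      by (simp add: dualmap_def z'_def right_diff_distrib sum_subtractf)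
    have "Q' (dualmap z') = Q' (\<lambda>i. \<Sum>j<n. A i j * z' j)"
      by (rule poisson_dualD(2)[OF assms(1)]) (simp add: dualmap_def)
    also have "\<dots> = q z'" by (rule poisson_dualD(3)[OF assms(1)])
    finally have Q': "Q' (dualmap z') = q z'" .
    have i: "ip n (dualmap z') (\<lambda>i. of_int a * w i) = of_int a * B w z - of_int (a * b) * q w"
    proof -
      have "B z' (\<lambda>i. of_int a * w i) = of_int a * (B z w + of_int (- b) * q w)"
        unfolding z'_def[abs_def] B_scale_right B_add_left by (simp only: B_self)
      also have "\<dots> = of_int a * B w z - of_int (a * b) * q w"
        using B_sym[of z w] by (simp add: algebra_simps)
      finally show ?thesis unfolding ip_dualmap .
    qed
    have "of_real (of_int a * B w z - of_int (a * b) * q w) + complex_of_real (of_int (a * b) * q w / 2) =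
       of_real (of_int a * B w z + of_int (- b * a) * q w / 2)"
      unfolding of_real_add[symmetric] by (rule arg_cong[of _ _ of_real]) (simp add: mult.commute)
    hence eq: "e2pi (of_real (of_int a * B w z - of_int (a * b) * q w)) * ?ph = e2pi (of_real (of_int a * B w z + of_int (- b * a) * q w / 2))"
      by (simp only: e2pi_add[symmetric])
    have "e2pi (of_real (ip n (\<lambda>i. dualmap z i - dualmap (\<lambda>i. of_int b * w i) i) (\<lambda>i. of_int a * w i))) *
         exp (- (1 / Y) * of_real (pi * Q' (\<lambda>i. dualmap z i - dualmap (\<lambda>i. of_int b * w i) i))) * ?ph =
       exp (- (- \<i> * \<tau>) * of_real (pi * q z')) * (e2pi (of_real (of_int a * B w z - of_int (a * b) * q w)) * ?ph)"
      unfolding d Q' i Y1 by (rule mult.left_commute[THEN trans[rotated]]) (simp only: mult.assoc)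
    also have "\<dots> = e2pi (\<tau> * of_real (q z' / 2)) * e2pi (of_real (of_int a * B w z + of_int (- b * a) * q w / 2))"
      unfolding eq e2pi_exp ..
    also have "\<dots> = e2pi (\<tau> * of_real (q (\<lambda>i. z i + of_int (- b) * w i) / 2) + of_real (of_int a * B w z + of_int (- b * a) * q w / 2))"
      unfolding e2pi_add z'_def[abs_def] ..
    finally show "e2pi (of_real (ip n (\<lambda>i. dualmap z i - dualmap (\<lambda>i. of_int b * w i) i) (\<lambda>i. of_int a * w i))) *
         exp (- (1 / Y) * of_real (pi * Q' (\<lambda>i. dualmap z i - dualmap (\<lambda>i. of_int b * w i) i))) * ?ph =
       e2pi (\<tau> * of_real (q (\<lambda>i. z i + of_int (- b) * w i) / 2) + of_real (of_int a * B w z + of_int (- b * a) * q w / 2))" .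
  qed
  finally show ?thesis unfolding Y_def .
qed

lemma theta_at_i_nonzero: "theta w 0 0 \<i> \<noteq> 0"
proof -
  have eq: "e2pi (\<i> * of_real (q (\<lambda>i. x i + of_int 0 * w i) / 2) + of_real (of_int 0 * B w x + of_int (0 * 0) * q w / 2)) = of_real (exp (- pi * q x))" for x
    by (simp add: e2pi_def exp_of_real[symmetric])
  have s: "(\<lambda>x. exp (- pi * q x)) summable_on Zn n"
    using summable_coercive[OF coercive_q, of pi "\<lambda>_. 0"] by simp
  have 0: "(\<lambda>_. 0) \<in> Zn n" by (simp add: Zn_def)
  have "0 < exp (- pi * q (\<lambda>_. 0))" by simp
  also have "\<dots> = infsum (\<lambda>x. exp (- pi * q x)) {\<lambda>_. 0}" by simp
  also have "\<dots> \<le> infsum (\<lambda>x. exp (- pi * q x)) (Zn n)"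
    by (rule infsum_mono2) (use s 0 in auto)
  finally have "infsum (\<lambda>x. exp (- pi * q x)) (Zn n) \<noteq> 0" by simp
  moreover have "theta w 0 0 \<i> = of_real (infsum (\<lambda>x. exp (- pi * q x)) (Zn n))"
    unfolding theta_def eq by (intro infsumI has_sum_of_real has_sum_infsum s)
  ultimately show ?thesis by simp
qed

text \<open>The constant is \<open>1\<close> because \<open>\<i>\<close> is fixed by \<open>\<tau> \<mapsto> -1 / \<tau>\<close> and the theta series is positive there.\<close>

lemma theta_inversion:
  assumes "Im \<tau> > 0"
  shows "theta w a b (- 1 / \<tau>) = 1 / csqrt (\<i> / \<tau>) ^ n * theta w (- b) a \<tau>"
proof -
  obtain C Q' where PD: "poisson_dual n A C Q'" using ex_poisson by blast
  have "theta w 0 0 (- 1 / \<i>) = of_real C / csqrt (\<i> / \<i>) ^ n * theta w (- 0) 0 \<i>"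
    by (rule theta_inversion_up_to_constant[OF PD]) simp
  hence "theta w 0 0 \<i> = of_real C * theta w 0 0 \<i>" by simp
  hence "C = 1" using theta_at_i_nonzero[of w] by simp
  thus ?thesis using theta_inversion_up_to_constant[OF PD assms] by simp
qed

text \<open>The map \<open>\<tau> \<mapsto> 1 - 1 / \<tau>\<close> has order three. Following \<open>\<theta>\<close> once around the orbit of \<open>\<i>\<close> shows that the product of the
three automorphy factors is \<open>1\<close>; it is the \<open>n\<close>-th power of a number whose square is \<open>\<i>\<close>, up to inversion.\<close>

lemma dim_dvd_8: "8 dvd n"
proof -
  define w where "w = (\<lambda>_::nat. 0::real)"
  define J where "J \<tau> = 1 / csqrt (\<i> / \<tau>) ^ n" for \<tau>
  define U where "U \<tau> = - 1 / \<tau> + 1" for \<tau> :: complex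
  have step: "theta w 0 0 (U \<tau>) = J \<tau> * theta w 0 0 \<tau>" if "Im \<tau> > 0" for \<tau>
    using theta_translate[of w 0 0 "- 1 / \<tau>" 1] theta_inversion[OF that, of w 0 0] by (simp add: U_def J_def)
  (* The orbit of the imaginary unit under U. *)
  define \<tau>1 where "\<tau>1 = 1 + \<i>"
  define \<tau>2 where "\<tau>2 = (1 + \<i>) / 2"
  have U: "U \<i> = \<tau>1" "U \<tau>1 = \<tau>2" "U \<tau>2 = \<i>"
    by (simp_all add: U_def \<tau>1_def \<tau>2_def complex_eq_iff Re_divide Im_divide power2_eq_square)
  have "theta w 0 0 \<i> = J \<tau>2 * (J \<tau>1 * (J \<i> * theta w 0 0 \<i>))"
  proof -
    have "Im \<i> > 0" "Im \<tau>1 > 0" "Im \<tau>2 > 0" by (simp_all add: \<tau>1_def \<tau>2_def)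
    from this[THEN step] show ?thesis unfolding U by simp
  qed
  hence J: "J \<tau>2 * (J \<tau>1 * J \<i>) = 1" using theta_at_i_nonzero[of w] by simp
  define p where "p = csqrt (\<i> / \<tau>1) * csqrt (\<i> / \<tau>2)"
  have p2: "p^2 = \<i>"
  proof -
    have "p^2 = (\<i> / \<tau>1) * (\<i> / \<tau>2)" by (simp add: p_def power_mult_distrib)
    also have "\<dots> = \<i>" by (simp add: \<tau>1_def \<tau>2_def complex_eq_iff Re_divide Im_divide power2_eq_square)
    finally show ?thesis .
  qed
  have "1 / p ^ n = 1" using J by (simp add: J_def p_def power_mult_distrib mult.commute)
  hence pn: "p ^ n = 1" by (simp add: divide_simps split: if_splits)
  have evenI: "even k" if "(- 1 :: complex) ^ k = 1" for k
    using that by (simp add: minus_one_power_iff split: if_splits)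
  have comm: "(x ^ j) ^ k = (x ^ k) ^ j" for x :: complex and j k :: nat
    unfolding power_mult[symmetric] by (simp only: mult.commute)
  have "(- 1) ^ n = (((p ^ 2) ^ 2) ^ n)" by (simp add: p2)
  also have "\<dots> = ((p ^ n) ^ 2) ^ 2" unfolding comm[of _ 2 n] ..
  finally have "(- 1 :: complex) ^ n = 1" unfolding pn by simp
  hence "even n" by (rule evenI)
  then obtain a where a: "n = 2 * a" by blast
  have ia: "\<i> ^ a = 1" using pn unfolding a power_mult p2 .
  have "(- 1) ^ a = (\<i> ^ 2) ^ a" by simp
  also have "\<dots> = (\<i> ^ a) ^ 2" by (rule comm)
  finally have "(- 1 :: complex) ^ a = 1" unfolding ia by simp
  hence "even a" by (rule evenI)
  then obtain c where c: "a = 2 * c" by blast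
  have "(- 1 :: complex) ^ c = 1" using ia unfolding c power_mult by simp
  hence "even c" by (rule evenI)
  thus ?thesis unfolding a c by auto
qed

definition s where "s = n div 2"

lemma s: "n = 2 * s" "4 dvd s" "s \<ge> 4"
proof -
  obtain k where k: "n = 8 * k" using dim_dvd_8 by blast
  have sk: "s = 4 * k" unfolding s_def using k by simp
  have "k > 0" using n_pos k by simp
  thus "n = 2 * s" "4 dvd s" "s \<ge> 4" unfolding sk using k by simp_all
qed

lemma theta_inversion_integral_weight:
  assumes "Im \<tau> > 0"
  shows "theta w a b (- 1 / \<tau>) = \<tau> ^ s * theta w (- b) a \<tau>"
proof -
  have "\<tau> \<noteq> 0" using assms by auto
  obtain k where k: "s = 4 * k" using s(2) by blast
  have "csqrt (\<i> / \<tau>) ^ n = csqrt (\<i> / \<tau>) ^ (2 * s)" by (rule arg_cong[OF s(1)])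
  also have "\<dots> = (\<i> / \<tau>) ^ s" unfolding power_mult by simp
  also have "\<dots> = 1 / \<tau> ^ s" by (simp only: k power_divide power_mult) simp
  finally show ?thesis using theta_inversion[OF assms] by simp
qed

lemma Im_moebius:
  fixes p q' r t :: int
  assumes "p * t - q' * r = 1"
  shows "Im ((of_int p * \<tau> + of_int q') / (of_int r * \<tau> + of_int t)) = Im \<tau> / (norm (of_int r * \<tau> + of_int t))^2"
proof -
  have "real_of_int p * real_of_int t - real_of_int q' * real_of_int r = 1"
    using assms by (simp flip: of_int_mult of_int_diff)
  hence "(real_of_int p * real_of_int t) * Im \<tau> - (real_of_int q' * real_of_int r) * Im \<tau> = Im \<tau>"
    by (simp only: left_diff_distrib[symmetric])
  hence num: "Im (of_int p * \<tau> + of_int q') * Re (of_int r * \<tau> + of_int t) - Re (of_int p * \<tau> + of_int q') * Im (of_int r * \<tau> + of_int t) = Im \<tau>"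
    by (simp add: algebra_simps)
  show ?thesis unfolding Im_divide num cmod_power2 ..
qed

lemma moebius_denom_nz:
  fixes p q' r t :: int
  assumes "p * t - q' * r = 1" "Im \<tau> > 0"
  shows "of_int r * \<tau> + of_int t \<noteq> 0"
proof
  assume "of_int r * \<tau> + of_int t = 0"
  hence "Im (of_int r * \<tau> + of_int t) = 0" "Re (of_int r * \<tau> + of_int t) = 0" by simp_all
  hence "r = 0" "t = 0" using assms(2) by auto
  thus False using assms(1) by simp
qed

lemma Im_moebius_pos:
  fixes p q' r t :: int
  assumes "p * t - q' * r = 1" "Im \<tau> > 0"
  shows "Im ((of_int p * \<tau> + of_int q') / (of_int r * \<tau> + of_int t)) > 0"
  unfolding Im_moebius[OF assms(1)] using assms(2) moebius_denom_nz[OF assms] by simp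

lemma s_even: "(- x) ^ s = (x::complex) ^ s"
  using s(2) by (elim dvdE) (simp add: power_mult)

text \<open>The Euclidean algorithm on the first column \<open>(p, r)\<close> writes every element of the modular group in terms of
translations and the inversion.\<close>

theorem theta_modular:
  fixes p q' r t :: int
  assumes "p * t - q' * r = 1" "Im \<tau> > 0"
  shows "theta w a b ((of_int p * \<tau> + of_int q') / (of_int r * \<tau> + of_int t)) =
    (of_int r * \<tau> + of_int t) ^ s * theta w (a * p + b * r) (a * q' + b * t) \<tau>"
  using assms(1)
proof (induction "nat \<bar>r\<bar>" arbitrary: a b p q' r t rule: less_induct)
  case less
  show ?case
  proof (cases "r = 0")
    case True
    hence pt: "p * t = 1" using less.prems by simp
    hence "p = 1 \<and> t = 1 \<or> p = - 1 \<and> t = - 1" by (simp add: zmult_eq_1_iff)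
    thus ?thesis
    proof
      assume "p = 1 \<and> t = 1"
      thus ?thesis using True theta_translate[of w a b \<tau> q'] by (simp add: algebra_simps)
    next
      assume pt: "p = - 1 \<and> t = - 1"
      have "(of_int p * \<tau> + of_int q') / (of_int r * \<tau> + of_int t) = \<tau> + of_int (- q')"
        using pt True by simp
      moreover have "(of_int r * \<tau> + of_int t) ^ s = 1"
        using pt True s_even[of 1] by simp
      moreover have "theta w a (b + - q' * a) \<tau> = theta w (a * p + b * r) (a * q' + b * t) \<tau>"
        using theta_neg[of w a "b + - q' * a" \<tau>] pt True by (simp add: algebra_simps)
      ultimately show ?thesis using theta_translate[of w a b \<tau> "- q'"] by simp
    qed
  next
    case False
    define k where "k = p div r"
    (* The matrix is the product of the k-th translation, the inversion, and the matrix
       with rows (r, t) and (- p', - u), whose lower left entry is smaller in absolute value. *)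
    define p' where "p' = p - k * r"
    define u where "u = q' - k * t"
    have p': "\<bar>p'\<bar> < \<bar>r\<bar>"
    proof -
      have "p' = p mod r" by (simp add: p'_def k_def minus_div_mult_eq_mod)
      thus ?thesis using False abs_mod_less[of r p] by simp
    qed
    have det: "r * (- u) - t * (- p') = 1"
      using less.prems by (simp add: u_def p'_def algebra_simps)
    have det': "p' * t - u * r = 1" using det by (simp add: algebra_simps)
    define \<sigma> where "\<sigma> = (of_int r * \<tau> + of_int t) / (of_int (- p') * \<tau> + of_int (- u))"
    have \<sigma>: "Im \<sigma> > 0" unfolding \<sigma>_def by (rule Im_moebius_pos[OF det assms(2)])
    have nz: "of_int r * \<tau> + of_int t \<noteq> 0" "of_int (- p') * \<tau> + of_int (- u) \<noteq> 0"
      using moebius_denom_nz[OF less.prems assms(2)] moebius_denom_nz[OF det assms(2)] by auto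
    have cancel: "x / y * y = x" if "y \<noteq> 0" for x y :: complex using that by simp
    have "(of_int p * \<tau> + of_int q') / (of_int r * \<tau> + of_int t) = - 1 / \<sigma> + of_int k"
    proof -
      have "- 1 / \<sigma> = (of_int p' * \<tau> + of_int u) / (of_int r * \<tau> + of_int t)"
        unfolding \<sigma>_def using nz by (simp add: divide_simps)
      also have "\<dots> + of_int k = (of_int p' * \<tau> + of_int u + of_int k * (of_int r * \<tau> + of_int t)) / (of_int r * \<tau> + of_int t)"
        using nz by (simp add: add_divide_distrib)
      also have "of_int p' * \<tau> + of_int u + of_int k * (of_int r * \<tau> + of_int t) = of_int p * \<tau> + of_int q'"
        by (simp add: p'_def u_def algebra_simps)
      finally show ?thesis by simp
    qed
    hence "theta w a b ((of_int p * \<tau> + of_int q') / (of_int r * \<tau> + of_int t)) = theta w a (b + k * a) (- 1 / \<sigma>)"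
      by (simp only: theta_translate)
    also have "\<dots> = \<sigma> ^ s * theta w (- (b + k * a)) a \<sigma>"
      by (rule theta_inversion_integral_weight[OF \<sigma>])
    also have "theta w (- (b + k * a)) a \<sigma> = (of_int (- p') * \<tau> + of_int (- u)) ^ s *
       theta w (- (b + k * a) * r + a * (- p')) (- (b + k * a) * t + a * (- u)) \<tau>"
      unfolding \<sigma>_def by (rule less.hyps) (use p' det in auto)
    also have "theta w (- (b + k * a) * r + a * (- p')) (- (b + k * a) * t + a * (- u)) \<tau> =
       theta w (- (a * p + b * r)) (- (a * q' + b * t)) \<tau>"
      by (rule arg_cong2[of _ _ _ _ "\<lambda>x y. theta w x y \<tau>"]) (simp_all add: p'_def u_def algebra_simps)
    also have "\<dots> = theta w (a * p + b * r) (a * q' + b * t) \<tau>" by (rule theta_neg)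
    also have "\<sigma> ^ s * ((of_int (- p') * \<tau> + of_int (- u)) ^ s * theta w (a * p + b * r) (a * q' + b * t) \<tau>) =
       (\<sigma> * (of_int (- p') * \<tau> + of_int (- u))) ^ s * theta w (a * p + b * r) (a * q' + b * t) \<tau>"
      by (simp only: power_mult_distrib mult.assoc)
    also have "\<sigma> * (of_int (- p') * \<tau> + of_int (- u)) = of_int r * \<tau> + of_int t"
      unfolding \<sigma>_def by (rule cancel[OF nz(2)])
    finally show ?thesis .
  qed
qed

section \<open>Behaviour at the cusps\<close>

text \<open>High up in the half-plane only the zero vector of the translate \<open>\<Lambda> + a w\<close> matters, if there is one. All other vectors of the
translate have norm at least \<open>1 / N\<^sup>2\<close>, because \<open>N\<close> times them lies in \<open>\<Lambda>\<close>; this gives constants \<open>K\<close> and \<open>\<delta>\<close>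
that are the same for all \<open>a\<close> and \<open>b\<close>.\<close>

lemma theta_cusp:
  assumes N: "N > 0" "\<And>i. i < n \<Longrightarrow> real N * w i \<in> \<int>"
  obtains K \<delta> where "K \<ge> 0" "\<delta> > 0"
    "\<And>a b \<tau>. Im \<tau> \<ge> 1 / 5 \<Longrightarrow> \<exists>\<kappa>. norm \<kappa> \<le> 1 \<and> (a = 0 \<longrightarrow> \<kappa> = 1) \<and>
       ((\<forall>x\<in>Zn n. \<exists>i<n. x i + of_int a * w i \<noteq> 0) \<longrightarrow> \<kappa> = 0) \<and>
       norm (theta w a b \<tau> - \<kappa>) \<le> K * exp (- \<delta> * Im \<tau>)"
proof
  define c where "c = pi / (10 * (real N)^2)"
  define K where "K = (\<Sum>\<^sub>\<infinity>z\<in>Zn n. exp (- c * q z))"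
  define \<delta> where "\<delta> = pi / (2 * (real N)^2)"
  have c: "c > 0" using N by (simp add: c_def)
  have sc: "(\<lambda>z. exp (- c * q z)) summable_on Zn n"
    using summable_coercive[OF coercive_q c, of "\<lambda>_. 0"] by simp
  show "K \<ge> 0" unfolding K_def by (rule infsum_nonneg) simp
  show "\<delta> > 0" using N by (simp add: \<delta>_def)
  fix a b :: int and \<tau> assume \<tau>: "Im \<tau> \<ge> 1 / 5"
  define y where "y = Im \<tau>"
  define sh where "sh x i = x i + of_int a * w i" for x :: "nat \<Rightarrow> real" and i
  define f where "f x = e2pi (\<tau> * of_real (q (sh x) / 2) + of_real (of_int b * B w x + of_int (a * b) * q w / 2))" for x
  define Z where "Z = {x \<in> Zn n. \<forall>i<n. sh x i = 0}"
  define g where "g x i = (if i < n then real N * sh x i else 0)" for x :: "nat \<Rightarrow> real" and i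
  have gZ: "g x \<in> Zn n" if "x \<in> Zn n" for x
  proof -
    have "real N * sh x i \<in> \<int>" if "i < n" for i
    proof -
      have "real N * sh x i = of_int (int N) * x i + of_int a * (real N * w i)"
        by (simp add: sh_def algebra_simps)
      moreover have "of_int (int N) * x i \<in> \<int>" "of_int a * (real N * w i) \<in> \<int>"
        by (rule Ints_mult[OF Ints_of_int], use \<open>x \<in> Zn n\<close> that N(2)[OF that] in \<open>simp add: Zn_def\<close>)+
      ultimately show ?thesis by (simp only: Ints_add)
    qed
    thus ?thesis by (auto simp: Zn_def g_def)
  qed
  have qg: "q (g x) = (real N)^2 * q (sh x)" for x
    unfolding q_scale[symmetric] by (rule qf_cong) (simp add: g_def)
  have inj: "inj_on g (Zn n)"
  proof (rule inj_onI)
    fix x x' assume x: "x \<in> Zn n" "x' \<in> Zn n" "g x = g x'"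
    show "x = x'"
    proof
      fix i
      show "x i = x' i"
      proof (cases "i < n")
        case True
        thus ?thesis using fun_cong[OF x(3), of i] N by (simp add: g_def sh_def)
      next
        case False
        thus ?thesis using x by (simp add: Zn_def)
      qed
    qed
  qed
  have normf: "norm (f x) = exp (- pi * y * q (sh x))" for x
    unfolding f_def norm_e2pi by (simp add: y_def)
  have y0: "y > 0" using \<tau> by (simp add: y_def)
  have bound: "norm (f x) \<le> exp (- \<delta> * y) * exp (- c * q (g x))" if "x \<in> Zn n - Z" for x
  proof -
    from that obtain i where i: "i < n" "sh x i \<noteq> 0" by (auto simp: Z_def)
    hence "g x i \<noteq> 0" using N by (simp add: g_def)
    hence "g x \<noteq> (\<lambda>_. 0)" by auto
    hence "q (g x) \<ge> 1" using gZ that by (intro q_Zn_ge_1) auto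
    hence 1: "1 \<le> (real N)^2 * q (sh x)" by (simp only: qg)
    have "\<delta> * y \<le> \<delta> * y * ((real N)^2 * q (sh x))"
      using mult_left_mono[OF 1, of "\<delta> * y"] y0 \<open>\<delta> > 0\<close> by simp
    also have "\<dots> = pi * y / 2 * q (sh x)" using N by (simp add: \<delta>_def)
    finally have a1: "\<delta> * y \<le> pi * y / 2 * q (sh x)" .
    have "c * q (g x) = pi * (1 / 5) / 2 * q (sh x)" using N by (simp add: c_def qg)
    also have "\<dots> \<le> pi * y / 2 * q (sh x)"
      using \<tau> by (intro mult_right_mono divide_right_mono mult_left_mono q_nonneg) (auto simp: y_def)
    finally have "- pi * y * q (sh x) \<le> - \<delta> * y + - c * q (g x)" using a1 by simp
    thus ?thesis unfolding normf exp_add[symmetric] by simp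
  qed
  have sumg: "(\<lambda>x. exp (- c * q (g x))) summable_on Zn n"
    and K: "infsum (\<lambda>x. exp (- c * q (g x))) (Zn n) \<le> K"
  proof -
    have sub: "g ` Zn n \<subseteq> Zn n" using gZ by auto
    have s: "(\<lambda>z. exp (- c * q z)) summable_on g ` Zn n" by (rule summable_on_subset_banach[OF sc sub])
    thus "(\<lambda>x. exp (- c * q (g x))) summable_on Zn n"
      using summable_on_reindex[OF inj, of "\<lambda>z. exp (- c * q z)"] by (simp add: o_def)
    have "infsum (\<lambda>x. exp (- c * q (g x))) (Zn n) = infsum (\<lambda>z. exp (- c * q z)) (g ` Zn n)"
      using infsum_reindex[OF inj, of "\<lambda>z. exp (- c * q z)"] by (simp add: o_def)
    also have "\<dots> \<le> K" unfolding K_def by (rule infsum_mono2[OF s sc sub]) simp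
    finally show "infsum (\<lambda>x. exp (- c * q (g x))) (Zn n) \<le> K" .
  qed
  have sf: "(\<lambda>x. norm (f x)) summable_on Zn n"
    using theta_summable[of \<tau> a w b] y0 unfolding f_def sh_def y_def by simp
  have sfA: "f summable_on A" if "A \<subseteq> Zn n" for A
    using summable_on_subset_banach[OF abs_summable_summable[OF sf] that] .
  have "theta w a b \<tau> = infsum f (Zn n)" unfolding theta_def f_def sh_def ..
  also have "Zn n = Z \<union> (Zn n - Z)" by (auto simp: Z_def)
  also have "infsum f \<dots> = infsum f Z + infsum f (Zn n - Z)"
    by (rule infsum_Un_disjoint) (auto intro!: sfA simp: Z_def)
  finally have split: "theta w a b \<tau> - infsum f Z = infsum f (Zn n - Z)" by simp
  have rest: "norm (infsum f (Zn n - Z)) \<le> K * exp (- \<delta> * Im \<tau>)"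
  proof -
    have s': "(\<lambda>x. exp (- \<delta> * y) * exp (- c * q (g x))) summable_on Zn n"
      by (rule summable_on_cmult_right[OF sumg])
    have "norm (infsum f (Zn n - Z)) \<le> infsum (\<lambda>x. norm (f x)) (Zn n - Z)"
      by (rule norm_infsum_bound) (rule summable_on_subset_banach[OF sf], auto)
    also have "\<dots> \<le> infsum (\<lambda>x. exp (- \<delta> * y) * exp (- c * q (g x))) (Zn n - Z)"
      by (intro infsum_mono bound summable_on_subset_banach[OF sf] summable_on_subset_banach[OF s']) auto
    also have "\<dots> \<le> infsum (\<lambda>x. exp (- \<delta> * y) * exp (- c * q (g x))) (Zn n)"
      by (intro infsum_mono2 summable_on_subset_banach[OF s'] s') auto
    also have "\<dots> = exp (- \<delta> * y) * infsum (\<lambda>x. exp (- c * q (g x))) (Zn n)"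
      by (rule infsum_cmult_right')
    also have "\<dots> \<le> exp (- \<delta> * y) * K" using K by (intro mult_left_mono) auto
    finally show ?thesis by (simp add: y_def mult.commute)
  qed
  have uniq: "x = x'" if "x \<in> Z" "x' \<in> Z" for x x'
  proof
    fix i show "x i = x' i"
    proof (cases "i < n")
      case True
      hence "sh x i = 0" "sh x' i = 0" using that by (auto simp: Z_def)
      thus ?thesis by (simp add: sh_def)
    next
      case False thus ?thesis using that by (simp add: Z_def Zn_def)
    qed
  qed
  have fZ: "norm (f x) = 1" if "x \<in> Z" for x
  proof -
    have "q (sh x) = 0" using that by (simp add: Z_def qf_def)
    thus ?thesis by (simp add: normf)
  qed
  show "\<exists>\<kappa>. norm \<kappa> \<le> 1 \<and> (a = 0 \<longrightarrow> \<kappa> = 1) \<and>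
       ((\<forall>x\<in>Zn n. \<exists>i<n. x i + of_int a * w i \<noteq> 0) \<longrightarrow> \<kappa> = 0) \<and>
       norm (theta w a b \<tau> - \<kappa>) \<le> K * exp (- \<delta> * Im \<tau>)"
  proof (cases "Z = {}")
    case True
    have "a \<noteq> 0"
    proof
      assume "a = 0"
      hence "(\<lambda>_. 0) \<in> Z" by (simp add: Z_def Zn_def sh_def)
      thus False using True by simp
    qed
    moreover have "norm (theta w a b \<tau> - 0) \<le> K * exp (- \<delta> * Im \<tau>)"
      using rest split True by simp
    ultimately show ?thesis by (intro exI[of _ 0]) auto
  next
    case False
    then obtain x0 where x0: "x0 \<in> Z" by blast
    hence Z: "Z = {x0}" using uniq by blast
    have "infsum f Z = f x0" by (simp add: Z)
    hence 1: "norm (theta w a b \<tau> - f x0) \<le> K * exp (- \<delta> * Im \<tau>)" using split rest by simp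
    have 2: "f x0 = 1" if "a = 0"
    proof -
      have "x0 = (\<lambda>_. 0)" by (rule uniq[OF x0]) (simp add: that Z_def Zn_def sh_def)
      thus ?thesis using that by (simp add: f_def sh_def qf_def bf_def)
    qed
    have 3: "\<not> (\<forall>x\<in>Zn n. \<exists>i<n. x i + of_int a * w i \<noteq> 0)"
      using x0 by (auto simp: Z_def sh_def)
    show ?thesis
    proof (intro exI[of _ "f x0"] conjI impI)
      show "norm (f x0) \<le> 1" using fZ[OF x0] by simp
      show "f x0 = 0" if "\<forall>x\<in>Zn n. \<exists>i<n. x i + of_int a * w i \<noteq> 0"
        using 3 that by (rule notE)
      show "f x0 = 1" if "a = 0" by (rule 2[OF that])
      show "norm (theta w a b \<tau> - f x0) \<le> K * exp (- \<delta> * Im \<tau>)" by (rule 1)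
    qed
  qed
qed

text \<open>Complete \<open>(c, d)\<close> to a matrix of determinant \<open>1\<close> and apply \<open>theta_cusp\<close> at the image of \<open>\<tau>\<close>. There the
characteristic \<open>(0, 1)\<close> has become \<open>(- c, v)\<close>; for \<open>c = 1\<close> the translate \<open>\<Lambda> - w\<close> does not contain zero.\<close>

lemma theta_diff_cusp:
  assumes N: "N > 0" "\<And>i. i < n \<Longrightarrow> real N * w i \<in> \<int>" and w: "\<exists>i<n. w i \<notin> \<int>"
  obtains K \<delta> where "K \<ge> 0" "\<delta> > 0"
    "\<And>c d \<tau>. coprime c d \<Longrightarrow> c > 0 \<Longrightarrow> Im \<tau> > 0 \<Longrightarrow> Im \<tau> / (norm (of_int c * \<tau> + of_int d))^2 \<ge> 1 / 5 \<Longrightarrow>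
      \<exists>\<kappa>. norm \<kappa> \<le> 2 \<and> (c = 1 \<longrightarrow> \<kappa> = 1) \<and>
       norm (theta w 0 0 \<tau> - theta w 0 1 \<tau> - \<kappa> / (of_int c * \<tau> + of_int d) ^ s) \<le>
         K / norm (of_int c * \<tau> + of_int d) ^ s * exp (- \<delta> * (Im \<tau> / (norm (of_int c * \<tau> + of_int d))^2))"
proof (rule theta_cusp[OF N])
  fix K \<delta> assume K: "K \<ge> 0" "\<delta> > 0" and cusp:
    "\<And>a b \<tau>. Im \<tau> \<ge> 1 / 5 \<Longrightarrow> \<exists>\<kappa>. norm \<kappa> \<le> 1 \<and> (a = 0 \<longrightarrow> \<kappa> = 1) \<and>
       ((\<forall>x\<in>Zn n. \<exists>i<n. x i + of_int a * w i \<noteq> 0) \<longrightarrow> \<kappa> = 0) \<and>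
       norm (theta w a b \<tau> - \<kappa>) \<le> K * exp (- \<delta> * Im \<tau>)"
  show ?thesis
  proof
    show "2 * K \<ge> 0" "\<delta> > 0" using K by auto
    fix c d :: int and \<tau> :: complex
    assume cd: "coprime c d" "c > 0" and \<tau>: "Im \<tau> > 0" and y': "Im \<tau> / (norm (of_int c * \<tau> + of_int d))^2 \<ge> 1 / 5"
    obtain u v where "u * c + v * d = gcd c d" using bezout_int by blast
    hence uv: "u * c + v * d = 1" using cd(1) by simp
    define D where "D = of_int c * \<tau> + of_int d"
    define \<sigma> where "\<sigma> = (of_int v * \<tau> + of_int (- u)) / (of_int c * \<tau> + of_int d)"
    have det: "v * d - (- u) * c = 1" using uv by simp
    have D: "D \<noteq> 0" unfolding D_def by (rule moebius_denom_nz[OF det \<tau>])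
    have Im\<sigma>: "Im \<sigma> = Im \<tau> / (norm D)^2" unfolding \<sigma>_def D_def by (rule Im_moebius[OF det])
    have "theta w 0 0 \<sigma> = D ^ s * theta w 0 0 \<tau>"
      unfolding \<sigma>_def D_def using theta_modular[OF det \<tau>, of w 0 0] by simp
    hence t0: "theta w 0 0 \<tau> = theta w 0 0 \<sigma> / D ^ s" using D by simp
    have "theta w (- c) v \<sigma> = D ^ s * theta w (- c * v + v * c) (- c * (- u) + v * d) \<tau>"
      unfolding \<sigma>_def D_def by (rule theta_modular[OF det \<tau>])
    moreover have "- c * v + v * c = 0" "- c * (- u) + v * d = 1" using uv by (simp_all add: mult.commute)
    ultimately have "theta w (- c) v \<sigma> = D ^ s * theta w 0 1 \<tau>" by (simp only:)
    hence t1: "theta w 0 1 \<tau> = theta w (- c) v \<sigma> / D ^ s" using D by simp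
    have y5: "Im \<sigma> \<ge> 1 / 5" using y' unfolding Im\<sigma> D_def .
    have "norm (theta w 0 0 \<sigma> - 1) \<le> K * exp (- \<delta> * Im \<sigma>)" using cusp[OF y5, of 0 0] by auto
    moreover obtain \<kappa> where \<kappa>: "norm \<kappa> \<le> 1" "(\<forall>x\<in>Zn n. \<exists>i<n. x i + of_int (- c) * w i \<noteq> 0) \<Longrightarrow> \<kappa> = 0"
       "norm (theta w (- c) v \<sigma> - \<kappa>) \<le> K * exp (- \<delta> * Im \<sigma>)"
      using cusp[OF y5, of "- c" v] by blast
    ultimately have "norm ((theta w 0 0 \<sigma> - 1) - (theta w (- c) v \<sigma> - \<kappa>)) \<le> 2 * K * exp (- \<delta> * Im \<sigma>)"
      using norm_triangle_ineq4[of "theta w 0 0 \<sigma> - 1" "theta w (- c) v \<sigma> - \<kappa>"] by linarith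
    hence "norm ((theta w 0 0 \<sigma> - 1) - (theta w (- c) v \<sigma> - \<kappa>)) / norm D ^ s \<le> 2 * K * exp (- \<delta> * Im \<sigma>) / norm D ^ s"
      by (intro divide_right_mono) auto
    also have "norm ((theta w 0 0 \<sigma> - 1) - (theta w (- c) v \<sigma> - \<kappa>)) / norm D ^ s = norm (((theta w 0 0 \<sigma> - 1) - (theta w (- c) v \<sigma> - \<kappa>)) / D ^ s)"
      by (simp only: norm_divide norm_power)
    also have "((theta w 0 0 \<sigma> - 1) - (theta w (- c) v \<sigma> - \<kappa>)) / D ^ s = theta w 0 0 \<tau> - theta w 0 1 \<tau> - (1 - \<kappa>) / D ^ s"
      unfolding t0 t1 by (simp add: diff_divide_distrib)
    also have "2 * K * exp (- \<delta> * Im \<sigma>) / norm D ^ s = 2 * K / norm D ^ s * exp (- \<delta> * (Im \<tau> / (norm D)^2))"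
      unfolding Im\<sigma> by simp
    finally have main: "norm (theta w 0 0 \<tau> - theta w 0 1 \<tau> - (1 - \<kappa>) / D ^ s) \<le> 2 * K / norm D ^ s * exp (- \<delta> * (Im \<tau> / (norm D)^2))" .
    have "norm (1 - \<kappa>) \<le> 2" using norm_triangle_ineq4[of 1 \<kappa>] \<kappa>(1) by simp
    moreover have "1 - \<kappa> = 1" if "c = 1"
    proof -
      obtain i where i: "i < n" "w i \<notin> \<int>" using w by blast
      have "x i + of_int (- c) * w i \<noteq> 0" if "x \<in> Zn n" for x
        using that i \<open>c = 1\<close> by (auto simp: Zn_def)
      hence "\<kappa> = 0" using \<kappa>(2) i(1) by blast
      thus ?thesis by simp
    qed
    ultimately show "\<exists>\<kappa>. norm \<kappa> \<le> 2 \<and> (c = 1 \<longrightarrow> \<kappa> = 1) \<and>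
       norm (theta w 0 0 \<tau> - theta w 0 1 \<tau> - \<kappa> / (of_int c * \<tau> + of_int d) ^ s) \<le>
         2 * K / norm (of_int c * \<tau> + of_int d) ^ s * exp (- \<delta> * (Im \<tau> / (norm (of_int c * \<tau> + of_int d))^2))"
      using main unfolding D_def by blast
  qed
qed

end

section \<open>Approximation on a horizontal line\<close>

lemma power_exp_bound:
  assumes "\<delta> > 0" "v \<ge> 0" "m > 0"
  shows "v ^ m * exp (- \<delta> * v) \<le> (real m / \<delta>) ^ m"
proof -
  have "(\<delta> * v / m) ^ m \<le> (1 + \<delta> * v / m) ^ m"
    using assms by (intro power_mono) auto
  also have "\<dots> \<le> exp (\<delta> * v)"
    using assms by (intro exp_ge_one_plus_x_over_n_power_n) (auto intro: order_trans[of _ 0])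
  finally have "(\<delta> * v / m) ^ m * exp (- \<delta> * v) \<le> exp (\<delta> * v) * exp (- \<delta> * v)"
    by (intro mult_right_mono) auto
  hence "(\<delta> * v / m) ^ m * exp (- \<delta> * v) \<le> 1" by (simp flip: exp_add)
  hence "(m / \<delta>) ^ m * ((\<delta> * v / m) ^ m * exp (- \<delta> * v)) \<le> (m / \<delta>) ^ m * 1"
    using assms by (intro mult_left_mono) auto
  also have "(m / \<delta>) ^ m * ((\<delta> * v / m) ^ m * exp (- \<delta> * v)) = ((m / \<delta>) * (\<delta> * v / m)) ^ m * exp (- \<delta> * v)"
    by (simp only: power_mult_distrib mult.assoc)
  also have "(m / \<delta>) * (\<delta> * v / m) = v" using assms by simp
  finally show ?thesis by simp
qed

lemma abs_of_int_ge_1: "d \<noteq> 0 \<Longrightarrow> \<bar>of_int d\<bar> \<ge> (1::real)"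
  by (metis Ints_nonzero_abs_ge1 Ints_of_int of_int_eq_0_iff)

text \<open>Dirichlet approximation to \<open>Re \<tau>\<close> with denominators up to about \<open>1 / sqrt (Im \<tau>)\<close> finds a cusp that \<open>\<tau>\<close> is close to: the last bound says that
the corresponding element of the modular group lifts \<open>\<tau>\<close> to height at least \<open>1 / 5\<close>.\<close>

lemma dirichlet_disc:
  fixes \<tau> :: complex
  assumes y: "0 < Im \<tau>" "Im \<tau> \<le> 1"
  obtains c d :: int where "coprime c d" "c > 0" "real_of_int c \<le> 2 / sqrt (Im \<tau>)"
    "\<bar>of_int c * Re \<tau> + of_int d\<bar> \<le> sqrt (Im \<tau>)"
    "(norm (of_int c * \<tau> + of_int d))^2 \<le> 5 * Im \<tau>"
proof -
  (* Rounding up costs a factor 2 in the bound for c and leads to the constant 5 = 1 + 2^2. *)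
  define M where "M = nat \<lceil>1 / sqrt (Im \<tau>)\<rceil>"
  have sq: "sqrt (Im \<tau>) > 0" "sqrt (Im \<tau>) \<le> 1" using y by auto
  have M1: "1 / sqrt (Im \<tau>) \<le> real M" unfolding M_def by (simp add: real_nat_ceiling_ge)
  have M2: "real M \<le> 2 / sqrt (Im \<tau>)"
  proof -
    have "real M \<le> 1 / sqrt (Im \<tau>) + 1" unfolding M_def using sq by (simp add: of_nat_nat)
    moreover have "1 \<le> 1 / sqrt (Im \<tau>)" using sq by simp
    moreover have "2 / sqrt (Im \<tau>) = 1 / sqrt (Im \<tau>) + 1 / sqrt (Im \<tau>)" by simp
    ultimately show ?thesis by linarith
  qed
  have Mpos: "M > 0" using M1 sq by (cases "M = 0") auto
  obtain h k where hk: "coprime h k" "0 < k" "k \<le> int M" "\<bar>of_int k * Re \<tau> - of_int h\<bar> < 1 / M"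
    using Dirichlet_approx_coprime[OF Mpos] by blast
  show ?thesis
  proof
    show "coprime k (- h)" using hk(1) by (simp add: coprime_commute)
    show "k > 0" by fact
    have "real_of_int k \<le> real M" using hk(3) by linarith
    thus c: "real_of_int k \<le> 2 / sqrt (Im \<tau>)" using M2 by linarith
    have "1 / M \<le> sqrt (Im \<tau>)" using M1 sq Mpos by (simp add: field_simps)
    thus 1: "\<bar>of_int k * Re \<tau> + of_int (- h)\<bar> \<le> sqrt (Im \<tau>)" using hk(4) by simp
    have "(norm (of_int k * \<tau> + of_int (- h)))^2 = (of_int k * Re \<tau> + of_int (- h))^2 + (of_int k * Im \<tau>)^2"
      by (simp add: cmod_power2)
    also have "(of_int k * Re \<tau> + of_int (- h))^2 \<le> (sqrt (Im \<tau>))^2"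
      by (rule abs_le_square_iff[THEN iffD1]) (use 1 sq in auto)
    also have "(of_int k * Im \<tau>)^2 \<le> (2 * sqrt (Im \<tau>))^2"
    proof (rule power_mono)
      have "of_int k * Im \<tau> \<le> 2 / sqrt (Im \<tau>) * Im \<tau>" using c y by (intro mult_right_mono) auto
      also have "\<dots> = 2 * sqrt (Im \<tau>)" using real_div_sqrt[of "Im \<tau>"] y by simp
      finally show "of_int k * Im \<tau> \<le> 2 * sqrt (Im \<tau>)" .
    qed (use hk y in auto)
    finally show "(norm (of_int k * \<tau> + of_int (- h)))^2 \<le> 5 * Im \<tau>" using y by (simp add: power_mult_distrib)
  qed
qed

context even_unimodular_gram
begin

definition theta_diff :: "(nat \<Rightarrow> real) \<Rightarrow> complex \<Rightarrow> complex" where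
  "theta_diff w \<tau> = theta w 0 0 \<tau> - theta w 0 1 \<tau>"

text \<open>On a line close to the real axis the difference of the theta series is its polar part at \<open>0\<close>, up to the bound
\<open>C y\<^sup>-\<^sup>s\<^sup>/\<^sup>2\<close> that holds for cusp forms, except near the cusps with denominator \<open>c \<ge> 2\<close>. If the cusp found for \<open>\<tau>\<close> is not \<open>0\<close>, the polar part
\<open>\<tau>\<^sup>-\<^sup>s\<close> itself is of the size of the error; so are the polar parts at the other cusps with \<open>c = 1\<close>, which lie at distance at least \<open>1 / 2\<close>.\<close>

lemma theta_diff_approx:
  assumes N: "N > 0" "\<And>i. i < n \<Longrightarrow> real N * w i \<in> \<int>" and w: "\<exists>i<n. w i \<notin> \<int>"
  obtains C where "C \<ge> 0"
    "\<And>\<tau>. \<bar>Re \<tau>\<bar> \<le> 1/2 \<Longrightarrow> 0 < Im \<tau> \<Longrightarrow> Im \<tau> \<le> 1/20 \<Longrightarrow>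
       norm (theta_diff w \<tau> - 1 / \<tau> ^ s) \<le> C / sqrt (Im \<tau>) ^ s \<or>
       (\<exists>c d :: int. 2 \<le> c \<and> of_int c \<le> 2 / sqrt (Im \<tau>) \<and> - c \<le> d \<and> d < c \<and>
          norm (theta_diff w \<tau> - 1 / \<tau> ^ s) \<le> C / sqrt (Im \<tau>) ^ s + 2 / norm (of_int c * \<tau> + of_int d) ^ s)"
proof (rule theta_diff_cusp[OF N w])
  fix K \<delta>
  assume K: "K \<ge> 0" "\<delta> > 0" and cusp: "\<And>c d \<tau>. coprime c d \<Longrightarrow> c > 0 \<Longrightarrow> Im \<tau> > 0 \<Longrightarrow> Im \<tau> / (norm (of_int c * \<tau> + of_int d))^2 \<ge> 1 / 5 \<Longrightarrow>
      \<exists>\<kappa>. norm \<kappa> \<le> 2 \<and> (c = 1 \<longrightarrow> \<kappa> = 1) \<and>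
       norm (theta w 0 0 \<tau> - theta w 0 1 \<tau> - \<kappa> / (of_int c * \<tau> + of_int d) ^ s) \<le>
         K / norm (of_int c * \<tau> + of_int d) ^ s * exp (- \<delta> * (Im \<tau> / (norm (of_int c * \<tau> + of_int d))^2))"
  define m where "m = s div 2"
  have sm: "s = 2 * m" using s(2) by (auto simp: m_def)
  have m0: "m > 0" using s(3) sm by linarith
  define E where "E = (real m / \<delta>) ^ m"
  define C where "C = K * E + 2 ^ s + 4 ^ s"
  have E: "E \<ge> 0" using K by (simp add: E_def)
  show ?thesis
  proof
    show "C \<ge> 0" using K E by (simp add: C_def)
    fix \<tau> assume \<tau>: "\<bar>Re \<tau>\<bar> \<le> 1/2" "0 < Im \<tau>" "Im \<tau> \<le> 1/20"
    define y where "y = Im \<tau>"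
    have y: "y > 0" "y \<le> 1/20" using \<tau> by (auto simp: y_def)
    have sq: "sqrt y > 0" "sqrt y < 1/4"
    proof -
      show "sqrt y > 0" using y by simp
      have "sqrt y < sqrt ((1/4)^2)" using y by (intro real_sqrt_less_mono) (simp add: power2_eq_square)
      thus "sqrt y < 1/4" by simp
    qed
    have y1: "Im \<tau> \<le> 1" using \<tau>(3) by simp
    obtain c d where cd: "coprime c d" "c > 0" "real_of_int c \<le> 2 / sqrt (Im \<tau>)"
      "\<bar>of_int c * Re \<tau> + of_int d\<bar> \<le> sqrt (Im \<tau>)"
      "(norm (of_int c * \<tau> + of_int d))^2 \<le> 5 * Im \<tau>"
      by (rule dirichlet_disc[OF \<tau>(2) y1])
    define D where "D = of_int c * \<tau> + of_int d"
    define R where "R = norm D"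
    have R: "R > 0"
    proof -
      have "Im D = of_int c * y" by (simp add: D_def y_def)
      hence "Im D \<noteq> 0" using cd y by simp
      hence "D \<noteq> 0" by auto
      thus ?thesis by (simp add: R_def)
    qed
    have R2: "R^2 \<le> 5 * y" using cd(5) by (simp add: R_def D_def y_def)
    have y': "y / R^2 \<ge> 1/5" using R R2 by (simp add: field_simps)
    obtain \<kappa> where \<kappa>: "norm \<kappa> \<le> 2" "c = 1 \<Longrightarrow> \<kappa> = 1"
       "norm (theta_diff w \<tau> - \<kappa> / D ^ s) \<le> K / R ^ s * exp (- \<delta> * (y / R^2))"
      using cusp[OF cd(1,2) \<tau>(2)] y' unfolding theta_diff_def D_def R_def y_def by blast
    have err: "K / R ^ s * exp (- \<delta> * (y / R^2)) \<le> K * E / sqrt y ^ s"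
    proof -
      have "sqrt y ^ s = y ^ m" using y by (simp add: sm power_mult)
      moreover have "R ^ s = (R^2) ^ m" by (simp add: sm power_mult)
      ultimately have "1 / R ^ s = (y / R^2) ^ m / sqrt y ^ s" using y R by (simp add: power_divide)
      hence "1 / R ^ s * exp (- \<delta> * (y / R^2)) = ((y / R^2) ^ m * exp (- \<delta> * (y / R^2))) / sqrt y ^ s" by simp
      also have "\<dots> \<le> E / sqrt y ^ s"
        unfolding E_def using y K m0 by (intro divide_right_mono power_exp_bound) auto
      finally have "K * (1 / R ^ s * exp (- \<delta> * (y / R^2))) \<le> K * (E / sqrt y ^ s)" using K by (intro mult_left_mono) auto
      thus ?thesis by simp
    qed
    have main: "norm (theta_diff w \<tau> - \<kappa> / D ^ s) \<le> K * E / sqrt y ^ s" using \<kappa>(3) err by linarith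
    have sqs: "sqrt y ^ s > 0" using sq by simp
    have s2: "2 ^ s \<le> 2 ^ s / sqrt y ^ s"
    proof -
      have "sqrt y ^ s \<le> 1" using sq y by (intro power_le_one) auto
      thus ?thesis using sqs by (simp add: field_simps)
    qed
    have mono: "K * E / sqrt y ^ s \<le> C / sqrt y ^ s" "K * E / sqrt y ^ s + 2 ^ s / sqrt y ^ s + 4 ^ s / sqrt y ^ s = C / sqrt y ^ s"
      using sqs by (auto simp: C_def add_divide_distrib intro!: divide_right_mono)
    show "norm (theta_diff w \<tau> - 1 / \<tau> ^ s) \<le> C / sqrt (Im \<tau>) ^ s \<or>
       (\<exists>c d :: int. 2 \<le> c \<and> of_int c \<le> 2 / sqrt (Im \<tau>) \<and> - c \<le> d \<and> d < c \<and>
          norm (theta_diff w \<tau> - 1 / \<tau> ^ s) \<le> C / sqrt (Im \<tau>) ^ s + 2 / norm (of_int c * \<tau> + of_int d) ^ s)"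
    proof (cases "d = 0")
      case True
      hence c1: "c = 1" using cd(1,2) by simp
      hence "D = \<tau>" using True by (simp add: D_def)
      thus ?thesis using main mono(1) \<kappa>(2)[OF c1] by (auto simp: y_def)
    next
      case False
      have "1 \<le> \<bar>real_of_int d\<bar>" using abs_of_int_ge_1[OF False] .
      also have "\<bar>real_of_int d\<bar> = norm (D - of_int c * \<tau>)" by (simp add: D_def)
      also have "\<dots> \<le> R + of_int c * norm \<tau>"
        using norm_triangle_ineq4[of D "of_int c * \<tau>"] cd(2) by (simp add: R_def norm_mult)
      also have "R \<le> 1/2"
      proof (rule power2_le_imp_le)
        show "R^2 \<le> (1/2)^2" using R2 y by (simp add: power2_eq_square)
      qed simp
      also have "of_int c * norm \<tau> \<le> 2 / sqrt y * norm \<tau>" using cd(3) by (intro mult_right_mono) (auto simp: y_def)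
      finally have "1/2 \<le> 2 / sqrt y * norm \<tau>" by simp
      hence n\<tau>: "sqrt y / 4 \<le> norm \<tau>" using sq by (simp add: field_simps)
      have n\<tau>s: "norm (1 / \<tau> ^ s) \<le> 4 ^ s / sqrt y ^ s"
      proof -
        have "1 / norm \<tau> ^ s \<le> 1 / (sqrt y / 4) ^ s"
          using n\<tau> sq by (intro divide_left_mono power_mono mult_pos_pos zero_less_power) auto
        thus ?thesis by (simp add: norm_divide norm_power power_divide)
      qed
      have tri: "norm (theta_diff w \<tau> - 1 / \<tau> ^ s) \<le> K * E / sqrt y ^ s + norm (\<kappa> / D ^ s) + 4 ^ s / sqrt y ^ s"
      proof -
        have "theta_diff w \<tau> - 1 / \<tau> ^ s = (theta_diff w \<tau> - \<kappa> / D ^ s) + \<kappa> / D ^ s - 1 / \<tau> ^ s" by simp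
        also have "norm \<dots> \<le> norm (theta_diff w \<tau> - \<kappa> / D ^ s) + norm (\<kappa> / D ^ s) + norm (1 / \<tau> ^ s)"
          by (intro order_trans[OF norm_triangle_ineq4] add_right_mono norm_triangle_ineq)
        finally show ?thesis using main n\<tau>s by linarith
      qed
      show ?thesis
      proof (cases "c = 1")
        case True
        have "1/2 \<le> \<bar>Re \<tau> + of_int d\<bar>"
          using \<tau>(1) \<open>1 \<le> \<bar>real_of_int d\<bar>\<close> by linarith
        also have "\<dots> \<le> R" using abs_Re_le_cmod[of D] True by (simp add: D_def R_def)
        finally have "1 / R ^ s \<le> 1 / (1/2) ^ s"
          using R by (intro divide_left_mono power_mono mult_pos_pos zero_less_power) auto
        hence "norm (\<kappa> / D ^ s) \<le> 2 ^ s / sqrt y ^ s"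
          using s2 \<kappa>(2)[OF True] by (simp add: norm_divide norm_power R_def power_divide)
        hence "norm (theta_diff w \<tau> - 1 / \<tau> ^ s) \<le> C / sqrt y ^ s" using tri mono(2) by linarith
        thus ?thesis by (simp add: y_def)
      next
        case False
        hence c2: "2 \<le> c" using cd(2) by linarith
        have "\<bar>of_int c * Re \<tau>\<bar> \<le> of_int c * (1/2)"
          unfolding abs_mult using \<tau>(1) cd(2) by (simp add: mult_left_mono)
        hence "\<bar>real_of_int d\<bar> \<le> of_int c / 2 + 1/4" using cd(4) sq unfolding y_def by linarith
        also have "\<dots> < of_int c" using c2 by simp
        finally have d: "- c \<le> d" "d < c" by linarith+
        have "norm (\<kappa> / D ^ s) \<le> 2 / R ^ s"
          using \<kappa>(1) R by (simp add: norm_divide norm_power R_def divide_right_mono)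
        moreover have "2 ^ s / sqrt y ^ s \<ge> 0" using sqs by simp
        ultimately have "norm (theta_diff w \<tau> - 1 / \<tau> ^ s) \<le> C / sqrt y ^ s + 2 / R ^ s" using tri mono(2) by linarith
        thus ?thesis using c2 d cd(3) unfolding y_def R_def D_def by blast
      qed
    qed
  qed
qed

end

section \<open>The comparison function and its kernels\<close>

lemma e2pi_ne_1:
  assumes "e2pi \<tau> = 1" "\<bar>Re \<tau>\<bar> \<le> 1/2" shows "\<tau> = 0"
proof -
  have "exp (- 2 * pi * Im \<tau>) = 1" using assms(1) norm_e2pi[of \<tau>] by simp
  hence im: "Im \<tau> = 0" by simp
  hence "\<tau> = of_real (Re \<tau>)" by (simp add: complex_eq_iff)
  hence "e2pi (of_real (Re \<tau>)) = 1" using assms(1) by simp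
  hence "Re \<tau> \<in> \<int>" by (simp only: e2pi_eq_1_iff)
  then obtain k :: int where k: "Re \<tau> = of_int k" by (elim Ints_cases)
  hence "\<bar>k\<bar> < 1" using assms(2) by linarith
  thus ?thesis using k im by (simp add: complex_eq_iff)
qed

lemma exp_pole_small:
  assumes "z \<noteq> 0" "norm z \<le> 1/4"
  shows "norm (1 / (exp z - 1) - 1 / (z::complex)) \<le> 4"
proof -
  define r where "r = norm z"
  have r: "r > 0" "r \<le> 1/4" using assms by (auto simp: r_def)
  have "\<bar>Re z\<bar> \<le> 1/4" using abs_Re_le_cmod[of z] assms(2) by linarith
  hence "exp \<bar>Re z\<bar> \<le> exp (1/4)" by simp
  also have "exp (1/4) \<le> (2::real)" using exp_bound[of "1/4"] by (simp add: power2_eq_square)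
  finally have e: "exp \<bar>Re z\<bar> \<le> 2" .
  have "norm (exp z - (\<Sum>k\<le>1. z ^ k / fact k)) \<le> exp \<bar>Re z\<bar> * norm z ^ Suc 1 / fact 1"
    by (rule Taylor_exp)
  hence "norm (exp z - 1 - z) \<le> exp \<bar>Re z\<bar> * r^2" by (simp add: r_def power2_eq_square algebra_simps)
  also have "\<dots> \<le> 2 * r^2" using e by (intro mult_right_mono) auto
  finally have 1: "norm (exp z - 1 - z) \<le> 2 * r^2" .
  have "r \<le> norm (exp z - 1) + norm (exp z - 1 - z)"
    using norm_triangle_ineq4[of "exp z - 1" "exp z - 1 - z"] by (simp add: r_def)
  moreover have "2 * r^2 \<le> r / 2"
    using mult_left_mono[OF r(2), of "2 * r"] r by (simp add: power2_eq_square)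
  ultimately have 2: "norm (exp z - 1) \<ge> r / 2" using 1 by linarith
  hence nz: "exp z - 1 \<noteq> 0" using r by auto
  have "1 / (exp z - 1) - 1 / z = - (exp z - 1 - z) / (z * (exp z - 1))"
    using nz assms by (simp add: divide_simps)
  hence "norm (1 / (exp z - 1) - 1 / z) = norm (exp z - 1 - z) / (r * norm (exp z - 1))"
    by (simp only: norm_divide norm_mult norm_minus_cancel r_def)
  also have "\<dots> \<le> (2 * r^2) / (r * (r / 2))"
    using 1 2 r by (intro frac_le mult_left_mono) auto
  also have "\<dots> = 4" using r by (simp add: power2_eq_square)
  finally show ?thesis .
qed

text \<open>The simple poles at \<open>0\<close> cancel; away from \<open>0\<close> compactness suffices, since \<open>0\<close> is the only zero of
\<open>e2pi - 1\<close> in the rectangle.\<close>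

lemma e2pi_pole:
  "\<exists>H\<ge>0. \<forall>\<tau>. \<bar>Re \<tau>\<bar> \<le> 1/2 \<longrightarrow> 0 \<le> Im \<tau> \<longrightarrow> Im \<tau> \<le> 1 \<longrightarrow> \<tau> \<noteq> 0 \<longrightarrow>
     norm (2 * of_real pi * \<i> / (e2pi \<tau> - 1) - 1 / \<tau>) \<le> H"
proof -
  define h where "h \<tau> = 2 * of_real pi * \<i> / (e2pi \<tau> - 1) - 1 / \<tau>" for \<tau>
  define K where "K = cbox (Complex (-1/2) 0) (Complex (1/2) 1) \<inter> {\<tau>. norm \<tau> \<ge> 1 / (8 * pi)}"
  have closed: "closed {\<tau>::complex. norm \<tau> \<ge> 1 / (8 * pi)}"
    by (intro closed_Collect_le continuous_intros)
  have "compact K" unfolding K_def by (intro compact_Int_closed compact_cbox closed)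
  moreover have "continuous_on K h"
  proof -
    have nz: "\<tau> \<noteq> 0" "e2pi \<tau> \<noteq> 1" if "\<tau> \<in> K" for \<tau>
    proof -
      have "norm \<tau> > 0" using that less_le_trans[of 0 "1 / (8 * pi)" "norm \<tau>"] by (simp add: K_def)
      thus "\<tau> \<noteq> 0" by auto
      have "\<bar>Re \<tau>\<bar> \<le> 1/2" using that by (auto simp: K_def in_cbox_complex_iff)
      thus "e2pi \<tau> \<noteq> 1" using e2pi_ne_1 \<open>\<tau> \<noteq> 0\<close> by blast
    qed
    show ?thesis unfolding h_def by (intro continuous_intros) (use nz in auto)
  qed
  ultimately have "bounded (h ` K)" by (intro compact_imp_bounded compact_continuous_image)
  then obtain H where H: "\<And>\<tau>. \<tau> \<in> K \<Longrightarrow> norm (h \<tau>) \<le> H" by (auto simp: bounded_iff)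
  show ?thesis
  proof (intro exI[of _ "max (8 * pi) H"] conjI allI impI)
    fix \<tau> assume \<tau>: "\<bar>Re \<tau>\<bar> \<le> 1/2" "0 \<le> Im \<tau>" "Im \<tau> \<le> 1" "\<tau> \<noteq> 0"
    show "norm (2 * of_real pi * \<i> / (e2pi \<tau> - 1) - 1 / \<tau>) \<le> max (8 * pi) H"
    proof (cases "norm \<tau> \<ge> 1 / (8 * pi)")
      case True
      hence "\<tau> \<in> K" using \<tau> by (auto simp: K_def in_cbox_complex_iff)
      thus ?thesis using H[of \<tau>] by (simp add: h_def)
    next
      case False
      define z where "z = 2 * of_real pi * \<i> * \<tau>"
      have z0: "z \<noteq> 0" using \<tau> by (simp add: z_def)
      have "norm z = 2 * pi * norm \<tau>" by (simp add: z_def norm_mult)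
      hence "norm z \<le> 1/4" using False by (simp add: field_simps)
      hence b: "norm (1 / (exp z - 1) - 1 / z) \<le> 4" using z0 by (intro exp_pole_small)
      have "2 * of_real pi * \<i> / (e2pi \<tau> - 1) - 1 / \<tau> = 2 * of_real pi * \<i> * (1 / (exp z - 1) - 1 / z)"
        using \<tau> by (simp add: e2pi_def z_def right_diff_distrib)
      hence "norm (2 * of_real pi * \<i> / (e2pi \<tau> - 1) - 1 / \<tau>) = 2 * pi * norm (1 / (exp z - 1) - 1 / z)"
        by (simp add: norm_mult)
      also have "\<dots> \<le> 2 * pi * 4" using b by (intro mult_left_mono) auto
      finally show ?thesis by simp
    qed
  qed (simp add: le_max_iff_disj)
qed

lemma norm_power_diff_le:
  fixes a b :: complex
  assumes "norm a \<le> R" "norm b \<le> R" "R > 0" "m > 0"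
  shows "norm (a ^ m - b ^ m) \<le> of_nat m * R ^ (m - 1) * norm (a - b)"
proof -
  define a' where "a' = a / of_real R"
  define b' where "b' = b / of_real R"
  have ab: "a = of_real R * a'" "b = of_real R * b'" using assms(3) by (simp_all add: a'_def b'_def)
  have "norm (a' ^ m - b' ^ m) \<le> of_nat m * norm (a' - b')"
    by (rule norm_power_diff) (use assms in \<open>auto simp: a'_def b'_def norm_divide\<close>)
  hence "R ^ m * norm (a' ^ m - b' ^ m) \<le> R ^ m * (of_nat m * norm (a' - b'))"
    using assms by (intro mult_left_mono) auto
  also have "R ^ m * (of_nat m * norm (a' - b')) = of_nat m * R ^ (m - 1) * (R * norm (a' - b'))"
  proof -
    have "R ^ m = R * R ^ (m - 1)" using assms(4) by (simp add: power_eq_if)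
    thus ?thesis by (simp only: mult_ac)
  qed
  also have "R * norm (a' - b') = norm (a - b)"
    using assms(3) unfolding ab right_diff_distrib[symmetric] norm_mult by simp
  also have "R ^ m * norm (a' ^ m - b' ^ m) = norm (a ^ m - b ^ m)"
    using assms(3) unfolding ab power_mult_distrib right_diff_distrib[symmetric] norm_mult by (simp add: norm_power)
  finally show ?thesis .
qed

text \<open>For \<open>s\<close> divisible by \<open>4\<close> the comparison function is the \<open>s\<close>-th power of \<open>2 \<pi> \<i> / (e2pi \<tau> - 1)\<close>, which differs from \<open>1 / \<tau>\<close> by
a bounded function.\<close>

lemma polar_approx:
  assumes "4 dvd (s::nat)" "s > 0"
  obtains C where "C \<ge> 0"
    "\<And>\<tau>. \<bar>Re \<tau>\<bar> \<le> 1/2 \<Longrightarrow> 0 < Im \<tau> \<Longrightarrow> Im \<tau> \<le> 1 \<Longrightarrow>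
       norm (of_real ((2 * pi) ^ s) / (1 - e2pi \<tau>) ^ s - 1 / \<tau> ^ s) \<le> C / norm \<tau> ^ (s - 1)"
proof -
  obtain H where H: "H \<ge> 0" "\<And>\<tau>. \<bar>Re \<tau>\<bar> \<le> 1/2 \<Longrightarrow> 0 \<le> Im \<tau> \<Longrightarrow> Im \<tau> \<le> 1 \<Longrightarrow> \<tau> \<noteq> 0 \<Longrightarrow>
     norm (2 * of_real pi * \<i> / (e2pi \<tau> - 1) - 1 / \<tau>) \<le> H"
    using e2pi_pole by blast
  define C where "C = of_nat s * (1 + 2 * H) ^ (s - 1) * H"
  show ?thesis
  proof (rule that[of C])
    show "C \<ge> 0" using H by (simp add: C_def)
    fix \<tau> assume \<tau>: "\<bar>Re \<tau>\<bar> \<le> 1/2" "0 < Im \<tau>" "Im \<tau> \<le> 1"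
    hence \<tau>0: "\<tau> \<noteq> 0" by auto
    define a where "a = 2 * of_real pi * \<i> / (e2pi \<tau> - 1)"
    define b where "b = 1 / \<tau>"
    have ab: "norm (a - b) \<le> H" unfolding a_def b_def using H(2)[of \<tau>] \<tau> \<tau>0 by simp
    define R where "R = (1 + 2 * H) / norm \<tau>"
    have R: "R > 0" using H \<tau>0 by (auto simp: R_def intro!: divide_pos_pos add_pos_nonneg)
    have n2: "norm \<tau> \<le> 2" using cmod_le[of \<tau>] \<tau> by linarith
    have nb: "norm b = 1 / norm \<tau>" by (simp add: b_def norm_divide)
    have "H \<le> 2 * H / norm \<tau>"
      using mult_left_mono[OF n2 H(1)] \<tau>0 by (simp add: field_simps)
    hence HR: "1 / norm \<tau> + H \<le> R" by (simp add: R_def add_divide_distrib)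
    have "norm a \<le> norm b + norm (a - b)" using norm_triangle_ineq[of b "a - b"] by simp
    hence "norm a \<le> R" using ab nb HR by linarith
    moreover have "norm b \<le> R" using nb HR H(1) by linarith
    ultimately have "norm (a ^ s - b ^ s) \<le> of_nat s * R ^ (s - 1) * norm (a - b)"
      using R assms by (intro norm_power_diff_le) auto
    also have "\<dots> \<le> of_nat s * R ^ (s - 1) * H"
      using ab R by (intro mult_left_mono) auto
    also have "\<dots> = C / norm \<tau> ^ (s - 1)" by (simp add: C_def R_def power_divide)
    also have "a ^ s = of_real ((2 * pi) ^ s) / (1 - e2pi \<tau>) ^ s"
    proof -
      obtain k where k: "s = 4 * k" using assms by blast
      have "(e2pi \<tau> - 1) ^ 4 = (1 - e2pi \<tau>) ^ 4"
        using power_minus_even[of 4 "1 - e2pi \<tau>"] by simp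
      moreover have "\<i> ^ 4 = 1" by (simp add: eval_nat_numeral)
      ultimately show ?thesis unfolding a_def k
        by (simp only: power_divide power_mult power_mult_distrib of_real_power of_real_mult of_real_numeral mult_1_right)
    qed
    finally show "norm (of_real ((2 * pi) ^ s) / (1 - e2pi \<tau>) ^ s - 1 / \<tau> ^ s) \<le> C / norm \<tau> ^ (s - 1)"
      by (simp add: b_def power_divide)
  qed
qed

lemma integral_cauchy_kernel:
  fixes y a b :: real
  assumes "y > 0" "a \<le> b"
  shows "integral {a..b} (\<lambda>v. 1 / (v^2 + y^2)) \<le> pi / y"
proof -
  have nz: "v^2 + y^2 > 0" for v using assms by (intro add_nonneg_pos) auto
  have "((\<lambda>v. 1 / (v^2 + y^2)) has_integral (arctan (b / y) / y - arctan (a / y) / y)) {a..b}"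
  proof (rule fundamental_theorem_of_calculus[OF assms(2)])
    fix v assume "v \<in> {a..b}"
    have "((\<lambda>v. arctan (v / y) / y) has_real_derivative (1 / (1 + (v / y)^2)) * (1 / y) / y) (at v)"
      using assms(1) by (auto intro!: derivative_eq_intros simp: inverse_eq_divide)
    also have "(1 / (1 + (v / y)^2)) * (1 / y) / y = 1 / (v^2 + y^2)"
    proof -
      have "v^2 + y^2 = y^2 * (1 + (v / y)^2)" using assms(1) by (simp add: power_divide distrib_left)
      thus ?thesis by (simp add: power2_eq_square mult_ac)
    qed
    finally show "((\<lambda>v. arctan (v / y) / y) has_vector_derivative 1 / (v^2 + y^2)) (at v within {a..b})"
      by (metis has_real_derivative_iff_has_vector_derivative has_field_derivative_at_within)
  qed
  hence "integral {a..b} (\<lambda>v. 1 / (v^2 + y^2)) = (arctan (b / y) - arctan (a / y)) / y"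
    by (simp add: integral_unique diff_divide_distrib)
  also have "arctan (b / y) - arctan (a / y) \<le> pi"
    using arctan_ubound[of "b / y"] arctan_lbound[of "a / y"] by linarith
  finally show ?thesis using assms(1) by (simp add: divide_right_mono)
qed

lemma arctan_ge: "x \<ge> 0 \<Longrightarrow> arctan x \<ge> x / (1 + x^2)"
proof -
  assume x: "x \<ge> 0"
  have nz: "1 + v^2 > 0" for v :: real by (intro add_pos_nonneg) auto
  have "arctan 0 - 0 / (1 + 0^2) \<le> arctan x - x / (1 + x^2)"
  proof (rule DERIV_nonneg_imp_nondecreasing[OF x])
    fix v :: real assume v: "0 \<le> v" "v \<le> x"
    have "((\<lambda>v. arctan v - v / (1 + v^2)) has_real_derivative
       1 / (1 + v^2) - (1 * (1 + v^2) - v * (2 * v)) / (1 + v^2)^2) (at v)"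
      using nz[of v] by (auto intro!: derivative_eq_intros simp: inverse_eq_divide power2_eq_square)
    moreover have "(1 * (1 + v^2) - v * (2 * v)) / (1 + v^2)^2 \<le> (1 + v^2) / (1 + v^2)^2"
      by (intro divide_right_mono) auto
    hence "(1 * (1 + v^2) - v * (2 * v)) / (1 + v^2)^2 \<le> 1 / (1 + v^2)"
      using nz[of v] by (simp add: power2_eq_square)
    ultimately show "\<exists>D. ((\<lambda>v. arctan v - v / (1 + v^2)) has_real_derivative D) (at v) \<and> 0 \<le> D"
      by (intro exI conjI) auto
  qed
  thus ?thesis by simp
qed

text \<open>For \<open>t > 0\<close> this is \<open>arctan_ge\<close> at \<open>1 / t\<close>.\<close>

lemma arctan_plus_le: "t / (1 + t^2) + arctan t \<le> pi / 2"
proof (cases "t > 0")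
  case True
  have "arctan (1 / t) \<ge> (1 / t) / (1 + (1 / t)^2)" using True by (intro arctan_ge) auto
  also have "(1 / t) / (1 + (1 / t)^2) = t / (1 + t^2)"
  proof -
    have "1 + (1/t)^2 = (1 + t^2) / t^2" using True by (simp add: power_divide add_divide_distrib)
    hence "(1 / t) / (1 + (1 / t)^2) = (1 / t) * t^2 / (1 + t^2)" by simp
    thus ?thesis using True by (simp add: power2_eq_square)
  qed
  finally have "t / (1 + t^2) \<le> arctan (inverse t)" by (simp only: inverse_eq_divide)
  thus ?thesis using arctan_inverse[OF True] by linarith
next
  case False
  hence "t / (1 + t^2) \<le> 0" by (intro divide_nonpos_pos add_pos_nonneg) auto
  moreover have "arctan t \<le> 0" using False by (simp add: not_less)
  ultimately show ?thesis using pi_gt_zero by linarith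
qed

lemma integral_cauchy_kernel_squared:
  fixes y a b :: real
  assumes "y > 0" "a \<le> b"
  shows "integral {a..b} (\<lambda>v. 1 / (v^2 + y^2)^2) \<le> pi / (2 * y^3)"
proof -
  have nz: "1 + t^2 > 0" for t :: real by (intro add_pos_nonneg) auto
  define \<phi> where "\<phi> t = t / (1 + t^2) + arctan t" for t :: real
  have \<phi>: "\<bar>\<phi> t\<bar> \<le> pi / 2" for t
  proof -
    have "- (t / (1 + t^2)) - arctan t \<le> pi / 2" using arctan_plus_le[of "- t"] by (simp add: arctan_minus)
    thus ?thesis using arctan_plus_le[of t] unfolding \<phi>_def by linarith
  qed
  have "((\<lambda>v. 1 / (v^2 + y^2)^2) has_integral (\<phi> (b / y) / (2 * y^3) - \<phi> (a / y) / (2 * y^3))) {a..b}"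
  proof (rule fundamental_theorem_of_calculus[OF assms(2)])
    fix v assume "v \<in> {a..b}"
    define t where "t = v / y"
    have v: "v = t * y" using assms by (simp add: t_def)
    have "(\<phi> has_real_derivative ((1 * (1 + t^2) - t * (2 * t)) / (1 + t^2)^2 + 1 / (1 + t^2))) (at t)"
      unfolding \<phi>_def using nz[of t] by (auto intro!: derivative_eq_intros simp: inverse_eq_divide power2_eq_square)
    also have "(1 * (1 + t^2) - t * (2 * t)) / (1 + t^2)^2 + 1 / (1 + t^2) = 2 / (1 + t^2)^2"
    proof -
      have r: "1 / (1 + t^2) = (1 + t^2) / (1 + t^2)^2" using nz[of t] by (simp add: power2_eq_square)
      have e: "(1 * (1 + t^2) - t * (2 * t)) + (1 + t^2) = 2" by (simp add: power2_eq_square)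
      show ?thesis unfolding r add_divide_distrib[symmetric] e ..
    qed
    finally have "(\<phi> has_real_derivative 2 / (1 + t^2)^2) (at (v / y))" by (simp only: t_def)
    hence "((\<lambda>v. \<phi> (v / y)) has_real_derivative 2 / (1 + t^2)^2 * (1 / y)) (at v)"
      by (rule DERIV_chain2) (use assms in \<open>auto intro!: derivative_eq_intros\<close>)
    hence "((\<lambda>v. \<phi> (v / y) / (2 * y^3)) has_real_derivative 2 / (1 + t^2)^2 * (1 / y) / (2 * y^3)) (at v)"
      by (rule DERIV_cdivide)
    also have "2 / (1 + t^2)^2 * (1 / y) / (2 * y^3) = 1 / (v^2 + y^2)^2"
    proof -
      have "v^2 + y^2 = y^2 * (1 + t^2)" by (simp add: v power_mult_distrib algebra_simps)
      hence "(v^2 + y^2)^2 = (y^2)^2 * (1 + t^2)^2" by (simp only: power_mult_distrib)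
      also have "(y^2)^2 = y * y^3" by (simp add: eval_nat_numeral)
      finally have e: "(v^2 + y^2)^2 = y * y^3 * (1 + t^2)^2" .
      show ?thesis unfolding e by (simp add: mult_ac)
    qed
    finally show "((\<lambda>v. \<phi> (v / y) / (2 * y^3)) has_vector_derivative 1 / (v^2 + y^2)^2) (at v within {a..b})"
      by (metis has_real_derivative_iff_has_vector_derivative has_field_derivative_at_within)
  qed
  hence "integral {a..b} (\<lambda>v. 1 / (v^2 + y^2)^2) = (\<phi> (b / y) - \<phi> (a / y)) / (2 * y^3)"
    by (simp add: integral_unique diff_divide_distrib)
  also have "\<phi> (b / y) - \<phi> (a / y) \<le> pi" using \<phi>[of "b / y"] \<phi>[of "a / y"] by linarith
  finally show ?thesis using assms(1) by (simp add: divide_right_mono)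
qed

text \<open>Telescoping, by \<open>1 / c\<^sup>3 \<le> 1 / ((c - 1) c (c + 1))\<close>.\<close>

lemma sum_inverse_cubes: "(\<Sum>c=2..M. 1 / real c ^ 3) \<le> 1 / 4"
proof -
  have "(\<Sum>c=2..M. 1 / real c ^ 3) \<le> 1/4 - 1 / (2 * real M * (real M + 1))" if "M \<ge> 1" for M
    using that
  proof (induction M rule: dec_induct)
    case (step M)
    define x where "x = real M + 1"
    have x: "x > 1" using step by (simp add: x_def)
    have "1 / x^3 \<le> 1 / (x * (x^2 - 1))"
    proof (rule divide_left_mono)
      have "x * (x^2 - 1) \<le> x * x^2" using x by (intro mult_left_mono) auto
      thus "x * (x^2 - 1) \<le> x^3" by (simp add: eval_nat_numeral)
      have "x^2 > 1" using x by simp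
      thus "0 < x^3 * (x * (x^2 - 1))" using x by simp
    qed simp
    also have "\<dots> = 1 / (2 * (x - 1) * x) - 1 / (2 * x * (x + 1))"
    proof -
      have "x^2 - 1 = (x - 1) * (x + 1)" by (simp add: power2_eq_square algebra_simps)
      thus ?thesis using x by (simp add: divide_simps)
    qed
    finally have "1 / real (Suc M) ^ 3 \<le> 1 / (2 * real M * (real M + 1)) - 1 / (2 * real (Suc M) * (real (Suc M) + 1))"
      by (simp add: x_def add_ac)
    moreover have "{2..Suc M} = insert (Suc M) {2..M}" using step by auto
    ultimately show ?case using step by simp
  qed auto
  note tele = this
  have nn: "1 / (2 * real M * (real M + 1)) \<ge> 0" by simp
  show ?thesis
  proof (cases "M \<ge> 1")
    case True
    show ?thesis using tele[OF True] nn by linarith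
  qed simp
qed

lemma sum_inverse_powers:
  assumes "t \<ge> 3"
  shows "(\<Sum>c=2..M. 1 / real c ^ t) \<le> 2 / 2 ^ t"
proof -
  obtain j where j: "t = 3 + j" using assms le_Suc_ex by blast
  have "(\<Sum>c=2..M. 1 / real c ^ t) \<le> (\<Sum>c=2..M. 1 / 2 ^ j * (1 / real c ^ 3))"
  proof (rule sum_mono)
    fix c assume "c \<in> {2..M}"
    hence c: "real c \<ge> 2" by simp
    hence "(2::real) ^ j * real c ^ 3 \<le> real c ^ j * real c ^ 3" by (intro mult_right_mono power_mono) auto
    hence "1 / (real c ^ j * real c ^ 3) \<le> 1 / (2 ^ j * real c ^ 3)"
      using c by (intro divide_left_mono) auto
    thus "1 / real c ^ t \<le> 1 / 2 ^ j * (1 / real c ^ 3)" by (simp add: j power_add mult.commute)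
  qed
  also have "\<dots> \<le> 1 / 2 ^ j * (1 / 4)"
    unfolding sum_distrib_left[symmetric] by (intro mult_left_mono sum_inverse_cubes) auto
  also have "\<dots> = 2 / 2 ^ t" by (simp add: j power_add)
  finally show ?thesis .
qed

section \<open>The arcs away from the main cusp\<close>

text \<open>Reduces all exponents \<open>s \<ge> 4\<close> to the kernel with exponent \<open>4\<close>, whose integral over the line has the exact value \<open>\<pi> / (2 y\<^sup>3)\<close>.
The cruder kernel with exponent \<open>2\<close> would lose a factor \<open>2\<close>, which is too much for \<open>s = 4\<close>.\<close>

lemma norm_affine_power:
  fixes c d u y :: real
  assumes "even s" "s \<ge> 4" "c > 0" "y > 0"
  shows "1 / norm (of_real c * Complex u y + of_real d) ^ s \<le> 1 / (c ^ s * y ^ (s - 4)) * (1 / ((u + d / c)^2 + y^2)^2)"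
proof -
  obtain m where m: "s = 2 * m" using assms(1) by blast
  have m2: "m \<ge> 2" using m assms(2) by simp
  define X where "X = (u + d / c)^2 + y^2"
  have X: "X \<ge> y^2" "X > 0" using assms by (auto simp: X_def intro: add_nonneg_pos)
  have "of_real c * Complex u y + of_real d = Complex (c * (u + d / c)) (c * y)"
    using assms by (simp add: complex_eq_iff distrib_left)
  hence "(norm (of_real c * Complex u y + of_real d))^2 = (c * (u + d / c))^2 + (c * y)^2"
    by (simp only: cmod_power2 complex.sel)
  also have "\<dots> = c^2 * X" unfolding X_def power_mult_distrib distrib_left[of "c^2"] ..
  finally have "norm (of_real c * Complex u y + of_real d) ^ s = (c^2 * X) ^ m"
    by (simp only: m power_mult)
  also have "\<dots> = c ^ s * (X ^ 2 * X ^ (m - 2))"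
  proof -
    have "X ^ m = X ^ 2 * X ^ (m - 2)" using m2 by (metis le_add_diff_inverse power_add)
    thus ?thesis by (simp only: m power_mult_distrib power_mult)
  qed
  finally have eq: "norm (of_real c * Complex u y + of_real d) ^ s = c ^ s * (X ^ 2 * X ^ (m - 2))" .
  have "y ^ (s - 4) = (y^2) ^ (m - 2)" by (simp add: m power_mult[symmetric] right_diff_distrib')
  also have "\<dots> \<le> X ^ (m - 2)" using X by (intro power_mono) auto
  finally have "c ^ s * (X^2 * y ^ (s - 4)) \<le> c ^ s * (X ^ 2 * X ^ (m - 2))"
    using assms X by (intro mult_left_mono) auto
  hence "1 / (c ^ s * (X ^ 2 * X ^ (m - 2))) \<le> 1 / (c ^ s * (X^2 * y ^ (s - 4)))"
    using assms X by (intro divide_left_mono mult_pos_pos zero_less_power) auto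
  thus ?thesis unfolding eq X_def[symmetric] by (simp add: mult_ac)
qed

lemma norm_power_kernel:
  fixes u y :: real
  assumes "s \<ge> 4" "y > 0"
  shows "1 / norm (Complex u y) ^ (s - 1) \<le> 1 / y ^ (s - 3) * (1 / (u^2 + y^2))"
proof -
  have "s - 1 = 2 + (s - 3)" using assms(1) by simp
  hence "norm (Complex u y) ^ (s - 1) = norm (Complex u y) ^ (2 + (s - 3))" by (rule arg_cong)
  also have "\<dots> = (u^2 + y^2) * norm (Complex u y) ^ (s - 3)" by (simp only: power_add cmod_power2 complex.sel)
  finally have eq: "norm (Complex u y) ^ (s - 1) = (u^2 + y^2) * norm (Complex u y) ^ (s - 3)" .
  have X: "u^2 + y^2 > 0" using assms by (intro add_nonneg_pos) auto
  have "y \<le> norm (Complex u y)" using abs_Im_le_cmod[of "Complex u y"] by simp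
  hence "y ^ (s - 3) \<le> norm (Complex u y) ^ (s - 3)" using assms by (intro power_mono) auto
  hence "(u^2 + y^2) * y ^ (s - 3) \<le> (u^2 + y^2) * norm (Complex u y) ^ (s - 3)"
    using X by (intro mult_left_mono) auto
  hence "1 / ((u^2 + y^2) * norm (Complex u y) ^ (s - 3)) \<le> 1 / ((u^2 + y^2) * y ^ (s - 3))"
    using assms X by (intro divide_left_mono mult_pos_pos zero_less_power) (auto intro: less_le_trans[OF _ \<open>y \<le> norm (Complex u y)\<close>])
  thus ?thesis unfolding eq by (simp add: mult.commute)
qed

text \<open>Two arcs that differ by a period fit together to an interval, so that together they cost no more than one integral over the line.\<close>

lemma integral_shift_pair:
  fixes g :: "real \<Rightarrow> real"
  assumes "continuous_on UNIV g"
  shows "integral {-1/2..1/2} (\<lambda>u. g (u + e) + g (u + e - 1)) = integral {e - 3/2..e + 1/2} g"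
proof -
  have cont: "continuous_on A g" for A using assms continuous_on_subset by blast
  have i: "(\<lambda>u. g (u + a)) integrable_on {-1/2..1/2}" for a
    by (intro integrable_continuous_real continuous_on_compose2[OF assms] continuous_intros) auto
  have sh: "integral {-1/2..1/2} (\<lambda>u. g (u + a)) = integral {a - 1/2..a + 1/2} g" for a
    using integral_shift[of "-1/2" a "1/2" g] cont by (simp add: o_def add.commute)
  have "integral {-1/2..1/2} (\<lambda>u. g (u + e) + g (u + (e - 1))) = integral {e - 1/2..e + 1/2} g + integral {e - 1 - 1/2..e - 1 + 1/2} g"
    by (subst integral_add[OF i i]) (simp only: sh)
  also have "\<dots> = integral {e - 3/2..e - 1/2} g + integral {e - 1/2..e + 1/2} g"
    by (simp add: add.commute)
  also have "\<dots> = integral {e - 3/2..e + 1/2} g"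
    by (rule Henstock_Kurzweil_Integration.integral_combine) (auto intro: integrable_continuous_real cont)
  finally show ?thesis by (simp add: add_diff_eq)
qed

text \<open>The relevant cusp is not known for a given \<open>u\<close>, but it is one of finitely many, so the sum over all of
them is a bound. For a fixed \<open>c\<close> the numerators \<open>d\<close> and \<open>d - c\<close> are paired, which leaves \<open>c\<close> integrals over the line, each at most
\<open>\<pi> / (c\<^sup>s y\<^sup>s\<^sup>-\<^sup>1)\<close>.\<close>

lemma farey_integral_bound:
  fixes P :: "real \<Rightarrow> complex" and y B0 B1 T :: real
  assumes s: "even s" "s \<ge> 4" and y: "0 < y" and B: "B0 \<ge> 0" "B1 \<ge> 0"
    and cont: "continuous_on {-1/2..1/2} P"
    and bound: "\<And>u. u \<in> {-1/2..1/2} \<Longrightarrow> norm (P u) \<le> B0 + B1 / norm (Complex u y) ^ (s - 1) \<or>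
       (\<exists>c d :: int. 2 \<le> c \<and> of_int c \<le> T \<and> - c \<le> d \<and> d < c \<and>
          norm (P u) \<le> B0 + B1 / norm (Complex u y) ^ (s - 1) + 2 / norm (of_int c * Complex u y + of_int d) ^ s)"
  shows "integral {-1/2..1/2} (\<lambda>u. norm (P u)) \<le> B0 + B1 * pi / y ^ (s - 2) + pi * (2 / 2 ^ (s - 1)) / y ^ (s - 1)"
proof -
  define M where "M = nat \<lfloor>T\<rfloor>"
  define g where "g v = 1 / (v^2 + y^2)^2" for v
  define g1 where "g1 v = 1 / (v^2 + y^2)" for v
  define w where "w c = 2 / (real c ^ s * y ^ (s - 4))" for c
  define h where "h c d u = w c * (g (u + real d / real c) + g (u + real d / real c - 1))" for c d u
  have X: "v^2 + y^2 > 0" for v using y by (intro add_nonneg_pos) auto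
  have X0: "v^2 + y^2 \<noteq> 0" for v using X[of v] by linarith
  have contg: "continuous_on A g" "continuous_on A g1" for A
    unfolding g_def g1_def by (intro continuous_intros; use X0 in simp)+
  have g0: "g v \<ge> 0" "g1 v \<ge> 0" for v using X[of v] by (auto simp: g_def g1_def)
  have w0: "w c \<ge> 0" for c using y by (simp add: w_def)
  have h0: "h c d u \<ge> 0" for c d u unfolding h_def by (intro mult_nonneg_nonneg add_nonneg_nonneg w0 g0)
  have conth: "continuous_on {-1/2..1/2} (h c d)" for c d
    unfolding h_def by (intro continuous_intros continuous_on_compose2[OF contg(1)[of UNIV]]) auto
  define D where "D u = B0 + B1 / y ^ (s - 3) * g1 u + (\<Sum>c=2..M. \<Sum>d<c. h c d u)" for u
  have le1: "B1 / norm (Complex u y) ^ (s - 1) \<le> B1 / y ^ (s - 3) * g1 u" for u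
    using mult_left_mono[OF norm_power_kernel[OF s(2) y, of u] B(2)] by (simp add: g1_def)
  have "norm (P u) \<le> D u" if u: "u \<in> {-1/2..1/2}" for u
    using bound[OF u]
  proof
    assume "norm (P u) \<le> B0 + B1 / norm (Complex u y) ^ (s - 1)"
    moreover have "(\<Sum>c=2..M. \<Sum>d<c. h c d u) \<ge> 0" by (intro sum_nonneg h0)
    ultimately show ?thesis using le1[of u] unfolding D_def by linarith
  next
    assume "\<exists>c d :: int. 2 \<le> c \<and> of_int c \<le> T \<and> - c \<le> d \<and> d < c \<and>
          norm (P u) \<le> B0 + B1 / norm (Complex u y) ^ (s - 1) + 2 / norm (of_int c * Complex u y + of_int d) ^ s"
    then obtain c d :: int where cd: "2 \<le> c" "of_int c \<le> T" "- c \<le> d" "d < c"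
      and P: "norm (P u) \<le> B0 + B1 / norm (Complex u y) ^ (s - 1) + 2 / norm (of_int c * Complex u y + of_int d) ^ s"
      by blast
    define c' where "c' = nat c"
    (* The representative of d modulo c; the second summand of h is the arc for d' - c. *)
    define d' where "d' = nat (if d \<ge> 0 then d else d + c)"
    have c': "c = int c'" "real_of_int c = real c'" "real c' > 0" using cd by (simp_all add: c'_def)
    have cM: "c' \<in> {2..M}"
    proof -
      have "c \<le> \<lfloor>T\<rfloor>" using cd(2) by (simp add: le_floor_iff)
      thus ?thesis using cd(1) by (auto simp: c'_def M_def)
    qed
    have dc: "d' < c'" using cd by (auto simp: d'_def c'_def)
    have "2 / norm (of_int c * Complex u y + of_int d) ^ s \<le> w c' * g (u + of_int d / real c')"
    proof -
      have "1 / norm (of_real (real c') * Complex u y + of_real (of_int d)) ^ s \<le> 1 / (real c' ^ s * y ^ (s - 4)) * (1 / ((u + of_int d / real c')^2 + y^2)^2)"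
        by (rule norm_affine_power) (use s c' y in auto)
      hence "2 * (1 / norm (of_real (real c') * Complex u y + of_real (of_int d)) ^ s) \<le> 2 * (1 / (real c' ^ s * y ^ (s - 4)) * (1 / ((u + of_int d / real c')^2 + y^2)^2))"
        by (rule mult_left_mono) simp
      moreover have "complex_of_real (real c') = of_int c" "complex_of_real (of_int d) = of_int d" by (simp_all add: c'(1))
      ultimately show ?thesis by (simp add: w_def g_def)
    qed
    also have "\<dots> \<le> h c' d' u"
    proof (cases "d \<ge> 0")
      case True
      hence "real d' = of_int d" by (simp add: d'_def)
      thus ?thesis unfolding h_def using g0 w0 by (intro mult_left_mono) auto
    next
      case False
      hence "real d' = of_int d + real c'" using cd by (simp add: d'_def c'_def)
      hence "real d' / real c' = of_int d / real c' + 1" using c' by (simp add: add_divide_distrib)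
      thus ?thesis unfolding h_def using g0 w0 by (intro mult_left_mono) auto
    qed
    also have "\<dots> \<le> (\<Sum>d<c'. h c' d u)" using dc h0 by (intro member_le_sum) auto
    also have "\<dots> \<le> (\<Sum>c=2..M. \<Sum>d<c. h c d u)" using cM h0 by (intro member_le_sum[where f = "\<lambda>c. \<Sum>d<c. h c d u"] sum_nonneg) auto
    finally show ?thesis using P le1[of u] unfolding D_def by linarith
  qed
  moreover have contD: "continuous_on {-1/2..1/2} D"
    unfolding D_def by (intro continuous_intros contg conth)
  ultimately have "integral {-1/2..1/2} (\<lambda>u. norm (P u)) \<le> integral {-1/2..1/2} D"
    by (intro integral_le integrable_continuous_real continuous_on_norm cont) auto
  also have "integral {-1/2..1/2} D = integral {-1/2..1/2} (\<lambda>u. B0 + B1 / y ^ (s - 3) * g1 u) + integral {-1/2..1/2} (\<lambda>u. \<Sum>c=2..M. \<Sum>d<c. h c d u)"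
    unfolding D_def by (intro integral_add integrable_continuous_real continuous_intros contg conth)
  also have "integral {-1/2..1/2} (\<lambda>u. B0 + B1 / y ^ (s - 3) * g1 u) = integral {-1/2..1/2} (\<lambda>u::real. B0) + integral {-1/2..1/2} (\<lambda>u. B1 / y ^ (s - 3) * g1 u)"
    by (rule integral_add; intro integrable_continuous_real continuous_intros contg)
  also have "integral {-1/2..1/2} (\<lambda>u::real. B0) = B0" by simp
  also have "integral {-1/2..1/2} (\<lambda>u. B1 / y ^ (s - 3) * g1 u) = B1 / y ^ (s - 3) * integral {-1/2..1/2} g1"
    by (rule integral_mult_right)
  also have "integral {-1/2..1/2} (\<lambda>u. \<Sum>c=2..M. \<Sum>d<c. h c d u) = (\<Sum>c=2..M. integral {-1/2..1/2} (\<lambda>u. \<Sum>d<c. h c d u))"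
    by (intro integral_sum integrable_continuous_real continuous_intros conth) auto
  also have "\<dots> = (\<Sum>c=2..M. \<Sum>d<c. integral {-1/2..1/2} (h c d))"
    by (intro sum.cong refl integral_sum integrable_continuous_real continuous_intros conth) auto
  also have "(\<Sum>c=2..M. \<Sum>d<c. integral {-1/2..1/2} (h c d)) \<le> (\<Sum>c=2..M. pi / y ^ (s - 1) * (1 / real c ^ (s - 1)))"
  proof (rule sum_mono)
    fix c assume "c \<in> {2..M}"
    hence c: "c > 0" by simp
    have "(\<Sum>d<c. integral {-1/2..1/2} (h c d)) \<le> (\<Sum>d<c. w c * (pi / (2 * y^3)))"
    proof (rule sum_mono)
      fix d
      have "integral {-1/2..1/2} (h c d) = w c * integral {real d / real c - 3/2..real d / real c + 1/2} g"
        unfolding h_def by (subst integral_mult_right) (subst integral_shift_pair[OF contg(1)], simp)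
      also have "\<dots> \<le> w c * (pi / (2 * y^3))"
        unfolding g_def by (intro mult_left_mono integral_cauchy_kernel_squared w0 y) simp
      finally show "integral {-1/2..1/2} (h c d) \<le> w c * (pi / (2 * y^3))" .
    qed
    also have "\<dots> = pi * (real c / real c ^ s) * (1 / (y ^ (s - 4) * y ^ 3))"
      by (simp add: w_def)
    also have "y ^ (s - 4) * y ^ 3 = y ^ (s - 1)"
    proof -
      have "s - 4 + 3 = s - 1" using s(2) by simp
      thus ?thesis by (simp only: power_add[symmetric])
    qed
    also have "real c / real c ^ s = 1 / real c ^ (s - 1)"
    proof -
      have "s = Suc (s - 1)" using s(2) by simp
      hence "real c ^ s = real c * real c ^ (s - 1)" by (metis power_Suc)
      thus ?thesis using c by simp
    qed
    finally show "(\<Sum>d<c. integral {-1/2..1/2} (h c d)) \<le> pi / y ^ (s - 1) * (1 / real c ^ (s - 1))" by (simp add: mult_ac)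
  qed
  also have "\<dots> = pi / y ^ (s - 1) * (\<Sum>c=2..M. 1 / real c ^ (s - 1))" by (simp only: sum_distrib_left)
  also have "\<dots> \<le> pi / y ^ (s - 1) * (2 / 2 ^ (s - 1))"
    using y s(2) by (intro mult_left_mono sum_inverse_powers) auto
  also have "B1 / y ^ (s - 3) * integral {-1/2..1/2} g1 \<le> B1 / y ^ (s - 3) * (pi / y)"
    unfolding g1_def using y B by (intro mult_left_mono integral_cauchy_kernel) auto
  also have "B1 / y ^ (s - 3) * (pi / y) = B1 * pi / y ^ (s - 2)"
  proof -
    have "s - 2 = Suc (s - 3)" using s(2) by simp
    hence "y ^ (s - 2) = y ^ (s - 3) * y" by (simp only: power_Suc2)
    thus ?thesis by simp
  qed
  finally show ?thesis by (simp add: mult_ac)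
qed

section \<open>Coefficient extraction\<close>

text \<open>Orthogonality of characters on a period, applied to a possibly non-injective indexing of the series; for theta series the index is the
lattice vector.\<close>

lemma coefficient_integral:
  fixes a :: "'i \<Rightarrow> complex" and m :: "'i \<Rightarrow> int" and y :: real
  assumes sum: "(\<lambda>i. norm (a i) * exp (- 2 * pi * y * of_int (m i))) summable_on I"
  defines "f \<equiv> (\<lambda>u. \<Sum>\<^sub>\<infinity>i\<in>I. a i * e2pi (of_int (m i) * Complex u y))"
  shows "continuous_on {-1/2..1/2} f"
    and "((\<lambda>i. if m i = k then a i else 0) has_sum integral {-1/2..1/2} (\<lambda>u. f u * e2pi (- of_int k * Complex u y))) I"
proof -
  define F where "F i u = a i * e2pi (of_int (m i) * Complex u y)" for i u
  define M where "M i = norm (a i) * exp (- 2 * pi * y * of_int (m i))" for i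
  have Mx: "norm (F i u) \<le> M i" for i u
    by (simp add: F_def M_def norm_mult norm_e2pi mult_ac)
  have sumM: "M summable_on I" using sum unfolding M_def .
  have line: "Complex u y = of_real u + \<i> * of_real y" for u by (simp add: complex_eq_iff)
  have contF: "continuous_on A (F i)" for A i
    unfolding F_def line by (intro continuous_intros)
  show "continuous_on {-1/2..1/2} f"
    unfolding f_def using integral_infsum(2)[of I "-1/2" "1/2" F M, OF Mx sumM contF] unfolding F_def .
  define E where "E u = e2pi (- of_int k * Complex u y)" for u
  have contE: "continuous_on A E" for A unfolding E_def line by (intro continuous_intros)
  have eq: "f u * E u = (\<Sum>\<^sub>\<infinity>i\<in>I. F i u * E u)" for u
    unfolding f_def F_def by (rule infsum_cmult_left'[symmetric])
  have "((\<lambda>i. integral {-1/2..1/2} (\<lambda>u. F i u * E u)) has_sum integral {-1/2..1/2} (\<lambda>u. \<Sum>\<^sub>\<infinity>i\<in>I. F i u * E u)) I"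
  proof (rule integral_infsum(1))
    show "norm (F i u * E u) \<le> M i * exp (2 * pi * y * of_int k)" for i u
    proof -
      have "norm (E u) = exp (2 * pi * y * of_int k)" by (simp add: E_def norm_e2pi mult_ac)
      thus ?thesis unfolding norm_mult using Mx[of i u] by (simp add: mult_right_mono)
    qed
    show "(\<lambda>i. M i * exp (2 * pi * y * of_int k)) summable_on I" by (rule summable_on_cmult_left[OF sumM])
    show "continuous_on {-1/2..1/2} (\<lambda>u. F i u * E u)" for i by (intro continuous_intros contF contE)
  qed
  moreover have "integral {-1/2..1/2} (\<lambda>u. F i u * E u) = (if m i = k then a i else 0)" for i
  proof -
    have e: "F i u * E u = a i * e2pi (of_int (m i - k) * (\<i> * of_real y)) * e2pi (of_real (of_int (m i - k) * u))" for u
    proof -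
      have "of_int (m i) * Complex u y + (- of_int k * Complex u y) = of_int (m i - k) * (\<i> * of_real y) + of_real (of_int (m i - k) * u)"
        unfolding line by (simp add: algebra_simps)
      hence "e2pi (of_int (m i) * Complex u y) * E u = e2pi (of_int (m i - k) * (\<i> * of_real y)) * e2pi (of_real (of_int (m i - k) * u))"
        unfolding E_def by (simp only: e2pi_add[symmetric])
      thus ?thesis unfolding F_def by (simp only: mult.assoc)
    qed
    have "integral {-1/2..1/2} (\<lambda>u. F i u * E u) = a i * e2pi (of_int (m i - k) * (\<i> * of_real y)) * (if m i - k = 0 then 1 else 0)"
      unfolding e using integral_e2pi_period[of "-1/2" "m i - k"] by (subst integral_mult_right) simp
    thus ?thesis by simp
  qed
  ultimately show "((\<lambda>i. if m i = k then a i else 0) has_sum integral {-1/2..1/2} (\<lambda>u. f u * e2pi (- of_int k * Complex u y))) I"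
    unfolding E_def[symmetric] eq by simp
qed

lemma binomial_ge_power: "real j ^ t / fact t \<le> real ((j + t) choose t)"
proof -
  have "real j ^ t \<le> fact t * real ((j + t) choose t)"
  proof (induction t)
    case (Suc t)
    have "Suc t * ((j + Suc t) choose Suc t) = (j + Suc t) * ((j + t) choose t)"
      using Suc_times_binomial[of t "j + t"] by simp
    hence e: "real (Suc t) * real ((j + Suc t) choose Suc t) = (real j + real (Suc t)) * real ((j + t) choose t)"
      by (metis of_nat_add of_nat_mult)
    have "real j ^ Suc t \<le> (real j + real (Suc t)) * (fact t * real ((j + t) choose t))"
      unfolding power_Suc using Suc by (intro mult_mono) auto
    also have "\<dots> = fact t * ((real j + real (Suc t)) * real ((j + t) choose t))" by (simp only: mult_ac)
    also have "\<dots> = fact t * (real (Suc t) * real ((j + Suc t) choose Suc t))" by (simp only: e)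
    also have "\<dots> = fact (Suc t) * real ((j + Suc t) choose Suc t)" by (simp only: fact_Suc of_nat_mult mult_ac)
    finally show ?case .
  qed simp
  thus ?thesis by (simp add: divide_le_eq mult.commute)
qed

lemma negative_binomial_sums:
  fixes z :: complex
  assumes "norm z < 1"
  shows "(\<lambda>j. of_nat ((j + t) choose t) * z ^ j) sums (1 / (1 - z) ^ Suc t)"
proof -
  have "(\<lambda>j. (- of_nat (Suc t) gchoose j) * (- z) ^ j) sums (1 + (- z)) powr (- of_nat (Suc t))"
    by (rule gen_binomial_complex) (use assms in simp)
  moreover have "(- of_nat (Suc t) gchoose j) * (- z) ^ j = of_nat ((j + t) choose t) * z ^ j" for j
  proof -
    have "(- of_nat (Suc t) gchoose j) = (- 1) ^ j * (of_nat (Suc t) + of_nat j - 1 gchoose j :: complex)"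
      by (rule gbinomial_minus)
    also have "of_nat (Suc t) + of_nat j - 1 = (of_nat (j + t) :: complex)" by simp
    also have "(of_nat (j + t) gchoose j :: complex) = of_nat ((j + t) choose j)" by (simp only: binomial_gbinomial)
    also have "(j + t) choose j = (j + t) choose t" using binomial_symmetric[of j "j + t"] by simp
    finally have "(- of_nat (Suc t) gchoose j) * (- z) ^ j = of_nat ((j + t) choose t) * ((- 1) ^ j * (- z) ^ j)" by (simp only: mult_ac)
    also have "(- 1) ^ j * (- z) ^ j = z ^ j" by (simp flip: power_mult_distrib)
    finally show ?thesis .
  qed
  moreover have "(1 + (- z)) powr (- of_nat (Suc t)) = 1 / (1 - z) ^ Suc t"
  proof -
    have nz: "1 - z \<noteq> 0" using assms by auto
    have "(1 - z) powr (- of_nat (Suc t)) = inverse ((1 - z) powr of_nat (Suc t))" by (rule powr_minus)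
    also have "(1 - z) powr of_nat (Suc t) = (1 - z) ^ Suc t" by (rule powr_nat') (use nz in simp)
    finally show ?thesis by (simp add: inverse_eq_divide)
  qed
  ultimately show ?thesis by simp
qed

lemma negative_binomial_has_sum:
  fixes z :: complex
  assumes z: "norm z < 1"
  shows "(\<lambda>j. norm (of_nat ((j + t) choose t) * z ^ j)) summable_on UNIV"
    and "((\<lambda>j. of_nat ((j + t) choose t) * z ^ j) has_sum (1 / (1 - z) ^ Suc t)) UNIV"
proof -
  define r where "r = (1 + norm z) / 2"
  have r: "norm z < r" "r < 1" "r \<ge> 0" using z by (auto simp: r_def)
  have "summable (\<lambda>j. of_nat ((j + t) choose t) * (of_real r :: complex) ^ j)"
    using negative_binomial_sums[of "of_real r" t] r by (auto simp: sums_iff)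
  hence s: "summable (\<lambda>j. norm (of_nat ((j + t) choose t) * z ^ j))"
    by (rule powser_insidea) (use r in simp)
  show "(\<lambda>j. norm (of_nat ((j + t) choose t) * z ^ j)) summable_on UNIV"
    using s by (intro norm_summable_imp_summable_on) simp
  show "((\<lambda>j. of_nat ((j + t) choose t) * z ^ j) has_sum (1 / (1 - z) ^ Suc t)) UNIV"
    by (rule norm_summable_imp_has_sum[OF s negative_binomial_sums[OF z]])
qed

text \<open>With \<open>t = s - 1\<close> this is the inequality that makes the cusp \<open>0\<close> outweigh all cusps with \<open>c \<ge> 2\<close> together. The
induction step uses \<open>(1 + 1 / t)\<^sup>t \<ge> 2\<close>, and \<open>e \<le> 3\<close>.\<close>

lemma fact_exp_bound:
  assumes "t \<ge> 3"
  shows "fact t * exp (real t) < 2 ^ t * real t ^ t"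
  using assms
proof (induction t rule: dec_induct)
  case base
  have "exp (real 3) = exp 1 ^ 3" by (simp flip: exp_of_nat_mult)
  also have "\<dots> \<le> 3 ^ 3" using exp_le by (intro power_mono) auto
  finally show ?case by (simp add: fact_numeral)
next
  case (step t)
  have t: "real t > 0" using step by simp
  have b: "2 * real t ^ t \<le> real (Suc t) ^ t"
  proof -
    have "1 + real t * (1 / real t) \<le> (1 + 1 / real t) ^ t"
      by (rule Bernoulli_inequality) (use t in \<open>auto intro: order_trans[of _ 0]\<close>)
    hence "2 \<le> (1 + 1 / real t) ^ t" using t by simp
    hence "2 * real t ^ t \<le> (1 + 1 / real t) ^ t * real t ^ t" by (intro mult_right_mono) auto
    also have "\<dots> = ((1 + 1 / real t) * real t) ^ t" by (simp only: power_mult_distrib)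
    also have "(1 + 1 / real t) * real t = real (Suc t)" using t by (simp add: distrib_right)
    finally show ?thesis .
  qed
  have "fact (Suc t) * exp (real (Suc t)) = real (Suc t) * exp 1 * (fact t * exp (real t))"
    by (simp add: exp_add algebra_simps)
  also have "\<dots> < real (Suc t) * exp 1 * (2 ^ t * real t ^ t)"
    using step.IH by (intro mult_strict_left_mono mult_pos_pos) auto
  also have "\<dots> \<le> real (Suc t) * 3 * (2 ^ t * real t ^ t)"
    using exp_le by (intro mult_right_mono mult_left_mono) auto
  also have "\<dots> \<le> real (Suc t) * 4 * (2 ^ t * real t ^ t)"
    by (intro mult_right_mono mult_left_mono) auto
  also have "\<dots> = 2 ^ Suc t * real (Suc t) * (2 * real t ^ t)" by simp
  also have "\<dots> \<le> 2 ^ Suc t * real (Suc t) * real (Suc t) ^ t"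
    using b by (intro mult_left_mono) auto
  finally show ?case by (simp add: mult.assoc)
qed

context even_unimodular_gram
begin

text \<open>The coefficient at \<open>k\<close> is the sum of \<open>1 - e2pi (B w x)\<close> over the vectors \<open>x\<close> of norm \<open>2 * k\<close>.\<close>

lemma theta_diff_series:
  assumes y: "y > 0" and w: "\<And>x. x \<in> Zn n \<Longrightarrow> q x = 2 * of_int k \<Longrightarrow> B w x \<in> \<int>"
  shows "continuous_on {-1/2..1/2} (\<lambda>u. theta_diff w (Complex u y))"
    and "integral {-1/2..1/2} (\<lambda>u. theta_diff w (Complex u y) * e2pi (- of_int k * Complex u y)) = 0"
proof -
  define m where "m x = \<lfloor>q x / 2\<rfloor>" for x
  define a where "a x = 1 - e2pi (of_real (B w x))" for x
  have m: "of_int (m x) = q x / 2" if "x \<in> Zn n" for x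
    using even[OF that] by (auto simp: m_def elim: Ints_cases)
  have sumq: "(\<lambda>x. exp (- (pi * y) * q x)) summable_on Zn n"
    using summable_coercive[OF coercive_q, of "pi * y" "\<lambda>_. 0"] y by simp
  have "theta_diff w (Complex u y) = (\<Sum>\<^sub>\<infinity>x\<in>Zn n. a x * e2pi (of_int (m x) * Complex u y))" for u
  proof -
    define \<tau> where "\<tau> = Complex u y"
    have \<tau>: "Im \<tau> > 0" using y by (simp add: \<tau>_def)
    define t where "t b x = e2pi (\<tau> * of_real (q (\<lambda>i. x i + of_int 0 * w i) / 2) + of_real (of_int b * B w x + of_int (0 * b) * q w / 2))" for b :: int and x
    have s: "t b summable_on Zn n" for b
      unfolding t_def by (rule abs_summable_summable[OF theta_summable[OF \<tau>]])
    have "theta_diff w \<tau> = infsum (t 0) (Zn n) + - infsum (t 1) (Zn n)"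
      unfolding theta_diff_def theta_def t_def by simp
    also have "\<dots> = infsum (\<lambda>x. t 0 x + - t 1 x) (Zn n)"
      unfolding infsum_uminus[symmetric] by (rule infsum_add[symmetric]) (simp_all only: s summable_on_uminus)
    also have "\<dots> = (\<Sum>\<^sub>\<infinity>x\<in>Zn n. a x * e2pi (of_int (m x) * \<tau>))"
    proof (rule infsum_cong)
      fix x assume "x \<in> Zn n"
      have X: "complex_of_real (q x / 2) = of_int (m x)" using m[OF \<open>x \<in> Zn n\<close>] by (metis of_real_of_int_eq)
      have t0: "t b x = e2pi (of_int (m x) * \<tau>) * e2pi (of_real (of_int b * B w x))" for b
      proof -
        have "q (\<lambda>i. x i + of_int 0 * w i) = q x" "of_int b * B w x + of_int (0 * b) * q w / 2 = of_int b * B w x" by simp_all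
        thus ?thesis unfolding t_def by (simp only: X e2pi_add mult.commute)
      qed
      show "t 0 x + - t 1 x = a x * e2pi (of_int (m x) * \<tau>)"
        unfolding t0 a_def by (simp add: algebra_simps)
    qed
    finally show ?thesis unfolding \<tau>_def .
  qed
  note eq = this
  have sum: "(\<lambda>x. norm (a x) * exp (- 2 * pi * y * of_int (m x))) summable_on Zn n"
  proof (rule summable_on_comparison_test[OF summable_on_cmult_right[OF sumq, of 2]])
    fix x assume x: "x \<in> Zn n"
    have "norm (a x) \<le> 2" using norm_triangle_ineq4[of 1 "e2pi (of_real (B w x))"] by (simp add: a_def)
    moreover have "- 2 * pi * y * of_int (m x) = - (pi * y) * q x" using m[OF x] by simp
    ultimately show "norm (a x) * exp (- 2 * pi * y * of_int (m x)) \<le> 2 * exp (- (pi * y) * q x)"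
      by (simp only:) (intro mult_right_mono, auto)
  qed auto
  show "continuous_on {-1/2..1/2} (\<lambda>u. theta_diff w (Complex u y))"
    unfolding eq by (rule coefficient_integral(1)[OF sum])
  have "((\<lambda>x. if m x = k then a x else 0) has_sum
     integral {-1/2..1/2} (\<lambda>u. theta_diff w (Complex u y) * e2pi (- of_int k * Complex u y))) (Zn n)"
    unfolding eq by (rule coefficient_integral(2)[OF sum])
  moreover have "(if m x = k then a x else 0) = 0" if "x \<in> Zn n" for x
    using m[OF that] w[OF that] by (auto simp: a_def e2pi_Ints)
  ultimately have "((\<lambda>_. 0) has_sum
     integral {-1/2..1/2} (\<lambda>u. theta_diff w (Complex u y) * e2pi (- of_int k * Complex u y))) (Zn n)"
    by (simp cong: has_sum_cong)
  thus "integral {-1/2..1/2} (\<lambda>u. theta_diff w (Complex u y) * e2pi (- of_int k * Complex u y)) = 0"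
    by (rule has_sum_unique) (rule has_sum_0, rule refl)
qed

end

lemma polar_series:
  assumes y: "y > 0" and s: "s = Suc t"
  shows "continuous_on {-1/2..1/2} (\<lambda>u. 1 / (1 - e2pi (Complex u y)) ^ s)"
    and "integral {-1/2..1/2} (\<lambda>u. 1 / (1 - e2pi (Complex u y)) ^ s * e2pi (- of_int (int k) * Complex u y)) = of_nat ((k + t) choose t)"
proof -
  have pw: "e2pi (of_int (int j) * z) = e2pi z ^ j" for j z
    unfolding e2pi_def by (simp add: exp_of_nat_mult[symmetric] mult_ac)
  have nz: "norm (e2pi (Complex u y)) < 1" for u using y by (simp add: norm_e2pi)
  have eq: "1 / (1 - e2pi (Complex u y)) ^ s = (\<Sum>\<^sub>\<infinity>j. of_nat ((j + t) choose t) * e2pi (of_int (int j) * Complex u y))" for u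
    unfolding pw s using infsumI[OF negative_binomial_has_sum(2)[OF nz[of u]]] by simp
  have sum: "(\<lambda>j. norm (of_nat ((j + t) choose t) :: complex) * exp (- 2 * pi * y * of_int (int j))) summable_on UNIV"
  proof -
    have "norm (of_nat ((j + t) choose t) :: complex) * exp (- 2 * pi * y * of_int (int j)) = norm (of_nat ((j + t) choose t) * e2pi (Complex 0 y) ^ j)" for j
      unfolding pw[symmetric] norm_mult norm_e2pi by (simp add: mult_ac)
    thus ?thesis using negative_binomial_has_sum(1)[OF nz[of 0], of t] by simp
  qed
  show "continuous_on {-1/2..1/2} (\<lambda>u. 1 / (1 - e2pi (Complex u y)) ^ s)"
    unfolding eq by (rule coefficient_integral(1)[OF sum])
  have "((\<lambda>j. if int j = int k then of_nat ((j + t) choose t) else 0) has_sum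
    integral {-1/2..1/2} (\<lambda>u. 1 / (1 - e2pi (Complex u y)) ^ s * e2pi (- of_int (int k) * Complex u y))) UNIV"
    unfolding eq by (rule coefficient_integral(2)[OF sum])
  moreover have "((\<lambda>j. if int j = int k then of_nat ((j + t) choose t) else 0) has_sum (of_nat ((k + t) choose t) :: complex)) UNIV"
    using has_sum_finite_neutralI[of "{k}" UNIV "\<lambda>j. if int j = int k then of_nat ((j + t) choose t) else (0::complex)"] by simp
  ultimately show "integral {-1/2..1/2} (\<lambda>u. 1 / (1 - e2pi (Complex u y)) ^ s * e2pi (- of_int (int k) * Complex u y)) = of_nat ((k + t) choose t)"
    using has_sum_unique by blast
qed

section \<open>All large norms\<close>

context even_unimodular_gram
begin

text \<open>The circle method. If all vectors of norm \<open>2 * k\<close> had integral product with \<open>w\<close>, then the \<open>k\<close>-th coefficient of the difference of the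
theta series minus the comparison function would be a negative binomial coefficient of size \<open>k\<^sup>t\<close>, which exceeds what
\<open>farey_integral_bound\<close> allows for small \<open>y\<close>.\<close>

theorem all_large_norms_avoid_kernel:
  assumes N: "N > 0" "\<And>i. i < n \<Longrightarrow> real N * w i \<in> \<int>" and w: "\<exists>i<n. w i \<notin> \<int>"
  shows "\<exists>k0. \<forall>k\<ge>k0. \<exists>x\<in>Zn n. q x = 2 * real k \<and> B w x \<notin> \<int>"
proof (rule theta_diff_approx[OF N w])
  fix C0 assume C0: "C0 \<ge> 0" and approx: "\<And>\<tau>. \<bar>Re \<tau>\<bar> \<le> 1/2 \<Longrightarrow> 0 < Im \<tau> \<Longrightarrow> Im \<tau> \<le> 1/20 \<Longrightarrow>
       norm (theta_diff w \<tau> - 1 / \<tau> ^ s) \<le> C0 / sqrt (Im \<tau>) ^ s \<or>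
       (\<exists>c d :: int. 2 \<le> c \<and> of_int c \<le> 2 / sqrt (Im \<tau>) \<and> - c \<le> d \<and> d < c \<and>
          norm (theta_diff w \<tau> - 1 / \<tau> ^ s) \<le> C0 / sqrt (Im \<tau>) ^ s + 2 / norm (of_int c * \<tau> + of_int d) ^ s)"
  have s0: "s > 0" using s(3) by simp
  show ?thesis
  proof (rule polar_approx[OF s(2) s0])
    fix C1 assume C1: "C1 \<ge> 0" and polar: "\<And>\<tau>. \<bar>Re \<tau>\<bar> \<le> 1/2 \<Longrightarrow> 0 < Im \<tau> \<Longrightarrow> Im \<tau> \<le> 1 \<Longrightarrow>
       norm (of_real ((2 * pi) ^ s) / (1 - e2pi \<tau>) ^ s - 1 / \<tau> ^ s) \<le> C1 / norm \<tau> ^ (s - 1)"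
    define t where "t = s - 1"
    have st: "s = Suc t" "t \<ge> 3" using s(3) by (simp_all add: t_def)
    have ev: "even s" using s(2) by (elim dvdE) simp
    then obtain m where m: "s = 2 * m" by blast
    have m2: "m \<ge> 2" "t - m \<ge> 1" "m \<le> t" using m s(3) by (simp_all add: t_def)
    define gap where "gap = 2 * pi * (real t ^ t / fact t - exp (real t) / 2 ^ t)"
    have gap: "gap > 0"
    proof -
      have "exp (real t) / 2 ^ t < real t ^ t / fact t"
        using fact_exp_bound[OF st(2)] by (simp add: divide_simps mult_ac)
      thus ?thesis by (simp add: gap_def)
    qed
    define \<eta> where "\<eta> = gap / (exp (real t) * (C0 + C1 * pi + 1))"
    have C01: "C0 + C1 * pi + 1 > 0" using C0 C1 by (intro add_nonneg_pos add_nonneg_nonneg mult_nonneg_nonneg) auto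
    have \<eta>: "\<eta> > 0" unfolding \<eta>_def using gap C01 by simp
    define \<epsilon> where "\<epsilon> = min (1/20) (\<eta> / 2)"
    have \<epsilon>: "\<epsilon> > 0" using \<eta> by (simp add: \<epsilon>_def)
    obtain k0 :: nat where k0: "real k0 > real t / (2 * pi * \<epsilon>)" using reals_Archimedean2 by blast
    show ?thesis
    proof (intro exI[of _ k0] allI impI)
      fix k assume "k \<ge> k0"
      hence k: "real k > real t / (2 * pi * \<epsilon>)" using k0 by linarith
      moreover have "real t / (2 * pi * \<epsilon>) \<ge> 0" using \<epsilon> by simp
      ultimately have kpos: "real k > 0" by linarith
      (* This height minimises exp (2 * pi * k * y) / y ^ t, the size of the contribution of the cusps. *)
      define y where "y = real t / (2 * pi * real k)"
      have y0: "y > 0" using kpos st(2) by (simp add: y_def)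
      have y\<epsilon>: "y < \<epsilon>" using k \<epsilon> kpos by (simp add: y_def field_simps)
      have y1: "y \<le> 1/20" "y < \<eta>" using y\<epsilon> \<eta> by (auto simp: \<epsilon>_def)
      have ky: "2 * pi * real k * y = real t" using kpos by (simp add: y_def)
      show "\<exists>x\<in>Zn n. q x = 2 * real k \<and> B w x \<notin> \<int>"
      proof (rule ccontr)
        assume neg: "\<not> ?thesis"
        hence int: "B w x \<in> \<int>" if "x \<in> Zn n" "q x = 2 * of_int (int k)" for x using that by auto
        define G where "G u = of_real ((2 * pi) ^ s) * (1 / (1 - e2pi (Complex u y)) ^ s)" for u
        define P where "P u = theta_diff w (Complex u y) - G u" for u
        define E where "E u = e2pi (- of_int (int k) * Complex u y)" for u
        have contE: "continuous_on A E" for A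
        proof -
          have "E = (\<lambda>u. e2pi (- of_int (int k) * (of_real u + \<i> * of_real y)))"
            by (simp add: E_def fun_eq_iff complex_eq_iff Complex_eq)
          thus ?thesis by (simp only:) (intro continuous_intros)
        qed
        note th = theta_diff_series[OF y0 int]
        note po = polar_series[OF y0 st(1)]
        have contG: "continuous_on {-1/2..1/2} G" unfolding G_def by (intro continuous_on_mult continuous_on_const po(1))
        have contP: "continuous_on {-1/2..1/2} P" unfolding P_def by (intro continuous_on_diff th(1) contG)
        have bound: "norm (P u) \<le> C0 / sqrt y ^ s + C1 / norm (Complex u y) ^ (s - 1) \<or>
           (\<exists>c d :: int. 2 \<le> c \<and> of_int c \<le> 2 / sqrt y \<and> - c \<le> d \<and> d < c \<and>
             norm (P u) \<le> C0 / sqrt y ^ s + C1 / norm (Complex u y) ^ (s - 1) + 2 / norm (of_int c * Complex u y + of_int d) ^ s)"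
          if u: "u \<in> {-1/2..1/2}" for u
        proof -
          define \<tau> where "\<tau> = Complex u y"
          have \<tau>: "\<bar>Re \<tau>\<bar> \<le> 1/2" "0 < Im \<tau>" "Im \<tau> \<le> 1/20" "Im \<tau> \<le> 1" "Im \<tau> = y"
            using u y0 y1 by (auto simp: \<tau>_def)
          have Pn: "norm (P u) \<le> norm (theta_diff w \<tau> - 1 / \<tau> ^ s) + norm (of_real ((2 * pi) ^ s) / (1 - e2pi \<tau>) ^ s - 1 / \<tau> ^ s)"
            using norm_triangle_ineq4[of "theta_diff w \<tau> - 1 / \<tau> ^ s" "of_real ((2 * pi) ^ s) / (1 - e2pi \<tau>) ^ s - 1 / \<tau> ^ s"]
            by (simp add: P_def G_def \<tau>_def)
          note po' = polar[OF \<tau>(1,2,4)]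
          from approx[OF \<tau>(1,2,3)] show ?thesis
          proof
            assume "norm (theta_diff w \<tau> - 1 / \<tau> ^ s) \<le> C0 / sqrt (Im \<tau>) ^ s"
            hence "norm (P u) \<le> C0 / sqrt y ^ s + C1 / norm \<tau> ^ (s - 1)" using Pn po' unfolding \<tau>(5) by linarith
            thus ?thesis unfolding \<tau>_def by (rule disjI1)
          next
            assume "\<exists>c d :: int. 2 \<le> c \<and> of_int c \<le> 2 / sqrt (Im \<tau>) \<and> - c \<le> d \<and> d < c \<and>
              norm (theta_diff w \<tau> - 1 / \<tau> ^ s) \<le> C0 / sqrt (Im \<tau>) ^ s + 2 / norm (of_int c * \<tau> + of_int d) ^ s"
            then obtain c d :: int where cd: "2 \<le> c" "of_int c \<le> 2 / sqrt y" "- c \<le> d" "d < c"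
              "norm (theta_diff w \<tau> - 1 / \<tau> ^ s) \<le> C0 / sqrt y ^ s + 2 / norm (of_int c * \<tau> + of_int d) ^ s"
              unfolding \<tau>(5) by blast
            have "norm (P u) \<le> C0 / sqrt y ^ s + C1 / norm \<tau> ^ (s - 1) + 2 / norm (of_int c * \<tau> + of_int d) ^ s"
              using Pn po' cd(5) by linarith
            thus ?thesis using cd(1-4) unfolding \<tau>_def by blast
          qed
        qed
        have sq: "sqrt y > 0" using y0 by simp
        have I: "integral {-1/2..1/2} (\<lambda>u. norm (P u)) \<le> C0 / sqrt y ^ s + C1 * pi / y ^ (s - 2) + pi * (2 / 2 ^ (s - 1)) / y ^ (s - 1)"
          using sq C0 by (intro farey_integral_bound[OF ev s(3) y0 _ C1 contP bound]) auto
        have "integral {-1/2..1/2} (\<lambda>u. P u * E u) = integral {-1/2..1/2} (\<lambda>u. theta_diff w (Complex u y) * E u) - integral {-1/2..1/2} (\<lambda>u. G u * E u)"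
          unfolding P_def left_diff_distrib
          by (intro integral_diff integrable_continuous_real continuous_on_mult th(1) contG contE)
        also have "integral {-1/2..1/2} (\<lambda>u. theta_diff w (Complex u y) * E u) = 0" unfolding E_def by (rule th(2))
        also have "integral {-1/2..1/2} (\<lambda>u. G u * E u) = of_real ((2 * pi) ^ s) * of_nat ((k + t) choose t)"
          unfolding G_def mult.assoc integral_mult_right E_def po(2) ..
        finally have "norm (integral {-1/2..1/2} (\<lambda>u. P u * E u)) = (2 * pi) ^ s * real ((k + t) choose t)"
          by (simp add: norm_mult norm_power)
        moreover have "norm (integral {-1/2..1/2} (\<lambda>u. P u * E u)) \<le> integral {-1/2..1/2} (\<lambda>u. exp (real t) * norm (P u))"
        proof (rule integral_norm_bound_integral)
          show "norm (P u * E u) \<le> exp (real t) * norm (P u)" for u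
          proof -
            have "norm (E u) = exp (2 * pi * real k * y)" unfolding E_def norm_e2pi by (simp add: mult_ac)
            thus ?thesis by (simp add: norm_mult ky)
          qed
        qed (intro integrable_continuous_real continuous_on_mult contP contE continuous_on_norm continuous_on_const)+
        ultimately have "(2 * pi) ^ s * real ((k + t) choose t) \<le> exp (real t) * integral {-1/2..1/2} (\<lambda>u. norm (P u))"
          by simp
        also have "\<dots> \<le> exp (real t) * (C0 / sqrt y ^ s + C1 * pi / y ^ (s - 2) + pi * (2 / 2 ^ (s - 1)) / y ^ (s - 1))"
          using I by (intro mult_left_mono) auto
        finally have "y ^ t * ((2 * pi) ^ s * real ((k + t) choose t)) \<le> y ^ t * (exp (real t) * (C0 / sqrt y ^ s + C1 * pi / y ^ (s - 2) + pi * (2 / 2 ^ (s - 1)) / y ^ (s - 1)))"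
          using y0 by (intro mult_left_mono) auto
        also have "\<dots> = exp (real t) * (C0 * (y ^ t / sqrt y ^ s) + C1 * pi * (y ^ t / y ^ (s - 2)) + pi * (2 / 2 ^ t) * (y ^ t / y ^ t))"
          by (simp add: t_def distrib_left mult_ac)
        also have "y ^ t / sqrt y ^ s = y ^ (t - m)"
        proof -
          have "sqrt y ^ s = y ^ m" using y0 by (simp add: m power_mult)
          thus ?thesis using y0 m2(3) by (simp add: power_diff)
        qed
        also have "y ^ t / y ^ (s - 2) = y"
        proof -
          have "t = Suc (s - 2)" using st by simp
          hence "y ^ t = y * y ^ (s - 2)" by (metis power_Suc)
          thus ?thesis using y0 by simp
        qed
        also have "y ^ t / y ^ t = 1" using y0 by simp
        also have "exp (real t) * (C0 * y ^ (t - m) + C1 * pi * y + pi * (2 / 2 ^ t) * 1) \<le> exp (real t) * (C0 * y + C1 * pi * y + pi * (2 / 2 ^ t) * 1)"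
        proof (intro mult_left_mono add_right_mono C0)
          have "y ^ (t - m) \<le> y ^ 1" using y0 y1 m2 by (intro power_decreasing) auto
          thus "y ^ (t - m) \<le> y" by simp
        qed simp
        finally have up: "y ^ t * ((2 * pi) ^ s * real ((k + t) choose t)) \<le> exp (real t) * (C0 + C1 * pi) * y + 2 * pi * (exp (real t) / 2 ^ t)"
          by (simp add: distrib_left distrib_right mult_ac)
        have "2 * pi * (real t ^ t / fact t) = y ^ t * ((2 * pi) ^ s * (real k ^ t / fact t))"
        proof -
          have "y ^ t * ((2 * pi) ^ s * (real k ^ t / fact t)) = 2 * pi * ((2 * pi * real k * y) ^ t / fact t)"
            by (simp add: st(1) power_mult_distrib)
          thus ?thesis by (simp only: ky)
        qed
        also have "\<dots> \<le> y ^ t * ((2 * pi) ^ s * real ((k + t) choose t))"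
          using y0 binomial_ge_power[of k t] by (intro mult_left_mono) auto
        finally have "gap \<le> exp (real t) * (C0 + C1 * pi) * y" using up by (simp add: gap_def right_diff_distrib)
        also have "\<dots> \<le> exp (real t) * (C0 + C1 * pi + 1) * y" using y0 by (intro mult_right_mono mult_left_mono) auto
        also have "\<dots> < exp (real t) * (C0 + C1 * pi + 1) * \<eta>" using y1(2) C01 by (intro mult_strict_left_mono) auto
        also have "\<dots> = gap" using C01 by (simp add: \<eta>_def)
        finally show False by simp
      qed
    qed
  qed
qed

end

section \<open>Proper subgroups\<close>

lemma group_int_multiples:
  fixes G :: "(nat \<Rightarrow> real) set"
  assumes 0: "(\<lambda>_. 0) \<in> G" and diff: "\<forall>x\<in>G. \<forall>y\<in>G. (\<lambda>i. x i - y i) \<in> G"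
    and x: "x \<in> G" and y: "y \<in> G"
  shows "(\<lambda>i. x i - of_int c * y i) \<in> G"
proof -
  have neg: "(\<lambda>i. - z i) \<in> G" if "z \<in> G" for z using bspec[OF bspec[OF diff 0] that] by simp
  have nat: "(\<lambda>i. x i - real k * z i) \<in> G" if z: "z \<in> G" for k z
  proof (induction k)
    case (Suc k)
    have "(\<lambda>i. (x i - real k * z i) - z i) \<in> G" by (rule bspec[OF bspec[OF diff Suc] z])
    thus ?case by (simp add: algebra_simps)
  qed (use x in simp)
  show ?thesis
  proof (cases "c \<ge> 0")
    case True
    thus ?thesis using nat[OF y, of "nat c"] by simp
  next
    case False
    thus ?thesis using nat[OF neg[OF y], of "nat (- c)"] by simp
  qed
qed

text \<open>The \<open>n\<close>-th coordinates of the elements of \<open>G\<close> form a subgroup of the integers; \<open>h\<close> attains its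
nonnegative generator \<open>g\<close>.\<close>

lemma coordinate_generator:
  fixes G :: "(nat \<Rightarrow> real) set"
  assumes 0: "(\<lambda>_. 0) \<in> G" and diff: "\<forall>x\<in>G. \<forall>y\<in>G. (\<lambda>i. x i - y i) \<in> G"
    and int: "\<And>x. x \<in> G \<Longrightarrow> x n \<in> \<int>"
  shows "\<exists>h\<in>G. \<exists>g. h n = real g \<and> (\<forall>x\<in>G. \<exists>c::int. x n = of_int c * real g)"
proof (cases "\<forall>x\<in>G. x n = 0")
  case True
  show ?thesis by (intro bexI[OF _ 0] exI[of _ 0]) (use True in simp)
next
  case False
  then obtain x where x: "x \<in> G" "x n \<noteq> 0" by blast
  obtain k :: int where k: "x n = of_int k" using int[OF x(1)] by (elim Ints_cases)
  define S where "S = {m::nat. m > 0 \<and> (\<exists>x\<in>G. x n = real m)}"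
  have "nat \<bar>k\<bar> \<in> S"
  proof (cases "k \<ge> 0")
    case True
    thus ?thesis using x k unfolding S_def by (auto intro!: bexI[of _ x])
  next
    case False
    have "(\<lambda>i. 0 - x i) \<in> G" by (rule bspec[OF bspec[OF diff 0] x(1)])
    thus ?thesis using False k unfolding S_def by (auto intro!: bexI[of _ "\<lambda>i. 0 - x i"])
  qed
  hence S: "(LEAST m. m \<in> S) \<in> S" by (rule LeastI)
  define g where "g = (LEAST m. m \<in> S)"
  have g: "g > 0" using S by (simp add: g_def S_def)
  obtain h where h: "h \<in> G" "h n = real g" using S unfolding g_def S_def by blast
  have gen: "\<exists>c::int. z n = of_int c * real g" if z: "z \<in> G" for z
  proof -
    obtain j :: int where j: "z n = of_int j" using int[OF z] by (elim Ints_cases)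
    define r where "r = nat (j mod int g)"
    have r: "r < g" "int r = j - (j div int g) * int g"
      using g by (simp_all add: r_def minus_div_mult_eq_mod nat_less_iff)
    have rG: "(\<lambda>i. z i - of_int (j div int g) * h i) \<in> G" by (rule group_int_multiples[OF 0 diff z h(1)])
    have rn: "z n - of_int (j div int g) * h n = real r"
    proof -
      have "real_of_int (int r) = of_int (j - (j div int g) * int g)" by (simp only: r(2))
      thus ?thesis by (simp add: j h(2))
    qed
    have "r = 0"
    proof (rule ccontr)
      assume "r \<noteq> 0"
      hence "r \<in> S" unfolding S_def mem_Collect_eq by (intro conjI bexI[OF _ rG] rn) simp
      thus False using not_less_Least[of r "\<lambda>m. m \<in> S"] r(1) by (simp add: g_def)
    qed
    hence "j = (j div int g) * int g" using r(2) by simp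
    hence "real_of_int j = of_int ((j div int g) * int g)" by (rule arg_cong)
    thus ?thesis using j by (intro exI[of _ "j div int g"]) simp
  qed
  show ?thesis by (intro bexI[OF _ h(1)] exI[of _ g] conjI ballI h(2) gen)
qed

text \<open>Induction on the rank. If the elements of \<open>G\<close> with last coordinate \<open>0\<close> already form a proper subgroup in one
rank less, a functional for it extends to \<open>G\<close>, because its value on the last basis vector can be adjusted so that it vanishes on an element \<open>h\<close>
with the smallest positive last coordinate, if there is one. Otherwise the last coordinates of \<open>G\<close> form a proper subgroup of the integers, and a multiple
of the last coordinate does it.\<close>

lemma proper_subgroup_functional:
  assumes "G \<subseteq> Zn n" "G \<noteq> Zn n" "(\<lambda>_. 0) \<in> G" "\<forall>x\<in>G. \<forall>y\<in>G. (\<lambda>i. x i - y i) \<in> G"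
  shows "\<exists>\<phi>. (\<forall>i<n. \<phi> i \<in> \<rat>) \<and> (\<forall>x\<in>G. ip n \<phi> x \<in> \<int>) \<and> (\<exists>x\<in>Zn n. ip n \<phi> x \<notin> \<int>)"
  using assms
proof (induction n arbitrary: G)
  case 0
  have "G = Zn 0" using 0(1,3) unfolding Zn_0 by blast
  thus ?case using 0(2) by contradiction
next
  case (Suc n)
  have mult: "(\<lambda>i. x i - of_int c * y i) \<in> G" if "x \<in> G" "y \<in> G" for x y c
    by (rule group_int_multiples[OF Suc.prems(3,4) that])
  have sub: "Zn n \<subseteq> Zn (Suc n)" by (auto simp: Zn_def less_Suc_eq)
  have Gint: "x i \<in> \<int>" if "x \<in> G" "i \<le> n" for x i using Suc.prems(1) that by (auto simp: Zn_def)
  define G' where "G' = {x \<in> G. x n = 0}"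
  have G'Zn: "x \<in> Zn n" if "x \<in> Zn (Suc n)" "x n = 0" for x
    unfolding Zn_def mem_Collect_eq
  proof (intro conjI allI impI)
    show "x i \<in> \<int>" if "i < n" for i using \<open>x \<in> Zn (Suc n)\<close> that by (simp add: Zn_def)
    show "x i = 0" if "i \<ge> n" for i
      using \<open>x \<in> Zn (Suc n)\<close> \<open>x n = 0\<close> that by (cases "i = n") (simp_all add: Zn_def)
  qed
  have G': "G' \<subseteq> Zn n" "(\<lambda>_. 0) \<in> G'" "\<forall>x\<in>G'. \<forall>y\<in>G'. (\<lambda>i. x i - y i) \<in> G'"
  proof -
    show "G' \<subseteq> Zn n" using Suc.prems(1) G'Zn unfolding G'_def by blast
    show "(\<lambda>_. 0) \<in> G'" using Suc.prems(3) by (simp add: G'_def)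
    show "\<forall>x\<in>G'. \<forall>y\<in>G'. (\<lambda>i. x i - y i) \<in> G'"
      using Suc.prems(4) by (simp add: G'_def)
  qed
  have "\<exists>h\<in>G. \<exists>g. h n = real g \<and> (\<forall>x\<in>G. \<exists>c::int. x n = of_int c * real g)"
    by (rule coordinate_generator[where G = G and n = n, OF Suc.prems(3,4)]) (simp_all add: Gint)
  then obtain h g where h: "h \<in> G" "h n = real g" and hg': "\<forall>x\<in>G. \<exists>c::int. x n = of_int c * real g"
    by (elim bexE exE conjE)
  note hg = hg'[rule_format]
  have red: "\<exists>c::int. x n = of_int c * real g \<and> (\<lambda>i. x i - of_int c * h i) \<in> G'" if x: "x \<in> G" for x
  proof -
    obtain c :: int where c: "x n = of_int c * real g" using hg[OF x] by blast
    have "(\<lambda>i. x i - of_int c * h i) \<in> G'" using mult[OF x h(1), of c] c h(2) by (simp add: G'_def)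
    thus ?thesis using c by blast
  qed
  show ?case
  proof (cases "G' = Zn n")
    case False
    from Suc.IH[OF G'(1) False G'(2,3)]
    obtain \<phi> where all: "\<forall>i<n. \<phi> i \<in> \<rat>" "\<forall>x\<in>G'. ip n \<phi> x \<in> \<int>" "\<exists>x\<in>Zn n. ip n \<phi> x \<notin> \<int>"
      by (elim exE conjE)
    note \<phi> = all(1)[rule_format] all(2)[rule_format]
    obtain x0 where x0: "x0 \<in> Zn n" "ip n \<phi> x0 \<notin> \<int>" using all(3) by (elim bexE)
    (* Makes the extended functional vanish on h. For g = 0 it is 0, and the last coordinate is 0 on G. *)
    define v where "v = - ip n \<phi> h / real g"
    have vR: "v \<in> \<rat>"
    proof -
      have "h i \<in> \<rat>" if "i < n" for i using Gint[OF h(1), of i] that Ints_subset_Rats by auto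
      hence "ip n \<phi> h \<in> \<rat>" unfolding ip_def by (intro Rats_sum Rats_mult \<phi>(1)) auto
      thus ?thesis unfolding v_def by (intro Rats_divide Rats_minus_iff[THEN iffD2] Rats_of_nat)
    qed
    have ip': "ip (Suc n) (\<phi>(n := v)) x = ip n \<phi> x + v * x n" for x by (simp add: ip_def)
    have G: "ip (Suc n) (\<phi>(n := v)) x \<in> \<int>" if x: "x \<in> G" for x
    proof -
      obtain c :: int where c: "x n = of_int c * real g" "(\<lambda>i. x i - of_int c * h i) \<in> G'" using red[OF x] by blast
      have l: "ip n \<phi> (\<lambda>i. x i - of_int c * h i) = ip n \<phi> x - of_int c * ip n \<phi> h"
        by (simp add: ip_def algebra_simps sum_subtractf sum_distrib_left)
      show ?thesis
      proof (cases "g = 0")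
        case True
        hence xn: "x n = 0" using c(1) by simp
        hence "x \<in> G'" using x by (simp add: G'_def)
        from \<phi>(2)[OF this] show ?thesis by (simp add: ip' xn)
      next
        case False
        hence vx: "v * x n = - (of_int c * ip n \<phi> h)" unfolding v_def c(1) by simp
        have "ip (Suc n) (\<phi>(n := v)) x = ip n \<phi> (\<lambda>i. x i - of_int c * h i)" unfolding ip' l vx by simp
        thus ?thesis using \<phi>(2)[OF c(2)] by (simp only:)
      qed
    qed
    have "x0 n = 0" using x0(1) by (simp add: Zn_def)
    hence "ip (Suc n) (\<phi>(n := v)) x0 \<notin> \<int>" using x0(2) by (simp add: ip')
    moreover have "\<forall>i<Suc n. (\<phi>(n := v)) i \<in> \<rat>" using \<phi>(1) vR by (simp add: less_Suc_eq)
    ultimately show ?thesis using G x0(1) sub by blast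
  next
    case True
    have g1: "g \<noteq> 1"
    proof
      assume "g = 1"
      have "x \<in> G" if x: "x \<in> Zn (Suc n)" for x
      proof -
        have "x n \<in> \<int>" using x by (simp add: Zn_def)
        then obtain c :: int where c: "x n = of_int c" by (elim Ints_cases)
        define z where "z i = x i - of_int c * h i" for i
        have hZ: "h \<in> Zn (Suc n)" using h Suc.prems(1) by blast
        have "z \<in> Zn (Suc n)" using x hZ by (auto simp: Zn_def z_def)
        hence "z \<in> Zn n" by (rule G'Zn) (simp add: z_def c h(2) \<open>g = 1\<close>)
        hence "z \<in> G" using True by (auto simp: G'_def)
        from mult[OF this h(1), of "- c"] show "x \<in> G" by (simp add: z_def)
      qed
      thus False using Suc.prems(1,2) by blast
    qed
    (* For g = 0 the last coordinate is 0 on G, and any non-integral value does. *)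
    define v where "v = (if g = 0 then 1/2 else 1 / real g)"
    define \<phi> where "\<phi> = (\<lambda>i. if i = n then v else 0)"
    have ip\<phi>: "ip (Suc n) \<phi> x = v * x n" for x by (simp add: ip_def \<phi>_def)
    have vN: "v \<notin> \<int>"
    proof
      assume "v \<in> \<int>"
      then obtain j :: int where j: "v = of_int j" by (elim Ints_cases)
      have "0 < v" "v < 1" using g1 by (auto simp: v_def)
      thus False using j by simp
    qed
    have "\<forall>i<Suc n. \<phi> i \<in> \<rat>" by (auto simp: \<phi>_def v_def)
    moreover have "\<forall>x\<in>G. ip (Suc n) \<phi> x \<in> \<int>"
    proof
      fix x assume "x \<in> G"
      then obtain c :: int where "x n = of_int c * real g" using hg by blast
      hence "v * x n = (if g = 0 then 0 else of_int c)" by (simp add: v_def)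
      thus "ip (Suc n) \<phi> x \<in> \<int>" by (simp add: ip\<phi>)
    qed
    moreover have "(\<lambda>i. if i = n then 1 else 0) \<in> Zn (Suc n)" by (auto simp: Zn_def)
    moreover have "ip (Suc n) \<phi> (\<lambda>i. if i = n then 1 else 0) \<notin> \<int>" using vN by (simp add: ip\<phi>)
    ultimately show ?thesis by blast
  qed
qed

context even_unimodular_gram
begin

text \<open>Unimodularity: the functional is the product with a combination of the vectors dual to the coordinates.\<close>

lemma represent_functional:
  assumes "\<forall>i<n. \<phi> i \<in> \<rat>"
  shows "\<exists>w. (\<forall>i<n. w i \<in> \<rat>) \<and> (\<forall>x. B w x = ip n \<phi> x)"
proof -
  have "\<exists>x. i < n \<longrightarrow> x \<in> Zn n \<and> (\<forall>j<n. (if j = i then 1 else 0) = (\<Sum>l<n. A j l * x l))" for i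
  proof (cases "i < n")
    case True
    hence "(\<lambda>j. if j = i then 1 else 0) \<in> Zn n" by (simp add: Zn_def)
    from dual[OF this] show ?thesis by blast
  qed simp
  hence "\<forall>i. \<exists>x. i < n \<longrightarrow> x \<in> Zn n \<and> (\<forall>j<n. (if j = i then 1 else 0) = (\<Sum>l<n. A j l * x l))" by (rule allI)
  from choice[OF this]
  obtain d where d': "\<forall>i. i < n \<longrightarrow> d i \<in> Zn n \<and> (\<forall>j<n. (if j = i then 1 else 0) = (\<Sum>l<n. A j l * d i l))"
    by (elim exE)
  have d: "d i \<in> Zn n" if "i < n" for i using d' that by simp
  have d2: "(if j = i then 1 else 0) = (\<Sum>l<n. A j l * d i l)" if "i < n" "j < n" for i j
    using d'[rule_format, OF that(1)] that(2) by (elim conjE allE[of _ j] impE)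
  define w where "w l = (\<Sum>i<n. \<phi> i * d i l)" for l
  show ?thesis
  proof (intro exI[of _ w] conjI allI impI)
    show "w l \<in> \<rat>" if "l < n" for l
      unfolding w_def using d that Ints_subset_Rats by (intro Rats_sum Rats_mult) (auto simp: Zn_def assms)
    fix x
    have "dualmap w j = \<phi> j" if j: "j < n" for j
    proof -
      have "dualmap w j = (\<Sum>l<n. \<Sum>i<n. \<phi> i * (A j l * d i l))"
        using j by (simp add: dualmap_def w_def sum_distrib_left mult_ac)
      also have "\<dots> = (\<Sum>i<n. \<phi> i * (\<Sum>l<n. A j l * d i l))"
        unfolding sum_distrib_left by (rule sum.swap)
      also have "\<dots> = (\<Sum>i<n. \<phi> i * (if j = i then 1 else 0))"
        using j by (intro sum.cong refl) (simp only: d2 lessThan_iff)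
      also have "\<dots> = (\<Sum>i<n. if j = i then \<phi> i else 0)" by (intro sum.cong refl) simp
      also have "\<dots> = \<phi> j" using j by simp
      finally show ?thesis .
    qed
    thus "B w x = ip n \<phi> x" unfolding ip_dualmap[symmetric] by (intro ip_cong) auto
  qed
qed

theorem proper_subgroup_misses_large_norms:
  assumes G: "G \<subseteq> Zn n" "G \<noteq> Zn n" "(\<lambda>_. 0) \<in> G" "\<forall>x\<in>G. \<forall>y\<in>G. (\<lambda>i. x i - y i) \<in> G"
  shows "\<exists>k0. \<forall>k\<ge>k0. \<exists>x\<in>Zn n - G. q x = 2 * real k"
proof -
  obtain \<phi> where all: "\<forall>i<n. \<phi> i \<in> \<rat>" "\<forall>x\<in>G. ip n \<phi> x \<in> \<int>" "\<exists>x\<in>Zn n. ip n \<phi> x \<notin> \<int>"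
    using proper_subgroup_functional[OF G] by (elim exE conjE)
  note \<phi> = all(1)[rule_format] all(2)[rule_format]
  obtain x0 where x0: "x0 \<in> Zn n" "ip n \<phi> x0 \<notin> \<int>" using all(3) by (elim bexE)
  obtain w where allw: "\<forall>i<n. w i \<in> \<rat>" "\<forall>x. B w x = ip n \<phi> x"
    using represent_functional[OF all(1)] by (elim exE conjE)
  note w = allw[rule_format]
  obtain N where N: "N > 0" "\<And>i. i < n \<Longrightarrow> real N * w i \<in> \<int>"
  proof -
    have "\<exists>D::nat. D > 0 \<and> (\<forall>i<n. real D * w i \<in> \<int>)" by (rule common_denominator) (rule w(1))
    thus ?thesis using that by (elim exE conjE) simp
  qed
  have wn: "\<exists>i<n. w i \<notin> \<int>"
  proof (rule ccontr)
    assume "\<not> ?thesis"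
    hence "B w x0 \<in> \<int>" using x0(1) unfolding bf_def by (intro Ints_sum Ints_mult int) (auto simp: Zn_def)
    thus False using x0(2) by (simp add: w(2))
  qed
  have "\<exists>k0. \<forall>k\<ge>k0. \<exists>x\<in>Zn n. q x = 2 * real k \<and> B w x \<notin> \<int>"
    by (rule all_large_norms_avoid_kernel[OF N(1) _ wn]) (rule N(2))
  then obtain k0 where k0: "\<forall>k\<ge>k0. \<exists>x\<in>Zn n. q x = 2 * real k \<and> B w x \<notin> \<int>"
    by (elim exE)
  show ?thesis
  proof (intro exI[of _ k0] allI impI)
    fix k assume "k \<ge> k0"
    from k0[rule_format, OF this]
    obtain x where x: "x \<in> Zn n" "q x = 2 * real k" "B w x \<notin> \<int>" by (elim bexE conjE)
    hence "x \<notin> G" using \<phi>(2) by (auto simp: w(2))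
    thus "\<exists>x\<in>Zn n - G. q x = 2 * real k" using x by blast
  qed
qed

end

section \<open>Coordinates on an abstract lattice\<close>

context pos_def_even_unimodular_lattice
begin

lemma form_sum_left:
  assumes L: "L = span V" and "finite I" "\<And>i. i \<in> I \<Longrightarrow> v i \<in> L" "z \<in> L"
  shows "form (\<Sum>i\<in>I. scale (c i) (v i)) z = (\<Sum>i\<in>I. c i * form (v i) z)"
  using assms(2,3)
proof (induction I rule: finite_induct)
  case empty
  have "form (scale 0 z) z = 0 * form z z" by (rule form_scale_left[OF assms(4,4)])
  thus ?case by simp
next
  case (insert i I)
  have vi: "v i \<in> L" using insert.prems by simp
  have IH: "form (\<Sum>i\<in>I. scale (c i) (v i)) z = (\<Sum>i\<in>I. c i * form (v i) z)"
    by (rule insert.IH) (simp add: insert.prems)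
  have 1: "scale (c i) (v i) \<in> L" using vi unfolding L by (rule span_scale)
  have 2: "(\<Sum>i\<in>I. scale (c i) (v i)) \<in> L"
    unfolding L by (intro span_sum span_scale) (use insert.prems in \<open>simp add: L\<close>)
  have "form (\<Sum>i\<in>insert i I. scale (c i) (v i)) z = form (scale (c i) (v i) + (\<Sum>i\<in>I. scale (c i) (v i))) z"
    using insert.hyps by simp
  also have "\<dots> = form (scale (c i) (v i)) z + form (\<Sum>i\<in>I. scale (c i) (v i)) z"
    by (rule form_add_left[OF 1 2 assms(4)])
  also have "form (scale (c i) (v i)) z = c i * form (v i) z"
    by (rule form_scale_left[OF vi assms(4)])
  finally show ?case using insert.hyps by (simp add: IH)
qed

text \<open>Transport to coordinates with respect to a basis. The condition \<open>dual\<close> is obtained from the adjugate of the Gram matrix, whose determinant is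
its own inverse.\<close>

lemma coordinates:
  obtains n A emb where
    "n > 0 \<Longrightarrow> even_unimodular_gram n A"
    "emb ` Zn n = L"
    "\<And>x y. x \<in> Zn n \<Longrightarrow> y \<in> Zn n \<Longrightarrow> emb (\<lambda>i. x i - y i) = emb x - emb y"
    "\<And>x. x \<in> Zn n \<Longrightarrow> of_int (form (emb x) (emb x)) = qf n A x"
proof -
  obtain bs where bs: "is_basis L bs" and det: "Determinant.det (gram_mat form bs) \<in> {1, -1}"
    using free_unimodular by blast
  have dist: "distinct bs" and ind: "independent (set bs)" and span: "L = span (set bs)"
    using bs by (auto simp: is_basis_def)
  define n where "n = length bs"
  define b where "b i = bs ! i" for i
  define A where "A i j = real_of_int (form (b i) (b j))" for i j
  define emb where "emb x = (\<Sum>i<n. scale \<lfloor>x i\<rfloor> (b i))" for x :: "nat \<Rightarrow> real"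
  have bij: "bij_betw b {..<n} (set bs)"
    unfolding b_def by (rule bij_betw_nth[OF dist]) (simp_all add: n_def)
  have bL: "b i \<in> L" if "i < n" for i
    unfolding span using that by (intro span_base) (simp add: b_def n_def)
  have embL: "emb x \<in> L" for x
    unfolding emb_def span using bL by (intro span_sum span_scale) (simp add: span)
  have fl: "of_int \<lfloor>x i\<rfloor> = x i" if "x \<in> Zn n" "i < n" for x i
    using that by (simp add: Zn_def)
  have emb_diff: "emb (\<lambda>i. x i - y i) = emb x - emb y" if "x \<in> Zn n" "y \<in> Zn n" for x y
  proof -
    have "scale \<lfloor>x i - y i\<rfloor> (b i) = scale \<lfloor>x i\<rfloor> (b i) - scale \<lfloor>y i\<rfloor> (b i)" if "i < n" for i
    proof -
      have "real_of_int \<lfloor>x i - y i\<rfloor> = of_int (\<lfloor>x i\<rfloor> - \<lfloor>y i\<rfloor>)"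
        using \<open>x \<in> Zn n\<close> \<open>y \<in> Zn n\<close> that by (simp add: Zn_def)
      hence "\<lfloor>x i - y i\<rfloor> = \<lfloor>x i\<rfloor> - \<lfloor>y i\<rfloor>" by (simp only: of_int_eq_iff)
      thus ?thesis by (simp only: scale_left_diff_distrib)
    qed
    thus ?thesis by (simp add: emb_def sum_subtractf)
  qed
  have formq: "real_of_int (form (emb x) (emb x)) = qf n A x" if x: "x \<in> Zn n" for x
  proof -
    have 1: "form (emb x) (emb x) = (\<Sum>i<n. \<lfloor>x i\<rfloor> * form (b i) (emb x))"
      unfolding emb_def[of x] by (subst form_sum_left[OF span]) (use bL embL[of x] in \<open>auto simp: emb_def\<close>)
    have 2: "form (b i) (emb x) = (\<Sum>j<n. \<lfloor>x j\<rfloor> * form (b j) (b i))" if "i < n" for i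
    proof -
      have "form (b i) (emb x) = form (emb x) (b i)" by (rule form_sym[OF bL[OF that] embL])
      also have "\<dots> = (\<Sum>j<n. \<lfloor>x j\<rfloor> * form (b j) (b i))"
        unfolding emb_def by (rule form_sum_left[OF span]) (use bL that in auto)
      finally show ?thesis .
    qed
    have "real_of_int (form (emb x) (emb x)) = (\<Sum>i<n. x i * (\<Sum>j<n. x j * A j i))"
      unfolding 1 A_def of_int_sum of_int_mult
      by (intro sum.cong refl) (simp add: 2 fl[OF x])
    also have "\<dots> = qf n A x"
      unfolding qf_def sum_distrib_left by (subst sum.swap) (simp add: mult_ac)
    finally show ?thesis .
  qed
  have surj: "emb ` Zn n = L"
  proof (intro equalityI subsetI)
    fix l assume "l \<in> L"
    then obtain u where u: "l = (\<Sum>v\<in>set bs. scale (u v) v)"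
      unfolding span span_finite[OF finite_set] by blast
    define x where "x i = (if i < n then real_of_int (u (b i)) else 0)" for i
    have "l = (\<Sum>i<n. scale (u (b i)) (b i))"
      unfolding u by (rule sum.reindex_bij_betw[OF bij, symmetric])
    also have "\<dots> = emb x" by (simp add: emb_def x_def)
    finally show "l \<in> emb ` Zn n" by (intro image_eqI[of _ _ x]) (auto simp: Zn_def x_def)
  qed (use embL in auto)
  have inj: "x = (\<lambda>_. 0)" if x: "x \<in> Zn n" and e: "emb x = 0" for x
  proof -
    define u where "u v = \<lfloor>x (the_inv_into {..<n} b v)\<rfloor>" for v
    have ub: "u (b i) = \<lfloor>x i\<rfloor>" if "i < n" for i
      unfolding u_def using the_inv_into_f_f[OF bij_betw_imp_inj_on[OF bij], of i] that by simp
    have "(\<Sum>v\<in>set bs. scale (u v) v) = (\<Sum>i<n. scale (u (b i)) (b i))"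
      by (rule sum.reindex_bij_betw[OF bij, symmetric])
    also have "\<dots> = emb x" unfolding emb_def by (intro sum.cong refl) (simp add: ub)
    finally have z: "(\<Sum>v\<in>set bs. scale (u v) v) = 0" using e by simp
    have "x i = 0" for i
    proof (cases "i < n")
      case True
      have "u (b i) = 0" by (rule independentD[OF ind finite_set subset_refl z]) (use True in \<open>simp add: b_def n_def\<close>)
      thus ?thesis using ub[OF True] fl[OF x True] by simp
    next
      case False thus ?thesis using x by (simp add: Zn_def)
    qed
    thus ?thesis by auto
  qed
  have gram: "even_unimodular_gram n A" if "n > 0"
  proof
    show "n > 0" by fact
    show "A i j = A j i" if "i < n" "j < n" for i j
      using form_sym[OF bL[OF that(1)] bL[OF that(2)]] by (simp add: A_def)
    show "A i j \<in> \<int>" for i j by (simp add: A_def)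
    show "qf n A x / 2 \<in> \<int>" if x: "x \<in> Zn n" for x
    proof -
      obtain k where "form (emb x) (emb x) = 2 * k" using form_even[OF embL[of x]] by (elim evenE)
      hence "qf n A x / 2 = of_int k" using formq[OF x] by simp
      thus ?thesis by simp
    qed
    show "qf n A x > 0" if x: "x \<in> Zn n" "x \<noteq> (\<lambda>_. 0)" for x
    proof -
      have "emb x \<noteq> 0" using inj[OF x(1)] x(2) by blast
      hence "form (emb x) (emb x) > 0" by (rule form_pos[OF embL])
      thus ?thesis using formq[OF x(1)] by simp
    qed
    show "\<exists>x\<in>Zn n. \<forall>i<n. k i = (\<Sum>j<n. A i j * x j)" if k: "k \<in> Zn n" for k
    proof -
      define M where "M = gram_mat form bs"
      have M: "M \<in> carrier_mat n n" by (simp add: M_def gram_mat_def n_def)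
      define d where "d = real_of_int (Determinant.det M)"
      have d2: "d * d = 1" using det by (auto simp: d_def M_def)
      define R where "R j l = real_of_int (adj_mat M $$ (j, l))" for j l
      have MR: "(\<Sum>j<n. A i j * R j l) = (if i = l then d else 0)" if il: "i < n" "l < n" for i l
      proof -
        have "(M * adj_mat M) $$ (i, l) = (Determinant.det M \<cdot>\<^sub>m 1\<^sub>m n) $$ (i, l)"
          by (simp only: adj_mat(2)[OF M])
        moreover have "(M * adj_mat M) $$ (i, l) = (\<Sum>j<n. M $$ (i, j) * adj_mat M $$ (j, l))"
          using M adj_mat(1)[OF M] il by (simp add: scalar_prod_def atLeast0LessThan)
        moreover have "(Determinant.det M \<cdot>\<^sub>m 1\<^sub>m n) $$ (i, l) = (if i = l then Determinant.det M else 0)"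
          using il by simp
        ultimately have "(\<Sum>j<n. M $$ (i, j) * adj_mat M $$ (j, l)) = (if i = l then Determinant.det M else 0)" by simp
        hence "real_of_int (\<Sum>j<n. M $$ (i, j) * adj_mat M $$ (j, l)) = (if i = l then d else 0)"
          by (simp add: d_def)
        moreover have "M $$ (i, j) = form (b i) (b j)" if "j < n" for j
          using il that by (simp add: M_def gram_mat_def n_def b_def)
        ultimately show ?thesis by (simp add: A_def R_def)
      qed
      define x where "x j = (if j < n then d * (\<Sum>l<n. R j l * k l) else 0)" for j
      have "x \<in> Zn n"
      proof -
        have "d * (\<Sum>l<n. R j l * k l) \<in> \<int>" for j
          unfolding d_def R_def by (intro Ints_mult Ints_of_int Ints_sum) (use k in \<open>simp add: Zn_def\<close>)
        thus ?thesis by (simp add: Zn_def x_def)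
      qed
      moreover have "k i = (\<Sum>j<n. A i j * x j)" if i: "i < n" for i
      proof -
        have "(\<Sum>j<n. A i j * x j) = d * (\<Sum>j<n. \<Sum>l<n. A i j * R j l * k l)"
          by (simp add: x_def sum_distrib_left mult_ac)
        also have "(\<Sum>j<n. \<Sum>l<n. A i j * R j l * k l) = (\<Sum>l<n. (\<Sum>j<n. A i j * R j l) * k l)"
          unfolding sum_distrib_right by (rule sum.swap)
        also have "\<dots> = (\<Sum>l<n. if i = l then d * k l else 0)"
          by (intro sum.cong refl) (simp add: MR i)
        also have "\<dots> = d * k i" using i by simp
        also have "d * (d * k i) = k i" using d2 by (simp flip: mult.assoc)
        finally show ?thesis by simp
      qed
      ultimately show ?thesis by blast
    qed
  qed
  show ?thesis by (rule that[OF gram surj emb_diff formq])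
qed

end

theorem corollary5p2p3:
  fixes scale :: "int \<Rightarrow> 'a::ab_group_add \<Rightarrow> 'a"
    and L :: "'a set"
    and form :: "'a \<Rightarrow> 'a \<Rightarrow> int"
    and S :: "int set"
  assumes "pos_def_even_unimodular_lattice scale L form"
    and "infinite S"
    and "\<And>s. s \<in> S \<Longrightarrow> s > 0 \<and> even s"
  shows "group_closure {x \<in> L. form x x \<in> S} = L"
proof -
  interpret pos_def_even_unimodular_lattice scale L form by fact
  define X where "X = {x \<in> L. form x x \<in> S}"
  show ?thesis
  proof (rule coordinates)
    fix n A and emb :: "(nat \<Rightarrow> real) \<Rightarrow> 'a"
    assume gram: "n > 0 \<Longrightarrow> even_unimodular_gram n A" and surj: "emb ` Zn n = L"
      and diff: "\<And>x y. x \<in> Zn n \<Longrightarrow> y \<in> Zn n \<Longrightarrow> emb (\<lambda>i. x i - y i) = emb x - emb y"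
      and norm: "\<And>x. x \<in> Zn n \<Longrightarrow> of_int (form (emb x) (emb x)) = qf n A x"
    have Zn_diff: "(\<lambda>i. x i - y i) \<in> Zn n" if "x \<in> Zn n" "y \<in> Zn n" for x y
      using that by (simp add: Zn_def)
    have Zn0: "(\<lambda>_. 0) \<in> Zn n" by (simp add: Zn_def)
    have emb0: "emb (\<lambda>_. 0) = 0" using diff[OF Zn0 Zn0] by simp
    have sub: "group_closure X \<subseteq> L"
    proof
      fix x assume "x \<in> group_closure X"
      thus "x \<in> L"
      proof induction
        case (base x)
        have "0 \<in> L" using surj emb0 Zn0 by (metis imageI)
        thus ?case using base by (auto simp: X_def)
      next
        case (diff x y)
        from diff.IH obtain u v where "u \<in> Zn n" "v \<in> Zn n" "x = emb u" "y = emb v" unfolding surj[symmetric] by blast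
        hence "x - y = emb (\<lambda>i. u i - v i)" "(\<lambda>i. u i - v i) \<in> Zn n"
          using \<open>\<And>x y. x \<in> Zn n \<Longrightarrow> y \<in> Zn n \<Longrightarrow> emb (\<lambda>i. x i - y i) = emb x - emb y\<close> Zn_diff by simp_all
        thus ?case unfolding surj[symmetric] by (simp only: imageI)
      qed
    qed
    have "group_closure X = L"
    proof (rule ccontr)
      assume neq: "group_closure X \<noteq> L"
      define G where "G = {x \<in> Zn n. emb x \<in> group_closure X}"
      have GZ: "G \<subseteq> Zn n" by (auto simp: G_def)
      have "G \<noteq> Zn n"
      proof
        assume "G = Zn n"
        hence "L \<subseteq> group_closure X" unfolding surj[symmetric] by (auto simp: G_def)
        thus False using neq sub by blast
      qed
      have G0: "(\<lambda>_. 0) \<in> G" by (simp add: G_def Zn0 emb0)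
      have Gd: "\<forall>x\<in>G. \<forall>y\<in>G. (\<lambda>i. x i - y i) \<in> G"
        by (simp add: G_def Zn_diff diff group_closure.diff)
      have "n > 0"
      proof (rule ccontr)
        assume "\<not> n > 0"
        hence "n = 0" by simp
        hence "Zn n \<subseteq> G" using G0 by (simp add: Zn_0)
        with GZ have "G = Zn n" by (rule equalityI)
        thus False using \<open>G \<noteq> Zn n\<close> by contradiction
      qed
      then interpret U: even_unimodular_gram n A by (rule gram)
      obtain k0 where k0: "\<forall>k\<ge>k0. \<exists>x\<in>Zn n - G. qf n A x = 2 * real k"
        using U.proper_subgroup_misses_large_norms[OF GZ \<open>G \<noteq> Zn n\<close> G0 Gd] by (elim exE)
      have "\<exists>m\<in>S. m > 2 * int k0"
      proof (rule ccontr)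
        assume no: "\<not> ?thesis"
        have "S \<subseteq> {0..2 * int k0}"
        proof
          fix m assume m: "m \<in> S"
          hence "m > 0" using assms(3) by blast
          moreover have "\<not> m > 2 * int k0"
          proof
            assume "m > 2 * int k0"
            with m have "\<exists>m\<in>S. m > 2 * int k0" by (rule bexI[rotated])
            with no show False by (rule notE)
          qed
          ultimately show "m \<in> {0..2 * int k0}" by simp
        qed
        thus False using assms(2) finite_subset by blast
      qed
      then obtain m where m: "m \<in> S" "m > 2 * int k0" by (elim bexE)
      have "even m" using assms(3)[OF m(1)] by simp
      then obtain j where j: "m = 2 * j" by (elim evenE)
      have "nat j \<ge> k0" using m(2) j by simp
      from k0[rule_format, OF this]
      obtain x where x: "x \<in> Zn n" "x \<notin> G" "qf n A x = 2 * real (nat j)" by (elim bexE DiffE)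
      have "real_of_int (form (emb x) (emb x)) = of_int m"
        using norm[OF x(1)] x(3) j m(2) by simp
      hence "form (emb x) (emb x) = m" by (simp only: of_int_eq_iff)
      moreover have "emb x \<in> L" unfolding surj[symmetric] using x(1) by (rule imageI)
      ultimately have "emb x \<in> X" using m(1) by (simp add: X_def)
      hence "emb x \<in> group_closure X" by (intro group_closure.base insertI2)
      thus False using x(1,2) by (simp add: G_def)
    qed
    thus ?thesis unfolding X_def .
  qed
qed

end
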